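(* Let $R_0>0$, $\lambda>0$, $\varepsilon>0$. Let $q=q(x_1)$ be a continuous function on $\{x\in\mathbb R^n:|x|\ge R_0\}$ depending only on the first coordinate $x_1$ of $x$ and satisfying $|q(x_1)|\le\lambda^2$. Then each solution $u\in C^2(|x|\ge R_0)$ of the stationary Schrödinger equation $$\Delta u(x)-q(x_1)u(x)=0,\qquad x\in\mathbb R^n,\ |x|\ge R_0,$$ satisfying the estimate $$|u(x)|\le\mathrm{const}\cdot e^{-(\lambda+\varepsilon)|x|}$$ is the identical zero. *)

theory Defs
  imports "HOL-Analysis.Analysis"
begin

text \<open>
  Derivatives are taken relative to the set \<open>S\<close>, so that functions living only on \<open>S\<close> have
  derivatives at boundary points too (one-sided ones, where necessary).  At interior points of \<open>S\<close>
  these are the ordinary derivatives.  The operator \<^const>\<open>frechet_derivative\<close> is defined by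
  choice, but on closed exterior domains \<open>{x. R \<le> norm x}\<close> with \<open>R > 0\<close> the derivative within the
  set is unique at every point, the boundary sphere included.
\<close>

definition partial_within ::
  "(real ^ 'n) set \<Rightarrow> 'n::finite \<Rightarrow> (real ^ 'n \<Rightarrow> complex) \<Rightarrow> real ^ 'n \<Rightarrow> complex" where
  "partial_within S i f x = frechet_derivative f (at x within S) (axis i 1)"

definition C1_on :: "(real ^ 'n::finite) set \<Rightarrow> (real ^ 'n \<Rightarrow> complex) \<Rightarrow> bool" where
  "C1_on S f \<longleftrightarrow> f differentiable_on S \<and> (\<forall>i. continuous_on S (partial_within S i f))"

text \<open>
  On a closed exterior domain this is \<open>C\<^sup>2\<close> up to the boundary: equivalently, all derivatives of
  order at most two in the interior extend continuously to the closed set.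
\<close>

definition C2_on :: "(real ^ 'n::finite) set \<Rightarrow> (real ^ 'n \<Rightarrow> complex) \<Rightarrow> bool" where
  "C2_on S f \<longleftrightarrow> C1_on S f \<and> (\<forall>i. C1_on S (partial_within S i f))"

definition laplacian_within ::
  "(real ^ 'n::finite) set \<Rightarrow> (real ^ 'n \<Rightarrow> complex) \<Rightarrow> real ^ 'n \<Rightarrow> complex" where
  "laplacian_within S f x = (\<Sum>i\<in>UNIV. partial_within S i (partial_within S i f) x)"

end

theory Submission
  imports Defs "HOL-Complex_Analysis.Conformal_Mappings" "HOL-Probability.Characteristic_Functions"
    "HOL-Real_Asymp.Real_Asymp"
begin

text \<open>
  Write \<open>s\<close> for the distinguished coordinate and let \<open>\<phi>'' = (q - \<mu>) \<phi> + \<psi>\<close>, \<open>\<phi> = 0\<close> for \<open>s \<le> a\<close>.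
  Integrating the equation against \<open>\<phi>(s) exp(z y)\<close>, where \<open>y = x \<bullet> e\<close> with \<open>e\<close> orthogonal to the
  \<open>s\<close> axis and \<open>\<mu> = z\<^sup>2 |e|\<^sup>2\<close>, gives \<open>\<integral> u \<psi>(s) exp(z y) = 0\<close> whenever the test function is
  dominated by the decay of \<open>u\<close>.

  In the half space \<open>s > R0\<close> this works for small \<open>z\<close>, because \<open>\<phi>\<close> grows only slightly faster than
  \<open>exp(lam s)\<close>; the integral is holomorphic in a strip around the imaginary axis, so it vanishes at
  \<open>z = \<i>\<close>, and Fourier inversion gives \<open>u = 0\<close> there.

  At the remaining points with \<open>s > 0\<close> one cuts off at \<open>y > b1\<close>, with the corner \<open>s > a\<close>, \<open>y > b\<close>
  (\<open>b < b1\<close>) lying in the exterior domain. Since \<open>u\<close> now vanishes for large \<open>s\<close>, the Laplace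
  transform in \<open>y\<close> extends to an entire function of exponential type. It is bounded in the left half
  plane by its integral representation and on the positive axis because there the equation for \<open>\<phi>\<close>
  is oscillatory. Phragmen-Lindelof and Liouville make it constant, hence zero, and Fourier inversion
  applies again. Negative \<open>s\<close> follow by reflection.
\<close>

section \<open>Integrals depending holomorphically on a parameter\<close>

text \<open>\<open>\<phi>\<close> grows at any rate k with \<open>k^2 > lam^2 + norm \<mu>\<close>.
  In the half space the margin \<open>eps\<close> must pay for \<open>k - lam\<close> and for
  \<open>exp (z y)\<close> together, which it can only do for small z; for large e this fails at z =
  i, hence the detour through analytic continuation. A half space s > a with a < R0 meets the ball,
  where there is no equation. The cutoff in y excludes the ball, at the price of a commutator term
  of size |z| |\<open>\<phi>\<close>|. That term lives in the strip b <= y <= b1, so its transform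
  is entire. On the positive axis \<open>\<phi>\<close> = O(1/z), which cancels the factor z. This
  axis splits the right half plane into quadrants, where order one is below the critical order two;
  in a half plane, order one would be critical. Full Fourier inversion needs all frequencies: the
  source \<open>\<psi>\<close> carries the one along s, z the one along e, and in the corner a
  vector \<open>\<xi>\<close> orthogonal to both carries the rest and shifts \<open>\<mu>\<close> by
  -|\<open>\<xi>\<close>|^2. Since q is merely continuous, \<open>\<phi>\<close> is only C2; all
  cutoffs are therefore built as C2 functions, and only pure second partials occur. Test functions
  vanish near the ball, so the sphere is reached only at the end, by continuity.\<close>

lemma integrable_exp_minus_abs:
  fixes a :: real
  assumes "a > 0"
  shows "integrable lborel (\<lambda>t. exp (- a * \<bar>t\<bar>))"
proof -
  have "((\<lambda>x. exp (- a * x)) has_integral exp (- a * 0) / a) {0..}"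
    using has_integral_exp_minus_to_infinity[OF assms, of 0] by simp
  then have "(\<lambda>x. exp (- a * x)) absolutely_integrable_on {0..}"
    by (intro nonnegative_absolutely_integrable_1) auto
  then have "set_integrable lborel {0..} (\<lambda>x. exp (- a * x))"
    unfolding absolutely_integrable_on_def set_integrable_def
    by (subst (asm) integrable_completion) auto
  then have i1: "integrable lborel (\<lambda>x. indicator {0..} x *\<^sub>R exp (- a * x))"
    by (simp add: set_integrable_def)
  have i2: "integrable lborel (\<lambda>x. indicator {0..} (- x) *\<^sub>R exp (- a * (- x)))"
    using lborel_integrable_real_affine[OF i1, of "-1" 0] by simp
  show ?thesis
    by (rule Bochner_Integration.integrable_bound[OF Bochner_Integration.integrable_add[OF i1 i2]])
      (auto simp: indicator_def)
qed

text \<open>The l1 norm is at most \<open>DIM('a)\<close> times the Euclidean norm, so a product of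
  one-dimensional exponentials of rate \<open>c / DIM('a)\<close> dominates, and its integral
  factorizes.\<close>

lemma integrable_exp_minus_norm:
  fixes c :: real
  assumes "c > 0"
  shows "integrable lborel (\<lambda>x::'a::euclidean_space. exp (- c * norm x))"
proof (rule integrableI_bounded)
  define a where "a = c / DIM('a)"
  have a: "a > 0" using assms by (simp add: a_def)
  have "exp (- c * norm x) \<le> (\<Prod>b\<in>Basis. exp (- a * \<bar>x \<bullet> b\<bar>))" for x :: 'a
  proof -
    have "(\<Sum>b\<in>Basis. \<bar>x \<bullet> b\<bar>) \<le> (\<Sum>b\<in>(Basis::'a set). norm x)"
      by (intro sum_mono) (simp add: Basis_le_norm)
    then have "a * (\<Sum>b\<in>Basis. \<bar>x \<bullet> b\<bar>) \<le> a * (DIM('a) * norm x)"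
      using a by (intro mult_left_mono) auto
    also have "\<dots> = c * norm x" by (simp add: a_def)
    finally show ?thesis
      by (simp add: exp_sum[symmetric] sum_distrib_left sum_negf)
  qed
  then have "(\<integral>\<^sup>+(x::'a). ennreal (norm (exp (- c * norm x))) \<partial>lborel)
      \<le> (\<integral>\<^sup>+(x::'a). (\<Prod>b\<in>Basis. ennreal (exp (- a * \<bar>x \<bullet> b\<bar>))) \<partial>lborel)"
    by (intro nn_integral_mono) (simp add: prod_ennreal ennreal_leI)
  also have "\<dots> = (\<Prod>b\<in>(Basis::'a set). \<integral>\<^sup>+t. ennreal (exp (- a * \<bar>t\<bar>)) \<partial>lborel)"
    by (intro nn_integral_lborel_prod) auto
  also have "\<dots> < \<infinity>"
  proof -
    have "(\<integral>\<^sup>+t. ennreal (exp (- a * \<bar>t\<bar>)) \<partial>lborel) < \<infinity>"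
      using integrable_exp_minus_abs[OF a] unfolding integrable_iff_bounded by simp
    then show ?thesis by (simp add: power_less_top_ennreal)
  qed
  finally show "(\<integral>\<^sup>+(x::'a). ennreal (norm (exp (- c * norm x))) \<partial>lborel) < \<infinity>" .
qed simp

text \<open>Domination of the integrand alone suffices: Cauchy's inequality turns the majorant g
  into the majorant g / r of the z-derivative, hence of the difference quotients, and dominated
  convergence applies to these.\<close>

lemma holomorphic_on_dominated_integral:
  fixes f :: "complex \<Rightarrow> 'a \<Rightarrow> complex"
  assumes S: "open S"
    and meas: "\<And>z. z \<in> S \<Longrightarrow> f z \<in> borel_measurable M"
    and hol: "\<And>x. x \<in> space M \<Longrightarrow> (\<lambda>z. f z x) holomorphic_on S"
    and dom: "\<And>z. z \<in> S \<Longrightarrow> \<exists>r>0. \<exists>g. integrable M g \<and>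
                (\<forall>w\<in>ball z r \<inter> S. \<forall>x\<in>space M. norm (f w x) \<le> g x)"
  shows "(\<lambda>z. LINT x|M. f z x) holomorphic_on S"
proof -
  have int: "integrable M (f z)" if "z \<in> S" for z
  proof -
    obtain r g where "r > 0" "integrable M g" "\<forall>w\<in>ball z r \<inter> S. \<forall>x\<in>space M. norm (f w x) \<le> g x"
      using dom[OF \<open>z \<in> S\<close>] by blast
    then show ?thesis
      using that meas[OF that]
      by (intro Bochner_Integration.integrable_bound[of M g "f z"]) (auto intro!: AE_I2 order_trans[OF _ abs_ge_self])
  qed
  have "\<exists>D. ((\<lambda>z. LINT x|M. f z x) has_field_derivative D) (at z0)" if z0: "z0 \<in> S" for z0
  proof -
    obtain r1 g where r1: "r1 > 0" "integrable M g"
      "\<forall>w\<in>ball z0 r1 \<inter> S. \<forall>x\<in>space M. norm (f w x) \<le> g x"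
      using dom[OF z0] by blast
    obtain r2 where r2: "r2 > 0" "ball z0 r2 \<subseteq> S"
      using S z0 open_contains_ball by blast
    \<comment> \<open>Halving keeps the closed r-disc about every point of \<open>ball z0 r\<close>
      inside both given balls, as Cauchy's inequality requires.\<close>
    define r where "r = min r1 r2 / 2"
    have r: "r > 0" "2 * r \<le> r1" "2 * r \<le> r2" using r1 r2 by (auto simp: r_def)
    have sub: "cball w r \<subseteq> ball z0 r1 \<inter> S" if "w \<in> ball z0 r" for w
    proof
      fix y assume "y \<in> cball w r"
      with that have "dist z0 y < 2 * r" by (auto simp: dist_commute) (metric)
      with r r2 show "y \<in> ball z0 r1 \<inter> S" by auto
    qed
    define f' where "f' x = deriv (\<lambda>z. f z x) z0" for x
    have fd: "((\<lambda>z. f z x) has_field_derivative deriv (\<lambda>z. f z x) w) (at w)"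
      if "x \<in> space M" "w \<in> S" for w x
      using hol[OF that(1)] S that(2) holomorphic_derivI by blast
    have db: "norm (deriv (\<lambda>z. f z x) w) \<le> g x / r" if "x \<in> space M" "w \<in> ball z0 r" for w x
    proof -
      have s: "cball w r \<subseteq> S" using sub[OF that(2)] by blast
      have "norm ((deriv ^^ 1) (\<lambda>z. f z x) w) \<le> fact 1 * g x / r ^ 1"
      proof (rule Cauchy_inequality)
        show "(\<lambda>z. f z x) holomorphic_on ball w r"
          using hol[OF that(1)] s holomorphic_on_subset ball_subset_cball by blast
        show "continuous_on (cball w r) (\<lambda>z. f z x)"
          using hol[OF that(1)] s holomorphic_on_subset holomorphic_on_imp_continuous_on by blast
        fix y assume "norm (w - y) = r"
        then have "y \<in> cball w r" by (simp add: dist_norm)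
        then show "norm (f y x) \<le> g x" using sub[OF that(2)] r1(3) that(1) by blast
      qed (use r in auto)
      then show ?thesis by simp
    qed
    have lip: "norm (f w x - f z0 x) \<le> g x / r * norm (w - z0)" if "x \<in> space M" "w \<in> ball z0 r" for w x
    proof (rule field_differentiable_bound[of "ball z0 r" _ "\<lambda>w. deriv (\<lambda>z. f z x) w"])
      fix y assume y: "y \<in> ball z0 r"
      have "y \<in> S" using sub[OF y] r(1) by auto
      then show "((\<lambda>z. f z x) has_field_derivative deriv (\<lambda>z. f z x) y) (at y within ball z0 r)"
        using fd[OF that(1)] has_field_derivative_at_within by blast
      show "norm (deriv (\<lambda>z. f z x) y) \<le> g x / r" using db[OF that(1) y] .
    qed (use that r in auto)
    have "((\<lambda>y. ((LINT x|M. f y x) - (LINT x|M. f z0 x)) / (y - z0)) \<longlongrightarrow> (LINT x|M. f' x)) (at z0)"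
      unfolding tendsto_at_iff_sequentially
    proof (intro allI impI)
      fix X assume X: "\<forall>i. X i \<in> UNIV - {z0}" "X \<longlonglongrightarrow> z0"
      obtain N where N: "\<And>n. n \<ge> N \<Longrightarrow> X n \<in> ball z0 r"
        using X(2) r(1) unfolding lim_sequentially by (auto simp: dist_commute)
      \<comment> \<open>Dropping the first N terms puts the whole sequence into the disc where the
        Lipschitz bound holds.\<close>
      define Y where "Y n = X (n + N)" for n
      have Y: "Y n \<in> ball z0 r" "Y n \<noteq> z0" "Y n \<in> S" for n
        using N[of "n + N"] X(1) sub[of "Y n"] r(1) by (auto simp: Y_def)
      have Yl: "Y \<longlonglongrightarrow> z0" unfolding Y_def using X(2) by (rule LIMSEQ_ignore_initial_segment)
      have lim: "(\<lambda>n. (f (Y n) x - f z0 x) / (Y n - z0)) \<longlonglongrightarrow> f' x" if "x \<in> space M" for x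
      proof -
        have "((\<lambda>y. (f y x - f z0 x) / (y - z0)) \<longlongrightarrow> f' x) (at z0)"
          using fd[OF that z0] by (simp add: has_field_derivative_iff f'_def)
        then show ?thesis
          using Yl Y(2) unfolding tendsto_at_iff_sequentially by (auto simp: comp_def)
      qed
      have "(\<lambda>n. LINT x|M. (f (Y n) x - f z0 x) / (Y n - z0)) \<longlonglongrightarrow> (LINT x|M. f' x)"
      proof (rule integral_dominated_convergence[where w="\<lambda>x. g x / r"])
        show m: "(\<lambda>x. (f (Y n) x - f z0 x) / (Y n - z0)) \<in> borel_measurable M" for n
          using meas[OF z0] meas[OF Y(3)] by simp
        show "f' \<in> borel_measurable M"
          by (rule borel_measurable_LIMSEQ_metric[of "\<lambda>n x. (f (Y n) x - f z0 x) / (Y n - z0)"]) (use m lim in auto)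
        show "integrable M (\<lambda>x. g x / r)" using r1(2) by simp
        show "AE x in M. (\<lambda>n. (f (Y n) x - f z0 x) / (Y n - z0)) \<longlonglongrightarrow> f' x"
          using lim by (intro AE_I2)
        show "AE x in M. norm ((f (Y n) x - f z0 x) / (Y n - z0)) \<le> g x / r" for n
        proof (intro AE_I2)
          fix x assume "x \<in> space M"
          from lip[OF this Y(1)[of n]] Y(2)[of n]
          show "norm ((f (Y n) x - f z0 x) / (Y n - z0)) \<le> g x / r"
            by (simp add: norm_divide field_simps)
        qed
      qed
      also have "(\<lambda>n. LINT x|M. (f (Y n) x - f z0 x) / (Y n - z0)) =
          (\<lambda>n. ((LINT x|M. f (Y n) x) - (LINT x|M. f z0 x)) / (Y n - z0))"
        using int[OF z0] int[OF Y(3)] by (simp add: diff_divide_distrib)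
      finally have "(\<lambda>n. ((\<lambda>y. ((LINT x|M. f y x) - (LINT x|M. f z0 x)) / (y - z0)) \<circ> X) (n + N))
          \<longlonglongrightarrow> (LINT x|M. f' x)"
        by (simp add: Y_def comp_def)
      then show "((\<lambda>y. ((LINT x|M. f y x) - (LINT x|M. f z0 x)) / (y - z0)) \<circ> X)
          \<longlonglongrightarrow> (LINT x|M. f' x)"
        by (rule LIMSEQ_offset)
    qed
    then show ?thesis unfolding has_field_derivative_iff by blast
  qed
  then show ?thesis
    by (metis has_field_derivative_at_within holomorphic_onI field_differentiable_def)
qed

section \<open>A Phragmen-Lindelof theorem\<close>

text \<open>The damping factor exp(-\<delta> h) has order 3/2, strictly between the order 1 of f and
  the critical order 2 of a quarter plane. It makes f small on a large arc, the maximum principle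
  gives the bound M in the truncated quadrant, and then \<delta> tends to 0.\<close>

lemma phragmen_lindelof_quadrant:
  fixes f :: "complex \<Rightarrow> complex" and A B M :: real
  assumes hol: "f holomorphic_on UNIV"
    and growth: "\<And>z. norm (f z) \<le> A * exp (B * norm z)"
    and bre: "\<And>x. x \<ge> 0 \<Longrightarrow> norm (f (of_real x)) \<le> M"
    and bim: "\<And>y. y \<ge> 0 \<Longrightarrow> norm (f (\<i> * of_real y)) \<le> M"
    and z: "Re z > 0" "Im z > 0"
    and M: "M > 0"
  shows "norm (f z) \<le> M"
proof -
  \<comment> \<open>Arguments up to pi/4 become at most 3 pi/8 < pi/2 under the power 3/2, so c is a
    positive lower bound for the cosine of the argument of \<open>h\<close>.\<close>
  define c :: real where "c = cos (3 * pi / 8)"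
  have c: "c > 0" unfolding c_def by (intro cos_gt_zero_pi) auto
  define w where "w = Complex 1 (-1)" \<comment> \<open>rotates the quadrant to the sector \<open>\<bar>Arg\<bar> \<le> pi / 4\<close>, where \<open>z powr (3/2)\<close> has positive real part\<close>
  have wz: "Re (w * v) = Re v + Im v" "Im (w * v) = Im v - Re v" for v by (auto simp: w_def)
  have nw: "norm w \<ge> 1" by (simp add: w_def cmod_def)
  define h where "h v = (w * v) powr (3/2)" for v
  have hlow: "Re (h v) \<ge> c * norm v powr (3/2)" if "Re v \<ge> 0" "Im v \<ge> 0" for v
  proof (cases "v = 0")
    case False
    then have nz: "w * v \<noteq> 0" using nw by auto
    have pos: "Re (w * v) > 0"
      using that False unfolding wz by (auto simp: complex_eq_iff)
    define t where "t = Im (w * v) / Re (w * v)"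
    have "-1 \<le> t" "t \<le> 1" using that pos unfolding t_def wz by (auto simp: field_simps)
    then have "- (pi / 4) \<le> arctan t" "arctan t \<le> pi / 4"
      using arctan_le_iff[of t 1] arctan_le_iff[of "-1" t]
      by (simp_all add: arctan_one arctan_minus)
    then have "\<bar>3/2 * arctan t\<bar> \<le> 3 * pi / 8"
      by (simp add: abs_le_iff)
    then have "cos (3 * pi / 8) \<le> cos \<bar>3/2 * arctan t\<bar>"
      by (intro cos_monotone_0_pi_le) auto
    then have cc: "c \<le> cos (3/2 * arctan t)" by (simp only: c_def cos_abs_real)
    have "Im (Ln (w * v)) = arctan t"
      using arg_conv_arctan[OF pos] Arg_eq_Im_Ln[OF nz] by (simp add: t_def)
    moreover have "Re (Ln (w * v)) = ln (norm (w * v))" using nz by (simp add: Re_Ln)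
    moreover have "h v = exp (of_real (3/2) * Ln (w * v))" using nz by (simp add: h_def powr_def)
    ultimately have "Re (h v) = exp (3/2 * ln (norm (w * v))) * cos (3/2 * arctan t)"
      by (simp only: Re_exp Re_complex_of_real Im_complex_of_real times_complex.sel) simp
    also have "exp (3/2 * ln (norm (w * v))) = norm (w * v) powr (3/2)"
      using nz by (simp add: powr_def)
    finally have "Re (h v) = norm (w * v) powr (3/2) * cos (3/2 * arctan t)" .
    moreover have "norm (w * v) powr (3/2) \<ge> norm v powr (3/2)"
      using nw by (intro powr_mono2) (auto simp: norm_mult mult_le_cancel_right1)
    ultimately show ?thesis
      using cc c by (metis mult.commute mult_mono order_less_imp_le powr_ge_zero)
  qed (simp add: h_def)
  have main: "norm (f z * exp (- (of_real \<delta> * h z))) \<le> M" if \<delta>: "\<delta> > 0" for \<delta> :: real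
  proof -
    have "((\<lambda>r. exp (B * r - k * r powr (3/2))) \<longlongrightarrow> 0) at_top" if "k > 0" for k :: real
      using that by real_asymp
    from tendsto_mult_right_zero[OF this[OF mult_pos_pos[OF \<delta> c]], of A]
    have "((\<lambda>r. A * exp (B * r - \<delta> * c * r powr (3/2))) \<longlongrightarrow> 0) at_top" .
    \<comment> \<open>Here M > 0 is essential: the bound on the arc only tends to zero.\<close>
    then have "eventually (\<lambda>r. A * exp (B * r - \<delta> * c * r powr (3/2)) < M) at_top"
      using M by (rule order_tendstoD)
    then obtain r where r: "r > norm z" "A * exp (B * r - \<delta> * c * r powr (3/2)) < M"
      using eventually_happens[OF eventually_conj[OF _ eventually_gt_at_top[of "norm z"]]]
      by (metis (no_types, lifting) trivial_limit_at_top_linorder)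
    define S where "S = {v. Re v > 0} \<inter> {v. Im v > 0} \<inter> ball 0 r"
    have oS: "open S" unfolding S_def
      by (intro open_Int open_halfspace_Re_gt open_halfspace_Im_gt open_ball)
    have clS: "closure S \<subseteq> {v. Re v \<ge> 0} \<inter> {v. Im v \<ge> 0} \<inter> cball 0 r"
      by (rule closure_minimal)
        (auto simp: S_def intro!: closed_Int closed_halfspace_Re_ge closed_halfspace_Im_ge)
    show ?thesis
    proof (rule maximum_modulus_frontier[of "\<lambda>v. f v * exp (- (of_real \<delta> * h v))" S])
      have "w * v \<notin> \<real>\<^sub>\<le>\<^sub>0" if "v \<in> S" for v
        using that unfolding complex_nonpos_Reals_iff wz by (auto simp: S_def)
      then show "(\<lambda>v. f v * exp (- (of_real \<delta> * h v))) holomorphic_on interior S"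
        using oS unfolding h_def
        by (auto intro!: holomorphic_intros holomorphic_on_subset[OF hol] simp: interior_open)
      have "continuous_on (closure S) (\<lambda>v. (w * v) powr (3/2))"
      proof (rule continuous_on_powr_complex)
        show "closure S \<subseteq> {v. Re (w * v) \<ge> 0 \<or> Im (w * v) \<noteq> 0}"
          using clS unfolding wz by auto
      qed (auto intro!: continuous_intros)
      then show "continuous_on (closure S) (\<lambda>v. f v * exp (- (of_real \<delta> * h v)))"
        unfolding h_def[symmetric]
        by (intro continuous_intros continuous_on_subset[OF holomorphic_on_imp_continuous_on[OF hol]]) auto
      show "bounded S" by (rule bounded_subset[of "ball 0 r"]) (auto simp: S_def)
      show "z \<in> S" using z r by (auto simp: S_def)
      fix v assume v: "v \<in> frontier S"
      then have v1: "Re v \<ge> 0" "Im v \<ge> 0" "norm v \<le> r" and v2: "v \<notin> S"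
        using clS oS by (auto simp: frontier_def interior_open)
      have nm: "norm (f v * exp (- (of_real \<delta> * h v))) \<le> norm (f v) * exp (- (\<delta> * c * norm v powr (3/2)))"
        using hlow[OF v1(1,2)] \<delta> by (auto simp: norm_mult intro!: mult_left_mono)
      consider "Re v = 0" | "Im v = 0" | "norm v = r"
        using v1 v2 by (auto simp: S_def)
      then show "norm (f v * exp (- (of_real \<delta> * h v))) \<le> M"
      proof cases
        case 1
        then have "v = \<i> * of_real (Im v)" by (simp add: complex_eq_iff)
        then have "norm (f v) \<le> M" using bim[OF v1(2)] by simp
        moreover have "exp (- (\<delta> * c * norm v powr (3/2))) \<le> 1" using \<delta> c by simp
        ultimately show ?thesis using nm
          by (smt (verit) mult_left_le norm_ge_zero)
      next
        case 2
        then have "v = of_real (Re v)" by (simp add: complex_eq_iff)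
        then have "norm (f v) \<le> M" using bre[OF v1(1)] by simp
        moreover have "exp (- (\<delta> * c * norm v powr (3/2))) \<le> 1" using \<delta> c by simp
        ultimately show ?thesis using nm
          by (smt (verit) mult_left_le norm_ge_zero)
      next
        case 3
        have "norm (f v) * exp (- (\<delta> * c * norm v powr (3/2)))
            \<le> A * exp (B * r) * exp (- (\<delta> * c * r powr (3/2)))"
          using growth[of v] unfolding 3 by (intro mult_right_mono) auto
        also have "\<dots> = A * exp (B * r - \<delta> * c * r powr (3/2))"
          by (simp add: exp_diff exp_minus field_simps)
        finally show ?thesis using nm r(2) by linarith
      qed
    qed
  qed
  have "((\<lambda>\<delta>. norm (f z * exp (- (of_real \<delta> * h z)))) \<longlongrightarrow> norm (f z * exp (- (of_real 0 * h z)))) (at_right 0)"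
    by (intro tendsto_intros)
  moreover have "eventually (\<lambda>\<delta>. norm (f z * exp (- (of_real \<delta> * h z))) \<le> M) (at_right 0)"
    using main by (auto simp: eventually_at_right_field intro: exI[of _ 1])
  ultimately have "norm (f z * exp (- (of_real 0 * h z))) \<le> M"
    by (rule tendsto_upperbound) auto
  then show ?thesis by simp
qed

text \<open>What remains is the open right half plane; the positive axis cuts it into two quadrants,
  the lower one being reduced to the upper one by conjugation. So f is bounded and entire.\<close>

lemma phragmen_lindelof_liouville:
  fixes f :: "complex \<Rightarrow> complex" and A B M :: real
  assumes hol: "f holomorphic_on UNIV"
    and growth: "\<And>z. norm (f z) \<le> A * exp (B * norm z)"
    and bre: "\<And>x. x \<ge> 0 \<Longrightarrow> norm (f (of_real x)) \<le> M"
    and bleft: "\<And>z. Re z \<le> 0 \<Longrightarrow> norm (f z) \<le> M"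
  shows "f z = f 0"
proof -
  \<comment> \<open>M may be 0, whereas the quadrant lemma wants a positive bound.\<close>
  define N where "N = M + 1"
  have "M \<ge> 0" using order_trans[OF norm_ge_zero bre[of 0]] by simp
  then have N: "N > 0" "M \<le> N" by (auto simp: N_def)
  define g where "g v = cnj (f (cnj v))" for v
  have holg: "g holomorphic_on UNIV"
  proof -
    have "(cnj \<circ> f \<circ> cnj) holomorphic_on UNIV"
      by (rule holomorphic_on_compose_cnj_cnj) (use hol in auto)
    then show ?thesis by (simp add: g_def[abs_def] comp_def)
  qed
  have "norm (f v) \<le> N" for v
  proof -
    consider "Re v \<le> 0" | "Re v > 0" "Im v > 0" | "Re v > 0" "Im v = 0" | "Re v > 0" "Im v < 0"
      by linarith
    then show ?thesis
    proof cases
      case 1 then show ?thesis using bleft N by force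
    next
      case 2
      show ?thesis
      proof (rule phragmen_lindelof_quadrant[OF hol growth _ _ 2 N(1)])
        show "norm (f (of_real x)) \<le> N" if "x \<ge> 0" for x
          using bre[OF that] N by simp
        show "norm (f (\<i> * of_real x)) \<le> N" for x
          using bleft[of "\<i> * of_real x"] N by simp
      qed
    next
      case 3
      then have "v = of_real (Re v)" by (simp add: complex_eq_iff)
      then show ?thesis using bre[of "Re v"] 3 N by simp
    next
      case 4
      have "norm (g (cnj v)) \<le> N"
      proof (rule phragmen_lindelof_quadrant[OF holg, of A B])
        show "norm (g z) \<le> A * exp (B * norm z)" for z
          using growth[of "cnj z"] by (simp add: g_def)
        show "norm (g (of_real x)) \<le> N" if "x \<ge> 0" for x
          using bre[OF that] N by (simp add: g_def)
        show "norm (g (\<i> * of_real x)) \<le> N" for x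
          using bleft[of "cnj (\<i> * of_real x)"] N by (simp add: g_def)
      qed (use 4 N in auto)
      then show ?thesis by (simp add: g_def)
    qed
  qed
  then have "bounded (range f)" by (auto simp: bounded_iff)
  then show ?thesis
    using Liouville_theorem[OF hol] by (auto simp: constant_on_def)
qed

section \<open>Injectivity of the Fourier transform\<close>

lemma integrable_mult_bounded:
  fixes h g :: "'a \<Rightarrow> complex"
  assumes "integrable M h" "g \<in> borel_measurable M" "\<And>x. x \<in> space M \<Longrightarrow> norm (g x) \<le> K"
  shows "integrable M (\<lambda>x. h x * g x)"
proof (rule Bochner_Integration.integrable_bound[of M "\<lambda>x. K * norm (h x)"])
  show "AE x in M. norm (h x * g x) \<le> norm (K * norm (h x))"
  proof (intro AE_I2)
    fix x assume "x \<in> space M"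
    then have "norm (g x) \<le> \<bar>K\<bar>" using assms(3) abs_ge_self order_trans by blast
    then show "norm (h x * g x) \<le> norm (K * norm (h x))"
      by (simp add: norm_mult abs_mult mult.commute mult_right_mono)
  qed
qed (use assms in auto)

text \<open>The Gaussian is the characteristic function of a standard normal variable t at m (x . b
  - c). Averaging the vanishing transforms at the frequencies \<omega> + t m b over t, with Fubini,
  therefore inserts this factor. The result again holds for every \<omega>, so further directions
  can be treated in the same way.\<close>

lemma fourier_gauss_coordinate:
  fixes h :: "'a::euclidean_space \<Rightarrow> complex" and m c :: real
  assumes h: "integrable lborel h"
    and zero: "\<And>\<omega>. (LINT x|lborel. h x * exp (\<i> * of_real (\<omega> \<bullet> x))) = 0"
  shows "(LINT x|lborel. h x * of_real (exp (- (m * (x \<bullet> b - c))\<^sup>2 / 2)) * exp (\<i> * of_real (\<omega> \<bullet> x))) = 0"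
proof -
  let ?N = "std_normal_distribution"
  interpret N: prob_space ?N by (rule prob_space_normal_density) simp
  interpret P: pair_sigma_finite ?N "lborel :: 'a measure" ..
  let ?F = "\<lambda>t x. h x * exp (\<i> * of_real ((\<omega> + (t * m) *\<^sub>R b) \<bullet> x)) * exp (- \<i> * of_real (t * m * c))"
  have ch: "(LINT t|?N. exp (\<i> * of_real (t * s))) = of_real (exp (- s\<^sup>2 / 2))" for s
    using fun_cong[OF char_std_normal_distribution, of s] by (simp add: char_def mult_ac)
  have inner: "(LINT t|?N. ?F t x) = h x * of_real (exp (- (m * (x \<bullet> b - c))\<^sup>2 / 2)) * exp (\<i> * of_real (\<omega> \<bullet> x))" for x
  proof -
    have eq: "?F t x = (h x * exp (\<i> * of_real (\<omega> \<bullet> x))) * exp (\<i> * of_real (t * (m * (x \<bullet> b - c))))" for t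
      by (simp add: exp_add[symmetric] algebra_simps inner_add_left inner_commute exp_diff exp_minus field_simps)
    show ?thesis
      unfolding eq integral_mult_right_zero ch by (simp only: mult_ac)
  qed
  have meas: "(\<lambda>(t, x). ?F t x) \<in> borel_measurable (?N \<Otimes>\<^sub>M lborel)"
    using h by (auto intro!: borel_measurable_times simp: split_beta)
  have int: "integrable (?N \<Otimes>\<^sub>M lborel) (\<lambda>(t, x). ?F t x)"
  proof (rule P.Fubini_integrable[OF meas])
    show "integrable ?N (\<lambda>x. LINT y|lborel. norm (case (x, y) of (t, x) \<Rightarrow> ?F t x))"
      by (simp add: norm_mult)
    show "AE x in ?N. integrable lborel (\<lambda>y. case (x, y) of (t, x) \<Rightarrow> ?F t x)"
      using h by (auto intro!: AE_I2 integrable_mult_bounded[where K=1])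
  qed
  have "(LINT x|lborel. LINT t|?N. ?F t x) = (LINT t|?N. LINT x|lborel. ?F t x)"
    by (rule P.Fubini_integral[OF int])
  also have "\<dots> = 0" using zero by (simp add: integral_mult_left_zero)
  finally show ?thesis by (simp only: inner)
qed

text \<open>Inserting one Gaussian factor per basis vector, by induction over the basis, builds the
  full Gaussian centred at x0; at the end \<omega> = 0.\<close>

lemma fourier_gauss:
  fixes h :: "'a::euclidean_space \<Rightarrow> complex" and m :: real
  assumes h: "integrable lborel h"
    and zero: "\<And>\<omega>. (LINT x|lborel. h x * exp (\<i> * of_real (\<omega> \<bullet> x))) = 0"
  shows "(LINT x|lborel. h x * of_real (exp (- (m * norm (x - x0))\<^sup>2 / 2))) = 0"
proof -
  let ?g = "\<lambda>B x. of_real (exp (\<Sum>b\<in>B. - (m * (x \<bullet> b - x0 \<bullet> b))\<^sup>2 / 2)) :: complex"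
  have "finite (Basis :: 'a set)" by simp
  then have "\<forall>\<omega>. (LINT x|lborel. h x * ?g Basis x * exp (\<i> * of_real (\<omega> \<bullet> x))) = 0"
  proof (induction rule: finite_induct)
    case empty
    then show ?case using zero by simp
  next
    case (insert b B)
    have i: "integrable lborel (\<lambda>x. h x * ?g B x)"
      by (rule integrable_mult_bounded[OF h, where K=1]) (auto intro!: sum_nonpos)
    have e: "h x * ?g (insert b B) x = h x * ?g B x * of_real (exp (- (m * (x \<bullet> b - x0 \<bullet> b))\<^sup>2 / 2))" for x
      by (simp only: sum.insert[OF insert.hyps] exp_add of_real_mult mult_ac)
    show ?case
      unfolding e using fourier_gauss_coordinate[OF i] insert.IH by blast
  qed
  from this[rule_format, of 0]
  have "(LINT x|lborel. h x * ?g Basis x) = 0" by simp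
  moreover have "(\<Sum>b\<in>Basis. - (m * (x \<bullet> b - x0 \<bullet> b))\<^sup>2 / 2) = - (m * norm (x - x0))\<^sup>2 / 2" for x
  proof -
    have "(norm (x - x0))\<^sup>2 = (\<Sum>b\<in>Basis. (x \<bullet> b - x0 \<bullet> b)\<^sup>2)"
      by (subst norm_eq_sqrt_inner, subst euclidean_inner)
        (simp add: inner_diff_left power2_eq_square sum_nonneg)
    then show ?thesis
      by (simp add: power_mult_distrib sum_distrib_left sum_divide_distrib sum_negf)
  qed
  ultimately show ?thesis by simp
qed

text \<open>Gaussians concentrating at x0 act as an approximate identity. Continuity is asked only
  at x0 because the function used in the corner jumps across a hyperplane; the uniform bound K
  supplies the majorant.\<close>

lemma fourier_zero_imp_zero:
  fixes h :: "'a::euclidean_space \<Rightarrow> complex"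
  assumes h: "integrable lborel h"
    and bd: "\<And>x. norm (h x) \<le> K"
    and cont: "isCont h x0"
    and zero: "\<And>\<omega>. (LINT x|lborel. h x * exp (\<i> * of_real (\<omega> \<bullet> x))) = 0"
  shows "h x0 = 0"
proof -
  let ?G = "\<lambda>x::'a. exp (- (norm x)\<^sup>2 / 2)"
  have [measurable]: "h \<in> borel_measurable borel" using h by auto
  have iG: "integrable lborel ?G"
  proof (rule Bochner_Integration.integrable_bound[of _ "\<lambda>x::'a. exp 1 * exp (- 1 * norm x)"])
    show "integrable lborel (\<lambda>x::'a. exp 1 * exp (- 1 * norm x))"
      using integrable_exp_minus_norm[of 1] by auto
    have "0 \<le> (norm x - 1)\<^sup>2" for x :: 'a by simp
    then have le: "norm x * 2 \<le> 1 + (norm x)\<^sup>2" for x :: 'a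
      unfolding power2_diff by (simp add: field_simps)
    have "- (norm x)\<^sup>2 / 2 \<le> 1 - norm x" for x :: 'a
      using le[of x] by simp
    then show "AE x in lborel. norm (?G x) \<le> norm (exp 1 * exp (- 1 * norm x))"
      by (intro AE_I2) (simp add: exp_add[symmetric])
  qed auto
  have z: "(LINT y|lborel. h (x0 + (1 / real (Suc n)) *\<^sub>R y) * of_real (?G y)) = 0" for n
  proof -
    let ?c = "1 / real (Suc n)"
    have "(LINT x|lborel. h x * of_real (exp (- (real (Suc n) * norm (x - x0))\<^sup>2 / 2))) = 0"
      by (rule fourier_gauss[OF h zero])
    \<comment> \<open>The substitution x = x0 + c y, carried out on the measure, moves the scaling
      from the Gaussian into the argument of h.\<close>
    also have "lborel = density (distr lborel borel (\<lambda>x. x0 + ?c *\<^sub>R x)) (\<lambda>_. ennreal (\<bar>?c\<bar>^DIM('a)))"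
      using lborel_affine[of ?c x0] by (simp add: ennreal_power)
    finally have "(LINT y|lborel. (\<bar>?c\<bar>^DIM('a)) *\<^sub>R (h (x0 + ?c *\<^sub>R y) * of_real (exp (- (real (Suc n) * norm (x0 + ?c *\<^sub>R y - x0))\<^sup>2 / 2)))) = 0"
      by (subst (asm) integral_density) (auto simp: integral_distr)
    then show ?thesis by simp
  qed
  have "(\<lambda>n. LINT y|lborel. h (x0 + (1 / real (Suc n)) *\<^sub>R y) * of_real (?G y))
      \<longlonglongrightarrow> (LINT y|lborel. h x0 * of_real (?G y))"
  proof (rule integral_dominated_convergence[where w="\<lambda>y. K * ?G y"])
    show "AE y in lborel. (\<lambda>n. h (x0 + (1 / real (Suc n)) *\<^sub>R y) * of_real (?G y)) \<longlonglongrightarrow> h x0 * of_real (?G y)"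
    proof (intro AE_I2 tendsto_mult tendsto_const)
      fix y :: 'a
      have "(\<lambda>n. x0 + (1 / real (Suc n)) *\<^sub>R y) \<longlonglongrightarrow> x0 + 0 *\<^sub>R y"
        by (intro tendsto_intros LIMSEQ_inverse_real_of_nat[unfolded inverse_eq_divide])
      then show "(\<lambda>n. h (x0 + (1 / real (Suc n)) *\<^sub>R y)) \<longlonglongrightarrow> h x0"
        using cont isCont_tendsto_compose by fastforce
    qed
    show "AE y in lborel. norm (h (x0 + (1 / real (Suc n)) *\<^sub>R y) * of_real (?G y)) \<le> K * ?G y" for n
      using bd by (intro AE_I2) (simp add: norm_mult mult_right_mono)
  qed (use iG in auto)
  then have "(LINT y|lborel. h x0 * of_real (?G y)) = 0"
    unfolding z using LIMSEQ_unique tendsto_const by metis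
  then have "h x0 * of_real (LINT y|lborel. ?G y) = 0" by (simp add: integral_mult_right_zero)
  moreover have "(LINT y|lborel. ?G y) \<noteq> 0"
  proof
    assume "(LINT y|lborel. ?G y) = 0"
    then have "AE y in lborel. ?G y = 0"
      using integral_nonneg_eq_0_iff_AE[OF iG] by auto
    then have "AE y in (lborel :: 'a measure). False" by simp
    then have "emeasure lborel (UNIV :: 'a set) = 0" by (simp add: AE_iff_measurable[of UNIV])
    then show False by (simp add: emeasure_lborel_UNIV)
  qed
  ultimately show ?thesis by simp
qed

section \<open>A linear ordinary differential equation with parameter\<close>

text \<open>Uniform convergence is taken on a ray unbounded to the left: the series in view vanish
  left of their starting point, so exponential bounds give summable majorants on every such
  ray.\<close>

lemma has_vector_derivative_suminf:
  fixes f f' :: "nat \<Rightarrow> real \<Rightarrow> 'a::banach"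
  assumes der: "\<And>n x. x < b \<Longrightarrow> (f n has_vector_derivative f' n x) (at x)"
    and bd: "\<And>n x. x < b \<Longrightarrow> norm (f' n x) \<le> M n"
    and M: "summable M"
    and sm: "\<And>x. x < b \<Longrightarrow> summable (\<lambda>n. f n x)"
    and x: "x < b"
  shows "((\<lambda>x. \<Sum>n. f n x) has_vector_derivative (\<Sum>n. f' n x)) (at x)"
proof -
  have ul: "uniform_limit {..<b} (\<lambda>n x. \<Sum>i<n. f' i x) (\<lambda>x. \<Sum>i. f' i x) sequentially"
    by (rule Weierstrass_m_test[of _ _ M]) (use bd M in auto)
  have "\<exists>g. \<forall>x\<in>{..<b}. (\<lambda>n. f n x) sums (g x) \<and>
      (g has_derivative (\<lambda>h. h *\<^sub>R (\<Sum>i. f' i x))) (at x within {..<b})"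
  proof (rule has_derivative_series[where x = x])
    show "(f n has_derivative (\<lambda>h. h *\<^sub>R f' n y)) (at y within {..<b})" if "y \<in> {..<b}" for n y
      using der[of y n] that
      by (auto simp: has_vector_derivative_def intro: has_derivative_at_withinI)
    show "\<forall>\<^sub>F n in sequentially. \<forall>y\<in>{..<b}. \<forall>h. norm ((\<Sum>i<n. h *\<^sub>R f' i y) - h *\<^sub>R (\<Sum>i. f' i y)) \<le> e * norm h"
      if "e > 0" for e
      using uniform_limitD[OF ul that]
    proof eventually_elim
      case (elim n)
      show ?case
      proof (intro ballI allI)
        fix y h assume "y \<in> {..<b}"
        then have "norm ((\<Sum>i<n. f' i y) - (\<Sum>i. f' i y)) \<le> e"
          using elim by (auto simp: dist_norm intro: less_imp_le)
        then have "\<bar>h\<bar> * norm ((\<Sum>i<n. f' i y) - (\<Sum>i. f' i y)) \<le> \<bar>h\<bar> * e"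
          by (intro mult_left_mono) auto
        moreover have "(\<Sum>i<n. h *\<^sub>R f' i y) - h *\<^sub>R (\<Sum>i. f' i y) = h *\<^sub>R ((\<Sum>i<n. f' i y) - (\<Sum>i. f' i y))"
          by (simp add: scaleR_right_diff_distrib scaleR_sum_right)
        ultimately show "norm ((\<Sum>i<n. h *\<^sub>R f' i y) - h *\<^sub>R (\<Sum>i. f' i y)) \<le> e * norm h"
          by (simp add: mult.commute)
      qed
    qed
    show "(\<lambda>n. f n x) sums (\<Sum>n. f n x)" using sm[OF x] by (rule summable_sums)
  qed (use x in auto)
  then obtain g where g: "\<And>y. y < b \<Longrightarrow> (\<lambda>n. f n y) sums (g y)"
    "(g has_derivative (\<lambda>h. h *\<^sub>R (\<Sum>i. f' i x))) (at x within {..<b})"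
    using x by auto
  have "(g has_derivative (\<lambda>h. h *\<^sub>R (\<Sum>i. f' i x))) (at x)"
    using g(2) x by (simp add: at_within_open[of x "{..<b}"])
  then have "((\<lambda>x. \<Sum>n. f n x) has_derivative (\<lambda>h. h *\<^sub>R (\<Sum>i. f' i x))) (at x)"
    by (rule has_derivative_transform_within_open[of _ _ _ _ "{..<b}"])
      (use x g(1) in \<open>auto simp: sums_iff\<close>)
  then show ?thesis by (simp add: has_vector_derivative_def)
qed

text \<open>For s < a the interval \<open>{a..s}\<close> is empty and the integral is 0, which
  agrees with f vanishing there. This makes the derivative two-sided on the whole line; in the proof
  the base point is moved below both a and s.\<close>

lemma has_vector_derivative_integral_from:
  fixes f :: "real \<Rightarrow> 'a::euclidean_space"
  assumes f: "continuous_on UNIV f" and z: "\<And>t. t \<le> a \<Longrightarrow> f t = 0"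
  shows "((\<lambda>s. integral {a..s} f) has_vector_derivative f s) (at s)"
proof -
  define b c where "b = min a s - 1" and "c = max a s + 1"
  have eq: "integral {b..t} f = integral {a..t} f" if "t > b" for t
  proof (cases "t \<ge> a")
    case True
    have "integral {b..a} f = integral {b..a} (\<lambda>_. 0)"
      by (rule integral_cong) (use z in auto)
    moreover have "f integrable_on {b..t}"
      by (intro integrable_continuous_real continuous_on_subset[OF f]) auto
    ultimately show ?thesis
      using Henstock_Kurzweil_Integration.integral_combine[of b a t f] True
      by (simp add: b_def)
  next
    case False
    have "integral {b..t} f = integral {b..t} (\<lambda>_. 0)"
      by (rule integral_cong) (use z False in auto)
    then show ?thesis using False by simp
  qed
  have "((\<lambda>u. integral {b..u} f) has_vector_derivative f s) (at s within {b..c})"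
    by (rule integral_has_vector_derivative) (use f in \<open>auto simp: b_def c_def intro: continuous_on_subset\<close>)
  then have "((\<lambda>u. integral {b..u} f) has_vector_derivative f s) (at s)"
    by (subst (asm) at_within_Icc_at) (auto simp: b_def c_def)
  then show ?thesis
    by (rule has_vector_derivative_transform_within_open[of _ _ _ "{b<..}"])
      (use eq in \<open>auto simp: b_def\<close>)
qed

text \<open>In the norm weighted by exp(-k (s - a)), each integration gains a factor 1/k. Two of
  them produce the contraction ratio K / k^2 of the Picard iteration.\<close>

lemma integral_from_exp_bound:
  fixes f :: "real \<Rightarrow> 'a::euclidean_space"
  assumes f: "continuous_on UNIV f" and k: "k > 0" and B: "B \<ge> 0"
    and bd: "\<And>t. a \<le> t \<Longrightarrow> norm (f t) \<le> B * exp (k * (t - a))"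
    and s: "a \<le> s"
  shows "norm (integral {a..s} f) \<le> B / k * exp (k * (s - a))"
proof -
  have d: "((\<lambda>t. B * exp (k * (t - a))) has_integral (B / k * exp (k * (s - a)) - B / k * exp (k * (a - a)))) {a..s}"
    by (rule fundamental_theorem_of_calculus[OF s])
      (use k in \<open>auto intro!: derivative_eq_intros simp flip: has_real_derivative_iff_has_vector_derivative\<close>)
  have "norm (integral {a..s} f) \<le> integral {a..s} (\<lambda>t. B * exp (k * (t - a)))"
    by (rule integral_norm_bound_integral)
      (use bd d in \<open>auto intro!: integrable_continuous_real continuous_on_subset[OF f] continuous_intros\<close>)
  also have "\<dots> = B / k * exp (k * (s - a)) - B / k * exp (k * (a - a))"
    using d by (rule integral_unique)
  also have "\<dots> \<le> B / k * exp (k * (s - a))" using k B by simp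
  finally show ?thesis .
qed

lemma holomorphic_integral_Icc:
  fixes f :: "complex \<Rightarrow> real \<Rightarrow> complex"
  assumes c: "\<And>z. continuous_on UNIV (f z)"
    and h: "\<And>t. (\<lambda>z. f z t) holomorphic_on UNIV"
    and b: "\<And>z0. \<exists>K. \<forall>z\<in>ball z0 1. \<forall>t\<in>{a..b}. norm (f z t) \<le> K"
  shows "(\<lambda>z. integral {a..b} (f z)) holomorphic_on UNIV"
proof -
  have eq: "integral {a..b} (f z) = (LINT t|lborel. indicator {a..b} t *\<^sub>R f z t)" for z
    using set_borel_integral_eq_integral(2)[OF borel_integrable_atLeastAtMost'[of a b "f z"]]
      continuous_on_subset[OF c] by (simp add: set_lebesgue_integral_def)
  show ?thesis unfolding eq
  proof (rule holomorphic_on_dominated_integral)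
    show "(\<lambda>t. indicator {a..b} t *\<^sub>R f z t) \<in> borel_measurable lborel" for z
      using borel_measurable_continuous_onI[OF c[of z]] by auto
    show "(\<lambda>z. indicator {a..b} t *\<^sub>R f z t) holomorphic_on UNIV" for t
      by (cases "t \<in> {a..b}") (use h in auto)
    fix z0
    obtain K where K: "\<forall>z\<in>ball z0 1. \<forall>t\<in>{a..b}. norm (f z t) \<le> K" using b by blast
    have "integrable lborel (\<lambda>t. indicator {a..b} t *\<^sub>R K)"
      using borel_integrable_atLeastAtMost'[of a b "\<lambda>_. K"] by (simp add: set_integrable_def)
    moreover have "\<forall>w\<in>ball z0 1 \<inter> UNIV. \<forall>t\<in>space lborel. norm (indicator {a..b} t *\<^sub>R f w t) \<le> indicator {a..b} t *\<^sub>R K"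
      using K by (auto simp: indicator_def)
    ultimately show "\<exists>r>0. \<exists>g. integrable lborel g \<and>
       (\<forall>w\<in>ball z0 r \<inter> UNIV. \<forall>t\<in>space lborel. norm (indicator {a..b} t *\<^sub>R f w t) \<le> g t)"
      using zero_less_one by blast
  qed auto
qed

section \<open>The Picard series, its geometric majorants and its dependence on the
  parameter\<close>

lemma norm_suminf_geometric:
  fixes f :: "nat \<Rightarrow> complex"
  assumes "\<And>n. norm (f n) \<le> C * r ^ n * e" "0 \<le> r" "r < 1"
  shows "summable f" "norm (suminf f) \<le> C / (1 - r) * e"
proof -
  have s: "(\<lambda>n. C * r ^ n * e) sums (C * (1 / (1 - r)) * e)"
    using assms by (intro sums_mult sums_mult2 geometric_sums) auto
  then have sm: "summable (\<lambda>n. C * r ^ n * e)" by (simp add: sums_iff)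
  show "summable f" using summable_comparison_test'[OF sm, of 0] assms(1) by auto
  have "norm (suminf f) \<le> (\<Sum>n. C * r ^ n * e)"
    by (rule norm_suminf_le[OF _ sm]) (use assms in auto)
  then show "norm (suminf f) \<le> C / (1 - r) * e" using s by (simp add: sums_iff)
qed

text \<open>The setting of \<phi>'' = (q - \<mu>) \<phi> + psi with zero data at a. The number \<mu>
  is an argument of the solution instead of a locale parameter, since holomorphy in \<mu> is one of
  the goals.\<close>

locale volterra =
  fixes q psi :: "real \<Rightarrow> complex" and a Q P :: real
  assumes q_cont: "continuous_on UNIV q" and q_bound: "\<And>t. norm (q t) \<le> Q"
    and psi_cont: "continuous_on UNIV psi" and psi_bound: "\<And>t. norm (psi t) \<le> P"
    and psi_zero: "\<And>t. t \<le> a \<Longrightarrow> psi t = 0"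
begin

lemma Q_nonneg: "Q \<ge> 0" using q_bound[of 0] norm_ge_zero order_trans by blast
lemma P_nonneg: "P \<ge> 0" using psi_bound[of 0] norm_ge_zero order_trans by blast

text \<open>The suffix counts derivatives: the solution is the sum over \<open>n\<close> of \<open>picard0 n \<mu>\<close>.\<close>

primrec picard2 :: "nat \<Rightarrow> complex \<Rightarrow> real \<Rightarrow> complex" where
  "picard2 0 \<mu> = psi"
| "picard2 (Suc n) \<mu> = (\<lambda>s. (q s - \<mu>) * integral {a..s} (\<lambda>t. integral {a..t} (picard2 n \<mu>)))"

definition "picard1 n \<mu> s = integral {a..s} (picard2 n \<mu>)"
definition "picard0 n \<mu> s = integral {a..s} (picard1 n \<mu>)"

lemma picard2_Suc: "picard2 (Suc n) \<mu> s = (q s - \<mu>) * picard0 n \<mu> s"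
  by (simp add: picard0_def picard1_def[abs_def])

lemma picard_zero:
  assumes "s \<le> a"
  shows "picard0 n \<mu> s = 0" "picard1 n \<mu> s = 0" "picard2 n \<mu> s = 0"
proof -
  show 0: "picard0 n \<mu> s = 0" "picard1 n \<mu> s = 0" for n
    using assms by (cases "s = a"; simp add: picard0_def picard1_def)+
  show "picard2 n \<mu> s = 0"
    using assms psi_zero 0 by (cases n) (simp_all add: picard2_Suc del: picard2.simps(2))
qed

lemma picard_props:
  "continuous_on UNIV (picard2 n \<mu>)"
  "(picard1 n \<mu> has_vector_derivative picard2 n \<mu> s) (at s)"
  "(picard0 n \<mu> has_vector_derivative picard1 n \<mu> s) (at s)"
proof -
  have 1: "(picard1 n \<mu> has_vector_derivative picard2 n \<mu> s) (at s)" if "continuous_on UNIV (picard2 n \<mu>)" for n s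
    unfolding picard1_def[abs_def]
    by (rule has_vector_derivative_integral_from[OF that]) (rule picard_zero)
  have 0: "(picard0 n \<mu> has_vector_derivative picard1 n \<mu> s) (at s)" if "continuous_on UNIV (picard2 n \<mu>)" for n s
  proof -
    have "continuous_on UNIV (picard1 n \<mu>)"
      by (rule continuous_on_vector_derivative) (use 1[OF that] has_vector_derivative_at_within in blast)
    then show ?thesis
      unfolding picard0_def[abs_def]
      by (rule has_vector_derivative_integral_from) (rule picard_zero)
  qed
  have 2: "continuous_on UNIV (picard2 n \<mu>)" for n
  proof (induction n)
    case (Suc n)
    have "continuous_on UNIV (picard0 n \<mu>)"
      by (rule continuous_on_vector_derivative) (use 0[OF Suc] has_vector_derivative_at_within in blast)
    then show ?case
      unfolding picard2_Suc[abs_def] by (intro continuous_intros q_cont)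
  qed (simp add: psi_cont)
  show "continuous_on UNIV (picard2 n \<mu>)"
    "(picard1 n \<mu> has_vector_derivative picard2 n \<mu> s) (at s)"
    "(picard0 n \<mu> has_vector_derivative picard1 n \<mu> s) (at s)"
    using 2 1[OF 2] 0[OF 2] by auto
qed

lemma picard_cont: "continuous_on UNIV (picard1 n \<mu>)" "continuous_on UNIV (picard0 n \<mu>)"
  by (rule continuous_on_vector_derivative, use picard_props has_vector_derivative_at_within in blast)+

text \<open>The rate k is free, so it can be tuned to the decay of u. The separate bound K allows
  the same estimate to hold uniformly for \<mu> in a disc.\<close>

lemma picard_bound:
  assumes k: "k > 0" and s: "a \<le> s" and K: "Q + norm \<mu> \<le> K"
  shows "norm (picard2 n \<mu> s) \<le> P * (K / k\<^sup>2) ^ n * exp (k * (s - a))"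
    "norm (picard1 n \<mu> s) \<le> P / k * (K / k\<^sup>2) ^ n * exp (k * (s - a))"
    "norm (picard0 n \<mu> s) \<le> P / k\<^sup>2 * (K / k\<^sup>2) ^ n * exp (k * (s - a))"
proof -
  have K0: "K \<ge> 0" using K Q_nonneg norm_ge_zero[of \<mu>] by linarith
  have 1: "norm (picard1 n \<mu> s) \<le> P / k * (K / k\<^sup>2) ^ n * exp (k * (s - a))"
    if "\<And>s. a \<le> s \<Longrightarrow> norm (picard2 n \<mu> s) \<le> P * (K / k\<^sup>2) ^ n * exp (k * (s - a))" "a \<le> s" for n s
    using integral_from_exp_bound[OF picard_props(1) k _ that(1,2)] P_nonneg K0
    by (simp add: picard1_def)
  have 0: "norm (picard0 n \<mu> s) \<le> P / k\<^sup>2 * (K / k\<^sup>2) ^ n * exp (k * (s - a))"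
    if "\<And>s. a \<le> s \<Longrightarrow> norm (picard2 n \<mu> s) \<le> P * (K / k\<^sup>2) ^ n * exp (k * (s - a))" "a \<le> s" for n s
    using integral_from_exp_bound[OF picard_cont(1) k _ 1[OF that(1)] that(2)] P_nonneg K0 k
    by (simp add: picard0_def power2_eq_square)
  have 2: "norm (picard2 n \<mu> s) \<le> P * (K / k\<^sup>2) ^ n * exp (k * (s - a))" if "a \<le> s" for n s
    using that
  proof (induction n arbitrary: s)
    case 0
    have "norm (psi s) \<le> P * 1" using psi_bound by simp
    also have "\<dots> \<le> P * exp (k * (s - a))"
      using 0 k P_nonneg by (intro mult_left_mono) auto
    finally show ?case by simp
  next
    case (Suc n)
    have "norm (q s - \<mu>) \<le> K" using q_bound[of s] K norm_triangle_ineq4[of "q s" \<mu>] by linarith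
    then have "norm (picard2 (Suc n) \<mu> s) \<le> K * (P / k\<^sup>2 * (K / k\<^sup>2) ^ n * exp (k * (s - a)))"
      unfolding picard2_Suc norm_mult using 0[OF Suc.IH Suc.prems] K0 by (intro mult_mono) auto
    also have "\<dots> = P * (K / k\<^sup>2) ^ Suc n * exp (k * (s - a))"
      by (simp add: field_simps)
    finally show ?case .
  qed
  show "norm (picard2 n \<mu> s) \<le> P * (K / k\<^sup>2) ^ n * exp (k * (s - a))"
    "norm (picard1 n \<mu> s) \<le> P / k * (K / k\<^sup>2) ^ n * exp (k * (s - a))"
    "norm (picard0 n \<mu> s) \<le> P / k\<^sup>2 * (K / k\<^sup>2) ^ n * exp (k * (s - a))"
    using 2[OF s] 1[OF 2 s] 0[OF 2 s] by auto
qed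

definition "sol \<mu> s = (\<Sum>n. picard0 n \<mu> s)"
definition "sol1 \<mu> s = (\<Sum>n. picard1 n \<mu> s)"

lemma sol_zero: "s \<le> a \<Longrightarrow> sol \<mu> s = 0" "s \<le> a \<Longrightarrow> sol1 \<mu> s = 0"
  by (simp_all add: sol_def sol1_def picard_zero)

text \<open>Summing the geometric series works for every k above the square root of
  \<open>Q + norm \<mu>\<close>; with \<open>Q = lam\<^sup>2\<close> and small \<mu> this is a
  growth rate as close to \<open>lam\<close> as desired.\<close>

lemma sol_bound:
  assumes k: "k > 0" "Q + norm \<mu> < k\<^sup>2" and s: "a \<le> s"
  shows "norm (sol \<mu> s) \<le> P / (k\<^sup>2 - (Q + norm \<mu>)) * exp (k * (s - a))"
    "norm (sol1 \<mu> s) \<le> k * P / (k\<^sup>2 - (Q + norm \<mu>)) * exp (k * (s - a))"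
    "summable (\<lambda>n. picard0 n \<mu> s)" "summable (\<lambda>n. picard1 n \<mu> s)" "summable (\<lambda>n. picard2 n \<mu> s)"
proof -
  let ?r = "(Q + norm \<mu>) / k\<^sup>2"
  have r: "0 \<le> ?r" "?r < 1" using k Q_nonneg by auto
  note b = picard_bound[OF k(1) s order_refl[of "Q + norm \<mu>"]]
  note S = norm_suminf_geometric[OF b(3) r] norm_suminf_geometric[OF b(2) r] norm_suminf_geometric[OF b(1) r]
  have "P / k\<^sup>2 / (1 - ?r) = P / (k\<^sup>2 - (Q + norm \<mu>))" "P / k / (1 - ?r) = k * P / (k\<^sup>2 - (Q + norm \<mu>))"
    using k by (auto simp: field_simps power2_eq_square)
  then show "norm (sol \<mu> s) \<le> P / (k\<^sup>2 - (Q + norm \<mu>)) * exp (k * (s - a))"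
    "norm (sol1 \<mu> s) \<le> k * P / (k\<^sup>2 - (Q + norm \<mu>)) * exp (k * (s - a))"
    "summable (\<lambda>n. picard0 n \<mu> s)" "summable (\<lambda>n. picard1 n \<mu> s)" "summable (\<lambda>n. picard2 n \<mu> s)"
    using S by (auto simp: sol_def sol1_def)
qed

lemma sol_deriv:
  "(sol \<mu> has_vector_derivative sol1 \<mu> s) (at s)"
  "(sol1 \<mu> has_vector_derivative ((q s - \<mu>) * sol \<mu> s + psi s)) (at s)"
proof -
  \<comment> \<open>Any rate will do here, as only convergence matters; k >= 1 gives k^2 >= k > Q +
    |\<mu>|.\<close>
  define k where "k = Q + norm \<mu> + 2"
  have k: "k > 0" "Q + norm \<mu> < k\<^sup>2" "k \<ge> 1"
  proof -
    show k1: "k > 0" "k \<ge> 1" using Q_nonneg by (auto simp: k_def add_nonneg_pos)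
    then show "Q + norm \<mu> < k\<^sup>2" using self_le_power[of k 2] by (auto simp: k_def)
  qed
  let ?r = "(Q + norm \<mu>) / k\<^sup>2"
  have r: "0 \<le> ?r" "?r < 1" using k Q_nonneg by auto
  define b where "b = max a s + 1"
  have sb: "s < b" by (simp add: b_def)
  have sm: "summable (\<lambda>n. picard0 n \<mu> t)" "summable (\<lambda>n. picard1 n \<mu> t)" "summable (\<lambda>n. picard2 n \<mu> t)" for t
    by (cases "a \<le> t"; use sol_bound(3-5)[OF k(1,2)] in \<open>simp add: picard_zero\<close>)+
  have mono: "exp (k * (t - a)) \<le> exp (k * (b - a))" if "t < b" for t
    using that k by simp
  have sg: "summable (\<lambda>n. C * ?r ^ n * e)" for C e
    using r by (intro summable_mult summable_mult2 summable_geometric) auto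
  have b1: "norm (picard1 n \<mu> t) \<le> P / k * ?r ^ n * exp (k * (b - a))" if "t < b" for n t
  proof (cases "a \<le> t")
    case True
    have "norm (picard1 n \<mu> t) \<le> P / k * ?r ^ n * exp (k * (t - a))"
      by (rule picard_bound[OF k(1) True order_refl])
    also have "\<dots> \<le> P / k * ?r ^ n * exp (k * (b - a))"
      using mono[OF that] r k P_nonneg by (intro mult_left_mono) auto
    finally show ?thesis .
  qed (use r k P_nonneg in \<open>simp add: picard_zero\<close>)
  have b2: "norm (picard2 n \<mu> t) \<le> P * ?r ^ n * exp (k * (b - a))" if "t < b" for n t
  proof (cases "a \<le> t")
    case True
    have "norm (picard2 n \<mu> t) \<le> P * ?r ^ n * exp (k * (t - a))"
      by (rule picard_bound[OF k(1) True order_refl])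
    also have "\<dots> \<le> P * ?r ^ n * exp (k * (b - a))"
      using mono[OF that] r k P_nonneg by (intro mult_left_mono) auto
    finally show ?thesis .
  qed (use r k P_nonneg in \<open>simp add: picard_zero\<close>)
  show "(sol \<mu> has_vector_derivative sol1 \<mu> s) (at s)"
    unfolding sol_def[abs_def] sol1_def
    by (rule has_vector_derivative_suminf[OF picard_props(3) b1 sg sm(1) sb])
  have "(sol1 \<mu> has_vector_derivative (\<Sum>n. picard2 n \<mu> s)) (at s)"
    unfolding sol1_def[abs_def]
    by (rule has_vector_derivative_suminf[OF picard_props(2) b2 sg sm(2) sb])
  \<comment> \<open>Splitting off the head exhibits the differential equation: the head is the
    source, and the shifted series is (q - \<mu>) times the solution.\<close>
  also have "(\<Sum>n. picard2 n \<mu> s) = picard2 0 \<mu> s + (\<Sum>n. picard2 (Suc n) \<mu> s)"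
    using suminf_split_head[OF sm(3)[of s]] by simp
  also have "(\<Sum>n. picard2 (Suc n) \<mu> s) = (q s - \<mu>) * sol \<mu> s"
    unfolding picard2_Suc sol_def by (rule suminf_mult[OF sm(1)])
  finally show "(sol1 \<mu> has_vector_derivative ((q s - \<mu>) * sol \<mu> s + psi s)) (at s)"
    by (simp add: add.commute)
qed

text \<open>On a unit disc in the parameter, Q + |z| stays below k - 1, so the ratio (k - 1) / k^2 <
  1 does not depend on z. This is the locally uniform convergence behind holomorphy in
  \<mu>.\<close>

lemma picard_local_bound:
  assumes "t \<in> {a..s}" "z \<in> ball z0 1"
  defines "k \<equiv> Q + norm z0 + 2"
  shows "norm (picard2 n z t) \<le> P * ((k - 1) / k\<^sup>2) ^ n * exp (k * (s - a))"
    "norm (picard1 n z t) \<le> P / k * ((k - 1) / k\<^sup>2) ^ n * exp (k * (s - a))"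
    "norm (picard0 n z t) \<le> P / k\<^sup>2 * ((k - 1) / k\<^sup>2) ^ n * exp (k * (s - a))"
proof -
  have k: "k \<ge> 2" "k > 0" using Q_nonneg by (auto simp: k_def add_nonneg_pos)
  have nz: "Q + norm z \<le> k - 1"
    using assms(2) norm_triangle_ineq2[of z z0] by (auto simp: k_def dist_norm norm_minus_commute)
  have e: "exp (k * (t - a)) \<le> exp (k * (s - a))" using assms(1) k by simp
  have "a \<le> t" using assms(1) by simp
  note b = picard_bound[OF k(2) this nz, of n]
  show "norm (picard2 n z t) \<le> P * ((k - 1) / k\<^sup>2) ^ n * exp (k * (s - a))"
    by (rule order_trans[OF b(1)]) (use e k P_nonneg in \<open>intro mult_left_mono; simp\<close>)
  show "norm (picard1 n z t) \<le> P / k * ((k - 1) / k\<^sup>2) ^ n * exp (k * (s - a))"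
    by (rule order_trans[OF b(2)]) (use e k P_nonneg in \<open>intro mult_left_mono; simp\<close>)
  show "norm (picard0 n z t) \<le> P / k\<^sup>2 * ((k - 1) / k\<^sup>2) ^ n * exp (k * (s - a))"
    by (rule order_trans[OF b(3)]) (use e k P_nonneg in \<open>intro mult_left_mono; simp\<close>)
qed

lemma picard_holomorphic: "(\<lambda>\<mu>. picard2 n \<mu> s) holomorphic_on UNIV" "(\<lambda>\<mu>. picard0 n \<mu> s) holomorphic_on UNIV"
proof -
  have 0: "(\<lambda>\<mu>. picard0 n \<mu> s) holomorphic_on UNIV"
    if "\<And>s. (\<lambda>\<mu>. picard2 n \<mu> s) holomorphic_on UNIV" for n s
  proof -
    have "(\<lambda>\<mu>. picard1 n \<mu> s) holomorphic_on UNIV" for s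
      unfolding picard1_def
      by (rule holomorphic_integral_Icc) (use picard_props(1) that picard_local_bound(1) in blast)+
    then show ?thesis
      unfolding picard0_def
      by (intro holomorphic_integral_Icc) (use picard_cont(1) picard_local_bound(2) in blast)+
  qed
  have 2: "(\<lambda>\<mu>. picard2 n \<mu> s) holomorphic_on UNIV" for n s
  proof (induction n arbitrary: s)
    case (Suc n)
    show ?case unfolding picard2_Suc by (intro holomorphic_intros 0 Suc)
  qed simp
  show "(\<lambda>\<mu>. picard2 n \<mu> s) holomorphic_on UNIV" "(\<lambda>\<mu>. picard0 n \<mu> s) holomorphic_on UNIV"
    using 2 0[OF 2] by auto
qed

lemma sol_holomorphic: "(\<lambda>\<mu>. sol \<mu> s) holomorphic_on UNIV"
proof (cases "a \<le> s")
  case True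
  show ?thesis unfolding sol_def
  proof (rule holomorphic_uniform_sequence)
    show "(\<lambda>\<mu>. \<Sum>i<n. picard0 i \<mu> s) holomorphic_on UNIV" for n
      by (intro holomorphic_intros picard_holomorphic)
    fix z0 :: complex
    define k where "k = Q + norm z0 + 2"
    have k: "k \<ge> 2" using Q_nonneg by (simp add: k_def)
    have r: "(k - 1) / k\<^sup>2 < 1" "0 \<le> (k - 1) / k\<^sup>2"
      using k self_le_power[of k 2] by auto
    have "uniform_limit (cball z0 (1/2)) (\<lambda>n \<mu>. \<Sum>i<n. picard0 i \<mu> s) (\<lambda>\<mu>. \<Sum>i. picard0 i \<mu> s) sequentially"
    proof (rule Weierstrass_m_test)
      show "norm (picard0 n \<mu> s) \<le> P / k\<^sup>2 * ((k - 1) / k\<^sup>2) ^ n * exp (k * (s - a))"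
        if "\<mu> \<in> cball z0 (1/2)" for n \<mu>
        unfolding k_def by (rule picard_local_bound(3)) (use that True in auto)
      show "summable (\<lambda>n. P / k\<^sup>2 * ((k - 1) / k\<^sup>2) ^ n * exp (k * (s - a)))"
        using r by (intro summable_mult summable_mult2 summable_geometric) auto
    qed
    then show "\<exists>d>0. cball z0 d \<subseteq> UNIV \<and>
        uniform_limit (cball z0 d) (\<lambda>n \<mu>. \<Sum>i<n. picard0 i \<mu> s) (\<lambda>\<mu>. \<Sum>i. picard0 i \<mu> s) sequentially"
      by (intro exI[of _ "1/2"]) auto
  qed auto
qed (simp add: sol_zero)

text \<open>For \<open>\<mu> = x\<^sup>2 - \<kappa>\<close> with large \<open>x\<close> the equation is oscillatory, so the solution does not grow with \<open>x\<close>.\<close>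

lemma sol_energy:
  assumes x: "x \<ge> 1" and \<kappa>: "\<kappa> \<ge> 0" and s: "a \<le> s"
  shows "(x * norm (sol (of_real (x\<^sup>2 - \<kappa>)) s))\<^sup>2 \<le> P\<^sup>2 * (s - a) * exp ((Q + \<kappa> + 1) * (s - a))"
proof -
  define f where "f = sol (of_real (x\<^sup>2 - \<kappa>))"
  define g where "g = sol1 (of_real (x\<^sup>2 - \<kappa>))"
  define c where "c = Q + \<kappa> + 1"
  \<comment> \<open>Written as f'' = -x^2 f + (q + \<kappa>) f + psi, the equation is a perturbed
    oscillator and E is its energy. In E' the terms with x^2 cancel, so the constants below are free
    of x. The inner product is the real one on the complex numbers.\<close>
  define E where "E t = g t \<bullet> g t + x\<^sup>2 * (f t \<bullet> f t)" for t
  define E' where "E' t = 2 * (g t \<bullet> ((q t + of_real \<kappa>) * f t + psi t))" for t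
  have df: "(f has_vector_derivative g t) (at t)" for t unfolding f_def g_def by (rule sol_deriv)
  have dg: "(g has_vector_derivative ((q t - of_real (x\<^sup>2 - \<kappa>)) * f t + psi t)) (at t)" for t
    unfolding f_def g_def by (rule sol_deriv)
  have dE: "(E has_real_derivative E' t) (at t)" for t
  proof -
    have "((\<lambda>t. g t \<bullet> g t + x\<^sup>2 * (f t \<bullet> f t)) has_derivative
        (\<lambda>h. (g t \<bullet> (h *\<^sub>R ((q t - of_real (x\<^sup>2 - \<kappa>)) * f t + psi t)) + (h *\<^sub>R ((q t - of_real (x\<^sup>2 - \<kappa>)) * f t + psi t)) \<bullet> g t)
           + x\<^sup>2 * (f t \<bullet> (h *\<^sub>R g t) + (h *\<^sub>R g t) \<bullet> f t))) (at t)"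
      using df[of t] dg[of t] unfolding has_vector_derivative_def
      by (intro derivative_intros) auto
    also have "(\<lambda>h. (g t \<bullet> (h *\<^sub>R ((q t - of_real (x\<^sup>2 - \<kappa>)) * f t + psi t)) + (h *\<^sub>R ((q t - of_real (x\<^sup>2 - \<kappa>)) * f t + psi t)) \<bullet> g t)
           + x\<^sup>2 * (f t \<bullet> (h *\<^sub>R g t) + (h *\<^sub>R g t) \<bullet> f t)) = (*) (E' t)"
    proof
      fix h
      have e: "(q t - of_real (x\<^sup>2 - \<kappa>)) * f t + psi t = ((q t + of_real \<kappa>) * f t + psi t) - x\<^sup>2 *\<^sub>R f t"
        by (simp add: algebra_simps scaleR_conv_of_real)
      show "(g t \<bullet> (h *\<^sub>R ((q t - of_real (x\<^sup>2 - \<kappa>)) * f t + psi t)) + (h *\<^sub>R ((q t - of_real (x\<^sup>2 - \<kappa>)) * f t + psi t)) \<bullet> g t)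
           + x\<^sup>2 * (f t \<bullet> (h *\<^sub>R g t) + (h *\<^sub>R g t) \<bullet> f t) = E' t * h"
        unfolding e E'_def inner_scaleR_left inner_scaleR_right inner_diff_left inner_diff_right
        by (simp add: inner_commute algebra_simps)
    qed
    finally show ?thesis unfolding has_field_derivative_def E_def[abs_def] .
  qed
  have E'_le: "E' t \<le> c * E t + P\<^sup>2" for t
  proof -
    have x2: "x\<^sup>2 \<ge> 1" using x by simp
    have "norm ((q t + of_real \<kappa>) * f t + psi t) \<le> norm (q t + of_real \<kappa>) * norm (f t) + norm (psi t)"
      by (metis norm_mult norm_triangle_ineq)
    also have "\<dots> \<le> (Q + \<kappa>) * norm (f t) + P"
    proof -
      have "norm (q t + of_real \<kappa>) \<le> Q + \<kappa>"
        using norm_triangle_ineq[of "q t" "of_real \<kappa>"] q_bound[of t] \<kappa> by simp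
      then show ?thesis using psi_bound[of t] by (intro add_mono mult_right_mono) auto
    qed
    finally have "E' t \<le> 2 * (norm (g t) * ((Q + \<kappa>) * norm (f t) + P))"
      unfolding E'_def using norm_cauchy_schwarz[of "g t"]
      by (smt (verit) mult_left_mono norm_ge_zero)
    also have "\<dots> = (Q + \<kappa>) * (2 * norm (g t) * norm (f t)) + 2 * norm (g t) * P"
      by (simp add: algebra_simps)
    also have "\<dots> \<le> (Q + \<kappa>) * ((norm (g t))\<^sup>2 + (norm (f t))\<^sup>2) + ((norm (g t))\<^sup>2 + P\<^sup>2)"
      using sum_squares_bound[of "norm (g t)" "norm (f t)"] sum_squares_bound[of "norm (g t)" P] Q_nonneg \<kappa>
      by (intro add_mono mult_left_mono) auto
    also have "\<dots> \<le> (Q + \<kappa>) * E t + (E t + P\<^sup>2)"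
    proof (intro add_mono mult_left_mono order_refl)
      have "1 * (norm (f t))\<^sup>2 \<le> x\<^sup>2 * (norm (f t))\<^sup>2" using x2 by (intro mult_right_mono) auto
      then show "(norm (g t))\<^sup>2 + (norm (f t))\<^sup>2 \<le> E t"
        by (simp add: E_def power2_norm_eq_inner)
      show "(norm (g t))\<^sup>2 \<le> E t"
        by (simp add: E_def power2_norm_eq_inner)
      show "0 \<le> Q + \<kappa>" using Q_nonneg \<kappa> by simp
    qed
    finally show ?thesis by (simp add: c_def algebra_simps)
  qed
  have c: "c > 0" using Q_nonneg \<kappa> by (simp add: c_def add_nonneg_pos)
  \<comment> \<open>Gronwall's argument: E' <= c E + P^2 makes G nonincreasing, and G starts at
    0.\<close>
  define G where "G t = E t * exp (- c * (t - a)) - P\<^sup>2 * (t - a)" for t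
  have "G s \<le> G a"
  proof (rule DERIV_nonpos_imp_nonincreasing[OF s])
    fix t assume t: "a \<le> t" "t \<le> s"
    have "(G has_real_derivative (E' t * exp (- c * (t - a)) + E t * (exp (- c * (t - a)) * (- c)) - P\<^sup>2)) (at t)"
      unfolding G_def[abs_def] using dE[of t] by (auto intro!: derivative_eq_intros)
    moreover have "E' t * exp (- c * (t - a)) + E t * (exp (- c * (t - a)) * (- c)) - P\<^sup>2 \<le> 0"
    proof -
      have "(E' t - c * E t) * exp (- c * (t - a)) \<le> P\<^sup>2 * exp (- c * (t - a))"
        using E'_le[of t] by (intro mult_right_mono) auto
      also have "\<dots> \<le> P\<^sup>2 * 1" using c t by (intro mult_left_mono) auto
      finally show ?thesis by (simp add: algebra_simps)
    qed
    ultimately show "\<exists>y. (G has_real_derivative y) (at t) \<and> y \<le> 0" by blast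
  qed
  also have "G a = 0" by (simp add: G_def E_def f_def g_def sol_zero)
  finally have "E s * exp (- c * (s - a)) \<le> P\<^sup>2 * (s - a)" by (simp add: G_def)
  then have "E s * exp (- c * (s - a)) * exp (c * (s - a)) \<le> P\<^sup>2 * (s - a) * exp (c * (s - a))"
    by (rule mult_right_mono) simp
  then have "E s \<le> P\<^sup>2 * (s - a) * exp (c * (s - a))"
    by (simp add: mult.assoc exp_add[symmetric])
  moreover have "(x * norm (f s))\<^sup>2 \<le> E s"
    by (simp add: E_def power_mult_distrib power2_norm_eq_inner)
  ultimately show ?thesis by (simp add: f_def c_def)
qed

end

section \<open>Weak form of the equation\<close>

text \<open>A derivative along a coordinate line: test functions can then be handled by one-variable
  rules, without total derivatives.\<close>

definition has_partial :: "(real ^ 'n \<Rightarrow> complex) \<Rightarrow> 'n::finite \<Rightarrow> complex \<Rightarrow> real ^ 'n \<Rightarrow> bool" where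
  "has_partial F i D x \<longleftrightarrow> ((\<lambda>t. F (x + t *\<^sub>R axis i 1)) has_vector_derivative D) (at 0)"

text \<open>Just the data that Green's identity for the Laplacian consumes: first and pure second
  partials, named explicitly so that products can be written out and estimated.\<close>

definition partials2 ::
  "(real ^ 'n::finite \<Rightarrow> complex) \<Rightarrow> ('n \<Rightarrow> real ^ 'n \<Rightarrow> complex) \<Rightarrow> ('n \<Rightarrow> real ^ 'n \<Rightarrow> complex) \<Rightarrow> bool" where
  "partials2 F F1 F2 \<longleftrightarrow>
    (\<forall>i x. has_partial F i (F1 i x) x \<and> has_partial (F1 i) i (F2 i x) x) \<and>
    continuous_on UNIV F \<and> (\<forall>i. continuous_on UNIV (F1 i) \<and> continuous_on UNIV (F2 i))"

section \<open>Calculus of coordinate derivatives and integration of a derivative over the whole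
  space\<close>

lemma has_partial_cong_open:
  assumes "open T" "x \<in> T" "\<And>y. y \<in> T \<Longrightarrow> F y = G y" "has_partial F i D x"
  shows "has_partial G i D x"
proof -
  have "open ((\<lambda>t. x + t *\<^sub>R axis i 1) -` T)"
    using assms(1) by (rule open_vimage) (intro continuous_intros)
  with assms show ?thesis
    unfolding has_partial_def
    by (elim has_vector_derivative_transform_within_open) auto
qed

lemma has_partial_const: "has_partial (\<lambda>_. c) i 0 x"
  unfolding has_partial_def by (rule has_vector_derivative_const)

lemma has_partial_mult:
  assumes "has_partial F i F' x" "has_partial G i G' x"
  shows "has_partial (\<lambda>x. F x * G x) i (F x * G' + F' * G x) x"
  using has_vector_derivative_mult[OF assms[unfolded has_partial_def]] by (simp add: has_partial_def)

lemma has_partial_add: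
  assumes "has_partial F i F' x" "has_partial G i G' x"
  shows "has_partial (\<lambda>x. F x + G x) i (F' + G') x"
  using has_vector_derivative_add[OF assms[unfolded has_partial_def]] by (simp add: has_partial_def)

lemma has_partial_diff:
  assumes "has_partial F i F' x" "has_partial G i G' x"
  shows "has_partial (\<lambda>x. F x - G x) i (F' - G') x"
  using has_vector_derivative_diff[OF assms[unfolded has_partial_def]] by (simp add: has_partial_def)

lemma has_partial_line:
  assumes "\<And>x. has_partial F i (F' x) x"
  shows "((\<lambda>t. F (x + t *\<^sub>R axis i 1)) has_vector_derivative F' (x + t *\<^sub>R axis i 1)) (at t)"
proof -
  have "((\<lambda>s. F ((x + t *\<^sub>R axis i 1) + s *\<^sub>R axis i 1)) has_vector_derivative F' (x + t *\<^sub>R axis i 1)) (at (t - t))"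
    using assms[of "x + t *\<^sub>R axis i 1"] by (simp add: has_partial_def)
  then have "((\<lambda>s. F ((x + t *\<^sub>R axis i 1) + (s - t) *\<^sub>R axis i 1)) has_vector_derivative 1 *\<^sub>R F' (x + t *\<^sub>R axis i 1)) (at t)"
    by (intro vector_diff_chain_at[unfolded comp_def, of "\<lambda>s. s - t"]) (auto intro!: derivative_eq_intros)
  then show ?thesis by (simp add: algebra_simps)
qed

lemma integrable_compact_support:
  fixes f :: "'a::euclidean_space \<Rightarrow> 'b::{banach, second_countable_topology}"
  assumes "continuous_on UNIV f" "\<And>x. norm x > R \<Longrightarrow> f x = 0"
  shows "integrable lborel f"
proof -
  have "integrable lborel (\<lambda>x. indicator (cball 0 R) x *\<^sub>R f x)"
    by (rule borel_integrable_compact) (use assms(1) continuous_on_subset in auto)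
  also have "(\<lambda>x. indicator (cball 0 R) x *\<^sub>R f x) = f"
    using assms(2) by (auto simp: indicator_def fun_eq_iff)
  finally show ?thesis .
qed

text \<open>By translation invariance, every difference quotient of F has integral zero, and
  dominated convergence passes to the derivative. This avoids splitting the space into a line and
  its complement.\<close>

lemma integral_partial_zero:
  fixes F F' :: "real ^ 'n::finite \<Rightarrow> complex"
  assumes der: "\<And>x. has_partial F i (F' x) x"
    and c: "continuous_on UNIV F" "continuous_on UNIV F'"
    and z: "\<And>x. norm x > R \<Longrightarrow> F x = 0" "\<And>x. norm x > R \<Longrightarrow> F' x = 0"
  shows "(LINT x|lborel. F' x) = 0"
proof -
  let ?b = "axis i 1 :: real ^ 'n"
  have nb: "norm ?b = 1" by (simp add: norm_axis_1)
  have "bounded (F' ` cball 0 R)"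
    by (intro compact_imp_bounded compact_continuous_image continuous_on_subset[OF c(2)]) auto
  then obtain M where M: "\<And>x. x \<in> cball 0 R \<Longrightarrow> norm (F' x) \<le> M" "M > 0"
    unfolding bounded_pos by blast
  have M': "norm (F' x) \<le> M" for x
    using M z(2)[of x] by (cases "norm x \<le> R") auto
  define h where "h n = 1 / real (Suc n)" for n
  have h: "h n > 0" "h n \<le> 1" for n by (auto simp: h_def)
  define D where "D n x = (1 / h n) *\<^sub>R (F (x + h n *\<^sub>R ?b) - F x)" for n x
  have iF: "integrable lborel F" by (rule integrable_compact_support[OF c(1) z(1)])
  have tr: "integrable lborel (\<lambda>x. F (x + v))" "(LINT x|lborel. F (x + v)) = (LINT x|lborel. F x)" for v
  proof -
    have [measurable]: "F \<in> borel_measurable borel" using iF by auto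
    have "integrable (distr lborel borel ((+) v)) F" using iF by (simp add: lborel_distr_plus)
    then show "integrable lborel (\<lambda>x. F (x + v))"
      by (subst (asm) integrable_distr_eq) (auto simp: add.commute)
    have "(LINT x|lborel. F x) = (LINT x|distr lborel borel ((+) v). F x)" by (simp add: lborel_distr_plus)
    also have "\<dots> = (LINT x|lborel. F (x + v))"
      by (subst integral_distr) (auto simp: add.commute)
    finally show "(LINT x|lborel. F (x + v)) = (LINT x|lborel. F x)" by simp
  qed
  have D0: "(LINT x|lborel. D n x) = 0" for n
    unfolding D_def using tr iF by simp
  have "(\<lambda>n. LINT x|lborel. D n x) \<longlonglongrightarrow> (LINT x|lborel. F' x)"
  \<comment> \<open>Steps are at most 1, so all quotients are supported in the ball of radius R + 1,
    and the mean value inequality bounds them by M.\<close>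
  proof (rule integral_dominated_convergence[where w="\<lambda>x. indicator (cball 0 (R + 1)) x *\<^sub>R M"])
    show "F' \<in> borel_measurable lborel" using c(2) by (simp add: borel_measurable_continuous_onI)
    show "D n \<in> borel_measurable lborel" for n
      unfolding D_def by (intro borel_measurable_scaleR borel_measurable_diff) (use tr(1) iF in auto)
    show "integrable lborel (\<lambda>x::real^'n. indicator (cball 0 (R + 1)) x *\<^sub>R M)"
      by (rule borel_integrable_compact) auto
    show "AE x in lborel. (\<lambda>n. D n x) \<longlonglongrightarrow> F' x"
    proof (intro AE_I2)
      fix x
      have "((\<lambda>t. F (x + t *\<^sub>R ?b)) has_vector_derivative F' x) (at 0)"
        using der[of x] by (simp add: has_partial_def)
      then have "((\<lambda>t. norm (F (x + t *\<^sub>R ?b) - F x - t *\<^sub>R F' x) / norm t) \<longlongrightarrow> 0) (at 0)"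
        by (simp add: has_vector_derivative_def has_derivative_iff_norm)
      moreover have "\<forall>\<^sub>F t in at 0. norm (F (x + t *\<^sub>R ?b) - F x - t *\<^sub>R F' x) / norm t
          = norm ((1 / t) *\<^sub>R (F (x + t *\<^sub>R ?b) - F x) - F' x)"
      proof (rule eventually_mono[OF eventually_neq_at_within[of 0]])
        fix t :: real assume "t \<noteq> 0"
        then have "(1 / t) *\<^sub>R (F (x + t *\<^sub>R ?b) - F x) - F' x = (1 / t) *\<^sub>R (F (x + t *\<^sub>R ?b) - F x - t *\<^sub>R F' x)"
          by (simp add: scaleR_right_diff_distrib)
        then show "norm (F (x + t *\<^sub>R ?b) - F x - t *\<^sub>R F' x) / norm t
          = norm ((1 / t) *\<^sub>R (F (x + t *\<^sub>R ?b) - F x) - F' x)" by simp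
      qed
      ultimately have "((\<lambda>t. norm ((1 / t) *\<^sub>R (F (x + t *\<^sub>R ?b) - F x) - F' x)) \<longlongrightarrow> 0) (at 0)"
        by (rule Lim_transform_eventually)
      then have l: "((\<lambda>t. (1 / t) *\<^sub>R (F (x + t *\<^sub>R ?b) - F x)) \<longlongrightarrow> F' x) (at 0)"
        by (simp add: tendsto_norm_zero_iff LIM_zero_iff)
      have "h \<longlonglongrightarrow> 0" unfolding h_def using LIMSEQ_inverse_real_of_nat by (simp add: inverse_eq_divide)
      then show "(\<lambda>n. D n x) \<longlonglongrightarrow> F' x"
        using l h(1) unfolding tendsto_at_iff_sequentially D_def by (auto simp: comp_def less_imp_neq[symmetric])
    qed
    show "AE x in lborel. norm (D n x) \<le> indicator (cball 0 (R + 1)) x *\<^sub>R M" for n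
    proof (intro AE_I2)
      fix x :: "real ^ 'n"
      show "norm (D n x) \<le> indicator (cball 0 (R + 1)) x *\<^sub>R M"
      proof (cases "norm x \<le> R + 1")
        case True
        have "norm (F (x + h n *\<^sub>R ?b) - F (x + 0 *\<^sub>R ?b)) \<le> M * norm (h n - 0)"
        proof (rule differentiable_bound[of UNIV _ "\<lambda>t s. s *\<^sub>R F' (x + t *\<^sub>R ?b)"])
          show "((\<lambda>t. F (x + t *\<^sub>R ?b)) has_derivative (\<lambda>s. s *\<^sub>R F' (x + t *\<^sub>R ?b))) (at t within UNIV)" for t
            using has_partial_line[OF der] by (simp add: has_vector_derivative_def)
          show "onorm (\<lambda>s. s *\<^sub>R F' (x + t *\<^sub>R ?b)) \<le> M" for t
            by (rule onorm_le) (use M' in \<open>simp add: mult.commute[of M] mult_left_mono\<close>)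
        qed auto
        then show ?thesis using True h[of n] by (simp add: D_def divide_le_eq)
      next
        case False
        have "norm (x + h n *\<^sub>R ?b) \<ge> norm x - h n * 1"
          using norm_triangle_ineq2[of x "- (h n *\<^sub>R ?b)"] h[of n] nb by simp
        then have "norm (x + h n *\<^sub>R ?b) > R" using False h[of n] by linarith
        then show ?thesis using False z(1) by (simp add: D_def)
      qed
    qed
  qed
  then show ?thesis unfolding D0 using LIMSEQ_unique tendsto_const by metis
qed

text \<open>Inside the ball f is unspecified. The product is glued from two overlapping open sets,
  which is why g has to vanish on a ball strictly larger than that of radius R0.\<close>

lemma continuous_mult_exterior:
  fixes f g :: "'a::real_normed_vector \<Rightarrow> complex"
  assumes f: "continuous_on {x. norm x \<ge> R0} f" and g: "continuous_on UNIV g"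
    and z: "\<And>x. norm x \<le> R1 \<Longrightarrow> g x = 0" and R: "R0 < R1"
  shows "continuous_on UNIV (\<lambda>x. f x * g x)"
proof -
  have U: "UNIV = {x::'a. norm x > R0} \<union> {x. norm x < R1}" using R by auto
  have "continuous_on ({x::'a. norm x > R0} \<union> {x. norm x < R1}) (\<lambda>x. f x * g x)"
  proof (rule continuous_on_open_Un)
    show "continuous_on {x. norm x > R0} (\<lambda>x. f x * g x)"
      by (intro continuous_intros continuous_on_subset[OF f] continuous_on_subset[OF g]) auto
    have "continuous_on {x. norm x < R1} (\<lambda>x::'a. 0::complex)" by simp
    then show "continuous_on {x. norm x < R1} (\<lambda>x. f x * g x)"
      by (rule continuous_on_eq) (use z in auto)
  qed (intro open_Collect_less continuous_intros)+
  then show ?thesis using U by simp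
qed

section \<open>C2 cutoff functions from powers of the positive part\<close>

lemma max_square_deriv:
  fixes t :: real
  shows "((\<lambda>t. (max 0 t)\<^sup>2) has_real_derivative 2 * max 0 t) (at t)"
proof (cases t "0 :: real" rule: linorder_cases)
  case less
  have "((\<lambda>t::real. 0) has_real_derivative 0) (at t)" by simp
  then have "((\<lambda>t. (max 0 t)\<^sup>2) has_real_derivative 0) (at t)"
    by (rule DERIV_cong_ev[THEN iffD1, rotated 3])
      (use less in \<open>auto intro: eventually_mono[OF eventually_nhds_in_open[of "{..<0}"]]\<close>)
  then show ?thesis using less by simp
next
  case greater
  have "((\<lambda>t::real. t\<^sup>2) has_real_derivative 2 * t) (at t)" by (auto intro!: derivative_eq_intros)
  then have "((\<lambda>t. (max 0 t)\<^sup>2) has_real_derivative 2 * t) (at t)"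
    by (rule DERIV_cong_ev[THEN iffD1, rotated 3])
      (use greater in \<open>auto intro: eventually_mono[OF eventually_nhds_in_open[of "{0<..}"]]\<close>)
  then show ?thesis using greater by simp
next
  case equal
  have "((\<lambda>h::real. (max 0 h)\<^sup>2 / h) \<longlongrightarrow> 0) (at 0)"
  proof (rule Lim_null_comparison)
    show "\<forall>\<^sub>F h in at 0. norm ((max 0 h)\<^sup>2 / h) \<le> \<bar>h\<bar>"
      by (intro always_eventually) (auto simp: max_def power2_eq_square)
    show "((\<lambda>h::real. \<bar>h\<bar>) \<longlongrightarrow> 0) (at 0)"
      using tendsto_rabs[OF tendsto_ident_at, of "0::real"] by simp
  qed
  then show ?thesis using equal by (simp add: has_field_derivative_iff)
qed

lemma max_cube_deriv:
  fixes t :: real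
  shows "((\<lambda>t. (max 0 t) ^ 3) has_real_derivative 3 * (max 0 t)\<^sup>2) (at t)"
proof -
  have "((\<lambda>t. t * (max 0 t)\<^sup>2) has_real_derivative 1 * (max 0 t)\<^sup>2 + t * (2 * max 0 t)) (at t)"
    by (rule derivative_eq_intros max_square_deriv refl)+ simp
  moreover have e: "t * (max 0 t)\<^sup>2 = (max 0 t) ^ 3" for t :: real
    by (auto simp: max_def power3_eq_cube power2_eq_square)
  moreover have "1 * (max 0 t)\<^sup>2 + t * (2 * max 0 t) = 3 * (max 0 t)\<^sup>2"
    by (auto simp: max_def power2_eq_square)
  ultimately show ?thesis by (simp only:)
qed

lemma has_partial_of_real:
  assumes "((\<lambda>t. F (x + t *\<^sub>R axis i 1)) has_real_derivative D) (at 0)"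
  shows "has_partial (\<lambda>x. of_real (F x)) i (of_real D) x"
  using has_vector_derivative_of_real[OF assms] by (simp add: has_partial_def)

lemma partials2_mult:
  assumes "partials2 F F1 F2" "partials2 G G1 G2"
  shows "partials2 (\<lambda>x. F x * G x) (\<lambda>i x. F x * G1 i x + F1 i x * G x)
    (\<lambda>i x. F x * G2 i x + 2 * F1 i x * G1 i x + F2 i x * G x)"
  unfolding partials2_def
proof (intro conjI allI)
  fix i x
  show "has_partial (\<lambda>x. F x * G x) i (F x * G1 i x + F1 i x * G x) x"
    using assms by (intro has_partial_mult) (auto simp: partials2_def)
  have "has_partial (\<lambda>x. F x * G1 i x + F1 i x * G x) i
      ((F x * G2 i x + F1 i x * G1 i x) + (F1 i x * G1 i x + F2 i x * G x)) x"
    using assms by (intro has_partial_add has_partial_mult) (auto simp: partials2_def)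
  then show "has_partial (\<lambda>x. F x * G1 i x + F1 i x * G x) i
      (F x * G2 i x + 2 * F1 i x * G1 i x + F2 i x * G x) x"
    by (simp add: algebra_simps)
qed (use assms in \<open>auto simp: partials2_def intro!: continuous_intros\<close>)

text \<open>The cube of the positive part is the lowest power that is C2. For a > 0 the function is
  supported in the ball of radius 1 / sqrt a, and its derivatives tend to 0 pointwise as a tends to
  0.\<close>

lemma partials2_cutoff:
  fixes a :: real
  defines "m \<equiv> \<lambda>x::real^'n::finite. max 0 (1 - a * (x \<bullet> x))"
  shows "partials2 (\<lambda>x. of_real (m x ^ 3)) (\<lambda>i x. of_real (- 6 * a * x $ i * (m x)\<^sup>2))
    (\<lambda>i x. of_real (24 * a\<^sup>2 * (x $ i)\<^sup>2 * m x - 6 * a * (m x)\<^sup>2))"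
proof -
  have lin: "((\<lambda>t. 1 - a * ((x + t *\<^sub>R axis i 1) \<bullet> (x + t *\<^sub>R axis i 1))) has_real_derivative (- 2 * a * x $ i)) (at 0)"
    for x :: "real ^ 'n" and i
    by (simp add: inner_add_left inner_add_right inner_axis inner_axis' inner_axis_axis)
       (auto intro!: derivative_eq_intros simp: algebra_simps)
  have comp: "(x + t *\<^sub>R axis i 1) $ i = x $ i + t" for x :: "real ^ 'n" and i t
    by (simp add: axis_def)
  have m2: "((\<lambda>t. (m (x + t *\<^sub>R axis i 1))\<^sup>2) has_real_derivative 2 * m x * (- 2 * a * x $ i)) (at 0)" for x i
    unfolding m_def using DERIV_chain2[OF max_square_deriv lin[of x i]] by simp
  show ?thesis
    unfolding partials2_def
  proof (intro conjI allI)
    fix i x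
    have "((\<lambda>t. m (x + t *\<^sub>R axis i 1) ^ 3) has_real_derivative 3 * (m x)\<^sup>2 * (- 2 * a * x $ i)) (at 0)"
      unfolding m_def using DERIV_chain2[OF max_cube_deriv lin[of x i]] by simp
    then show "has_partial (\<lambda>x. of_real (m x ^ 3)) i (of_real (- 6 * a * x $ i * (m x)\<^sup>2)) x"
      by (intro has_partial_of_real) (simp add: algebra_simps)
    have "((\<lambda>t. - 6 * a * (x $ i + t) * (m (x + t *\<^sub>R axis i 1))\<^sup>2) has_real_derivative
        (- 6 * a) * (m (x + 0 *\<^sub>R axis i 1))\<^sup>2 + (2 * m x * (- 2 * a * x $ i)) * (- 6 * a * (x $ i + 0))) (at 0)"
      by (rule DERIV_mult[OF _ m2]) (auto intro!: derivative_eq_intros)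
    then show "has_partial (\<lambda>x. of_real (- 6 * a * x $ i * (m x)\<^sup>2)) i
        (of_real (24 * a\<^sup>2 * (x $ i)\<^sup>2 * m x - 6 * a * (m x)\<^sup>2)) x"
      by (intro has_partial_of_real) (simp add: comp power2_eq_square algebra_simps)
  qed (auto simp: m_def intro!: continuous_intros)
qed

text \<open>All derivatives fall on the test function. The strict inequality R0 < R1 keeps its
  support off the sphere, so there are no boundary terms and the values of u in the ball do not
  enter.\<close>

definition weak_solution ::
  "real \<Rightarrow> (real ^ 'n::finite \<Rightarrow> complex) \<Rightarrow> (real ^ 'n \<Rightarrow> complex) \<Rightarrow> bool" where
  "weak_solution R0 V u \<longleftrightarrow>
    (\<forall>\<Psi> \<Psi>1 \<Psi>2 R1 R2. R0 < R1 \<longrightarrow> partials2 \<Psi> \<Psi>1 \<Psi>2 \<longrightarrow>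
      (\<forall>x i. norm x \<le> R1 \<or> norm x > R2 \<longrightarrow> \<Psi> x = 0 \<and> \<Psi>1 i x = 0 \<and> \<Psi>2 i x = 0) \<longrightarrow>
      (LINT x|lborel. u x * (\<Sum>i\<in>UNIV. \<Psi>2 i x) - V x * (u x * \<Psi> x)) = 0)"

lemma partial_within_has_partial:
  assumes "f differentiable_on S" "x \<in> interior S"
  shows "has_partial f i (partial_within S i f x) x"
proof -
  have x: "x \<in> S" using assms(2) interior_subset by blast
  have w: "at x within S = at x" using assms(2) by (rule at_within_interior)
  have "f differentiable (at x)" using assms(1) x w unfolding differentiable_on_def by metis
  then have D: "(f has_derivative frechet_derivative f (at x)) (at x)"
    by (simp add: frechet_derivative_works)
  have "((\<lambda>t. f (x + t *\<^sub>R axis i 1)) has_derivative (\<lambda>t. frechet_derivative f (at x) (t *\<^sub>R axis i 1))) (at 0)"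
    by (rule has_derivative_compose[of "\<lambda>t. x + t *\<^sub>R axis i 1"]) (use D in \<open>auto intro!: derivative_eq_intros\<close>)
  moreover have "frechet_derivative f (at x) (t *\<^sub>R axis i 1) = t *\<^sub>R partial_within S i f x" for t
    using linear_scale[OF has_derivative_linear[OF D]] by (simp add: partial_within_def w)
  ultimately show ?thesis by (simp add: has_partial_def has_vector_derivative_def)
qed

lemma C2_on_continuous:
  assumes "C2_on S u"
  shows "continuous_on S u" "continuous_on S (partial_within S i u)"
    "continuous_on S (partial_within S i (partial_within S i u))"
  using assms differentiable_imp_continuous_on by (auto simp: C2_on_def C1_on_def)

text \<open>Green's identity, one coordinate at a time: u \<Psi>_ii - u_ii \<Psi> is the i-th
  partial of u \<Psi>_i - u_i \<Psi>, which has compact support, hence integrates to zero.\<close>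

lemma C2_on_weak_solution:
  fixes u V :: "real ^ 'n::finite \<Rightarrow> complex"
  defines "S \<equiv> \<lambda>R0. {x::real ^ 'n. norm x \<ge> R0}"
  assumes C2: "C2_on (S R0) u"
    and eq: "\<And>x. norm x \<ge> R0 \<Longrightarrow> laplacian_within (S R0) u x = V x * u x"
  shows "weak_solution R0 V u"
  unfolding weak_solution_def
proof (intro allI impI)
  fix \<Psi> :: "real ^ 'n \<Rightarrow> complex" and \<Psi>1 \<Psi>2 R1 R2
  assume R: "R0 < R1" and P: "partials2 \<Psi> \<Psi>1 \<Psi>2"
    and Z: "\<forall>x i. norm x \<le> R1 \<or> norm x > R2 \<longrightarrow> \<Psi> x = 0 \<and> \<Psi>1 i x = 0 \<and> \<Psi>2 i x = 0"
  define U1 U2 where "U1 i = partial_within (S R0) i u" and "U2 i = partial_within (S R0) i (U1 i)" for i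
  have int: "x \<in> interior (S R0)" if "norm x > R0" for x
    by (rule interiorI[of "{x. norm x > R0}"]) (use that in \<open>auto simp: S_def intro!: open_Collect_less continuous_intros\<close>)
  note cu = C2_on_continuous[OF C2, folded U1_def, folded U2_def, unfolded S_def]
  have h1: "has_partial u i (U1 i x) x" and h2: "has_partial (U1 i) i (U2 i x) x" if "norm x > R0" for x i
    unfolding U1_def U2_def
    using C2 int[OF that] by (auto simp: C2_on_def C1_on_def intro!: partial_within_has_partial)
  have z: "\<Psi> x = 0" "\<Psi>1 i x = 0" "\<Psi>2 i x = 0" if "norm x \<le> R1" for x i
    using Z that by auto
  have cP: "continuous_on UNIV \<Psi>" "continuous_on UNIV (\<Psi>1 i)" "continuous_on UNIV (\<Psi>2 i)" for i
    using P by (auto simp: partials2_def)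
  define F where "F i x = u x * \<Psi>1 i x - U1 i x * \<Psi> x" for i x
  define F' where "F' i x = u x * \<Psi>2 i x - U2 i x * \<Psi> x" for i x
  have cF: "continuous_on UNIV (F i)" "continuous_on UNIV (F' i)" for i
    unfolding F_def F'_def
    by (intro continuous_on_diff continuous_mult_exterior[OF _ _ _ R] cu cP z; assumption)+
  have zF: "F i x = 0" "F' i x = 0" if "norm x > R2" for i x
    using Z that by (auto simp: F_def F'_def)
  have "(LINT x|lborel. F' i x) = 0" for i
  proof (rule integral_partial_zero[OF _ cF zF])
    fix x
    show "has_partial (F i) i (F' i x) x"
    proof (cases "norm x > R0")
      case True
      have "has_partial (F i) i ((u x * \<Psi>2 i x + U1 i x * \<Psi>1 i x) - (U1 i x * \<Psi>1 i x + U2 i x * \<Psi> x)) x"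
        unfolding F_def using h1[OF True] h2[OF True] P
        by (intro has_partial_diff has_partial_mult) (auto simp: partials2_def)
      then show ?thesis by (simp add: F'_def)
    next
      case False
      then have x: "norm x < R1" using R by simp
      have "F' i x = 0" using x z by (simp add: F'_def)
      then show ?thesis
        by (intro has_partial_cong_open[of "{y. norm y < R1}" x "\<lambda>_. 0" "F i"])
          (use x z has_partial_const[of 0] in \<open>auto simp: F_def intro!: open_Collect_less continuous_intros\<close>)
    qed
  qed auto
  then have sum0: "(\<Sum>i\<in>UNIV. (LINT x|lborel. F' i x)) = 0" by simp
  have swap: "(\<Sum>i\<in>UNIV. (LINT x|lborel. F' i x)) = (LINT x|lborel. (\<Sum>i\<in>UNIV. F' i x))"
    by (subst Bochner_Integration.integral_sum) (auto intro!: integrable_compact_support[OF cF(2) zF(2)])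
  have "(\<Sum>i\<in>UNIV. F' i x) = u x * (\<Sum>i\<in>UNIV. \<Psi>2 i x) - V x * (u x * \<Psi> x)" for x
  proof -
    have "(\<Sum>i\<in>UNIV. F' i x) = u x * (\<Sum>i\<in>UNIV. \<Psi>2 i x) - (\<Sum>i\<in>UNIV. U2 i x) * \<Psi> x"
      by (simp add: F'_def sum_subtractf sum_distrib_left sum_distrib_right)
    moreover have "(\<Sum>i\<in>UNIV. U2 i x) * \<Psi> x = V x * (u x * \<Psi> x)"
    proof (cases "norm x \<ge> R0")
      case True
      then show ?thesis using eq[OF True] by (simp add: laplacian_within_def U1_def U2_def)
    qed (use z(1)[of x] R in auto)
    ultimately show ?thesis by simp
  qed
  then show "(LINT x|lborel. u x * (\<Sum>i\<in>UNIV. \<Psi>2 i x) - V x * (u x * \<Psi> x)) = 0"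
    using sum0 swap by simp
qed

section \<open>Passage from compactly supported to exponentially decaying test functions\<close>

lemma integrable_exp_decay:
  fixes f :: "'a::euclidean_space \<Rightarrow> complex"
  assumes "f \<in> borel_measurable borel" "c > 0" "\<And>x. norm (f x) \<le> K * exp (- c * norm x)"
  shows "integrable lborel f"
proof (rule Bochner_Integration.integrable_bound)
  show "integrable lborel (\<lambda>x::'a. K * exp (- c * norm x))"
    using integrable_exp_minus_norm[OF assms(2)] by (rule integrable_mult_right)
  show "AE x in lborel. norm (f x) \<le> norm (K * exp (- c * norm x))"
    using assms(3) by (intro AE_I2) (auto intro: order_trans[OF _ abs_ge_self])
qed (use assms(1) in simp)

text \<open>The test function is multiplied by cutoffs that spread out. Their derivatives are
  uniformly bounded and tend to zero, and the three decay hypotheses provide one integrable majorant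
  for all terms of the product rule.\<close>

lemma weak_solution_decaying_test:
  fixes u V :: "real ^ 'n::finite \<Rightarrow> complex"
  assumes w: "weak_solution R0 V u"
    and cu: "continuous_on {x. norm x \<ge> R0} u" and cV: "continuous_on {x. norm x \<ge> R0} V"
    and V: "\<And>x. norm x \<ge> R0 \<Longrightarrow> norm (V x) \<le> Q"
    and R: "R0 < R1" and P: "partials2 \<Phi> \<Phi>1 \<Phi>2"
    and z: "\<And>x i. norm x \<le> R1 \<Longrightarrow> \<Phi> x = 0 \<and> \<Phi>1 i x = 0 \<and> \<Phi>2 i x = 0"
    and c: "c > 0"
    and b: "\<And>x. norm x \<ge> R0 \<Longrightarrow> norm (u x * \<Phi> x) \<le> K * exp (- c * norm x)"
    and b1: "\<And>x i. norm x \<ge> R0 \<Longrightarrow> norm (u x * \<Phi>1 i x) \<le> K * exp (- c * norm x)"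
    and b2: "\<And>x i. norm x \<ge> R0 \<Longrightarrow> norm (u x * \<Phi>2 i x) \<le> K * exp (- c * norm x)"
  shows "(LINT x|lborel. u x * (\<Sum>i\<in>UNIV. \<Phi>2 i x) - V x * (u x * \<Phi> x)) = 0"
proof -
  have cP: "continuous_on UNIV \<Phi>" "continuous_on UNIV (\<Phi>1 i)" "continuous_on UNIV (\<Phi>2 i)" for i
    using P by (auto simp: partials2_def)
  have zs: "\<Phi> x = 0" "\<Phi>1 i x = 0" "\<Phi>2 i x = 0" if "norm x \<le> R1" for x i
    using z[OF that, of i] by blast+
  have cVu: "continuous_on {x. norm x \<ge> R0} (\<lambda>x. V x * u x)"
    using cV cu by (rule continuous_on_mult)
  have cuP: "continuous_on UNIV (\<lambda>x. u x * \<Phi> x)" "continuous_on UNIV (\<lambda>x. u x * \<Phi>1 i x)"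
    "continuous_on UNIV (\<lambda>x. u x * \<Phi>2 i x)" "continuous_on UNIV (\<lambda>x. (V x * u x) * \<Phi> x)" for i
    by (rule continuous_mult_exterior[OF cu cP(1) zs(1) R] continuous_mult_exterior[OF cu cP(2) zs(2) R]
      continuous_mult_exterior[OF cu cP(3) zs(3) R] continuous_mult_exterior[OF cVu cP(1) zs(1) R]; assumption)+
  have K0: "K \<ge> 0"
  proof -
    obtain x :: "real ^ 'n" where "norm x = \<bar>R0\<bar>" using vector_choose_size[OF abs_ge_zero] by blast
    then have "norm x \<ge> R0" by simp
    from order_trans[OF norm_ge_zero b[OF this]] show ?thesis by (simp add: zero_le_mult_iff)
  qed
  have B: "norm (u x * \<Phi> x) \<le> K * exp (- c * norm x)" "norm (u x * \<Phi>1 i x) \<le> K * exp (- c * norm x)"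
    "norm (u x * \<Phi>2 i x) \<le> K * exp (- c * norm x)" for x i
    using b b1 b2 z[of x i] R K0 by (cases "norm x \<ge> R0"; simp)+
  have BV: "norm (V x * (u x * \<Phi> x)) \<le> \<bar>Q\<bar> * (K * exp (- c * norm x))" for x
  proof (cases "norm x \<ge> R0")
    case True
    then show ?thesis unfolding norm_mult[of "V x"]
      using V[OF True] B(1)[of x] by (intro mult_mono) auto
  qed (use z[of x] R K0 in simp)
  \<comment> \<open>The n-th cutoff then lives in the ball of radius n + 1, and a n <= 1 from the
    start.\<close>
  define a where "a n = 1 / (real (Suc n))\<^sup>2" for n
  define m where "m n x = max 0 (1 - a n * (x \<bullet> x))" for n and x :: "real ^ 'n"
  define X where "X n x = (of_real (m n x ^ 3) :: complex)" for n x
  define X1 where "X1 n i x = (of_real (- 6 * a n * x $ i * (m n x)\<^sup>2) :: complex)" for n i x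
  define X2 where "X2 n i x = (of_real (24 * (a n)\<^sup>2 * (x $ i)\<^sup>2 * m n x - 6 * a n * (m n x)\<^sup>2) :: complex)" for n i x
  have pX: "partials2 (X n) (X1 n) (X2 n)" for n
    using partials2_cutoff[of "a n"] unfolding X_def[abs_def] X1_def[abs_def] X2_def[abs_def] m_def .
  have a: "0 < a n" "a n \<le> 1" for n by (auto simp: a_def power_le_one_iff divide_le_eq)
  have a0: "a \<longlonglongrightarrow> 0"
  proof -
    have "(\<lambda>n. (1 / real (Suc n))\<^sup>2) \<longlonglongrightarrow> 0\<^sup>2"
      by (intro tendsto_power LIMSEQ_inverse_real_of_nat[unfolded inverse_eq_divide])
    then show ?thesis by (simp add: a_def[abs_def] power_divide)
  qed
  have m01: "0 \<le> m n x" "m n x \<le> 1" for n x using a[of n] by (auto simp: m_def)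
  have ax: "m n x = 0 \<or> a n * (x $ i)\<^sup>2 \<le> 1" for n x i
  proof (cases "a n * (x \<bullet> x) \<le> 1")
    case True
    have "(x $ i)\<^sup>2 \<le> x \<bullet> x"
      using power_mono[OF component_le_norm_cart[of x i], of 2] by (simp add: power2_norm_eq_inner[symmetric])
    then have "a n * (x $ i)\<^sup>2 \<le> a n * (x \<bullet> x)" using a[of n] by (intro mult_left_mono) auto
    then show ?thesis using True by simp
  qed (simp add: m_def)
  \<comment> \<open>Where the cutoff is nonzero, a n <= 1 and a n x_i^2 <= 1; so the factors 6 and
    24 + 6 = 30 are all that remains.\<close>
  have nX: "norm (X n x) \<le> 1" "norm (X1 n i x) \<le> 6" "norm (X2 n i x) \<le> 30" for n i x
  proof -
    show "norm (X n x) \<le> 1" using m01[of n x] by (simp add: X_def norm_power power_le_one)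
    have m2: "0 \<le> (m n x)\<^sup>2" "(m n x)\<^sup>2 \<le> 1" using m01[of n x] by (auto simp: power_le_one)
    show "norm (X1 n i x) \<le> 6"
    proof (cases "m n x = 0")
      case False
      have "(a n * x $ i)\<^sup>2 = a n * (a n * (x $ i)\<^sup>2)" by (simp add: power2_eq_square)
      also have "\<dots> \<le> 1 * 1" using ax[of n x i] False a[of n] by (intro mult_mono) auto
      finally have "\<bar>a n * x $ i\<bar> \<le> 1" by (simp add: abs_square_le_1)
      then have "\<bar>a n * x $ i\<bar> * \<bar>(m n x)\<^sup>2\<bar> \<le> 1 * 1" using m2 by (intro mult_mono) auto
      then show ?thesis by (simp add: X1_def abs_mult norm_mult norm_power)
    qed (simp add: X1_def)
    show "norm (X2 n i x) \<le> 30"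
    proof (cases "m n x = 0")
      case False
      have "a n * (a n * (x $ i)\<^sup>2) * m n x \<le> 1 * 1 * 1"
        using ax[of n x i] False a[of n] m01[of n x] by (intro mult_mono) auto
      moreover have "0 \<le> a n * (a n * (x $ i)\<^sup>2) * m n x" using a[of n] m01[of n x] by simp
      moreover have "0 \<le> a n * (m n x)\<^sup>2" "a n * (m n x)\<^sup>2 \<le> 1 * 1"
        using a[of n] m2 mult_mono[of "a n" 1 "(m n x)\<^sup>2" 1] by auto
      moreover have "24 * (a n)\<^sup>2 * (x $ i)\<^sup>2 * m n x - 6 * a n * (m n x)\<^sup>2
          = 24 * (a n * (a n * (x $ i)\<^sup>2) * m n x) - 6 * (a n * (m n x)\<^sup>2)"
        by (simp add: power2_eq_square)
      ultimately show ?thesis unfolding X2_def norm_of_real by linarith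
    qed (simp add: X2_def)
  qed
  define I where "I n x = u x * (\<Sum>i\<in>UNIV. X n x * \<Phi>2 i x + 2 * X1 n i x * \<Phi>1 i x + X2 n i x * \<Phi> x)
      - V x * (u x * (X n x * \<Phi> x))" for n x
  \<comment> \<open>The limit integrand carries the plain cutoff; every other term contains a
    derivative of the cutoff and dies out.\<close>
  have I_eq: "I n x = X n x * (u x * (\<Sum>i\<in>UNIV. \<Phi>2 i x) - V x * (u x * \<Phi> x))
      + (\<Sum>i\<in>UNIV. 2 * X1 n i x * (u x * \<Phi>1 i x) + X2 n i x * (u x * \<Phi> x))" for n x
    by (simp add: I_def sum.distrib sum_distrib_left algebra_simps)
  have I0: "(LINT x|lborel. I n x) = 0" for n
  proof -
    have "partials2 (\<lambda>x. X n x * \<Phi> x) (\<lambda>i x. X n x * \<Phi>1 i x + X1 n i x * \<Phi> x)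
        (\<lambda>i x. X n x * \<Phi>2 i x + 2 * X1 n i x * \<Phi>1 i x + X2 n i x * \<Phi> x)"
      by (rule partials2_mult[OF pX P])
    moreover have "m n x = 0" if "norm x > real (Suc n)" for x
    proof -
      have "(real (Suc n))\<^sup>2 \<le> (norm x)\<^sup>2" using that by (intro power_mono) auto
      then have "1 \<le> a n * (x \<bullet> x)"
        by (simp add: a_def power2_norm_eq_inner field_simps del: of_nat_Suc)
      then show ?thesis by (simp add: m_def)
    qed
    then have "\<forall>x i. norm x \<le> R1 \<or> norm x > real (Suc n) \<longrightarrow> X n x * \<Phi> x = 0 \<and> X n x * \<Phi>1 i x + X1 n i x * \<Phi> x = 0 \<and>
        X n x * \<Phi>2 i x + 2 * X1 n i x * \<Phi>1 i x + X2 n i x * \<Phi> x = 0"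
      using z by (auto simp: X_def X1_def X2_def)
    ultimately show ?thesis
      using w R unfolding weak_solution_def I_def by blast
  qed
  have "(\<lambda>n. LINT x|lborel. I n x) \<longlonglongrightarrow> (LINT x|lborel. u x * (\<Sum>i\<in>UNIV. \<Phi>2 i x) - V x * (u x * \<Phi> x))"
  proof (rule integral_dominated_convergence)
    define L where "L = (\<Sum>i\<in>(UNIV::'n set). K) + \<bar>Q\<bar> * K + (\<Sum>i\<in>(UNIV::'n set). 12 * K + 30 * K)"
    show "integrable lborel (\<lambda>x::real ^ 'n. L * exp (- c * norm x))"
      using integrable_exp_minus_norm[OF c] by (rule integrable_mult_right)
    have cm: "continuous_on UNIV (\<lambda>x. u x * (\<Sum>i\<in>UNIV. \<Phi>2 i x) - V x * (u x * \<Phi> x))"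
      using cuP(3,4) by (simp add: sum_distrib_left mult.assoc continuous_intros)
    then show "(\<lambda>x. u x * (\<Sum>i\<in>UNIV. \<Phi>2 i x) - V x * (u x * \<Phi> x)) \<in> borel_measurable lborel"
      by (simp add: borel_measurable_continuous_onI)
    have "continuous_on UNIV (I n)" for n
      unfolding I_eq[abs_def] using pX[of n] unfolding partials2_def
      by (intro continuous_on_add continuous_on_mult cm continuous_on_sum continuous_on_const cuP) auto
    then show "I n \<in> borel_measurable lborel" for n
      by (simp add: borel_measurable_continuous_onI)
    show "AE x in lborel. (\<lambda>n. I n x) \<longlonglongrightarrow> u x * (\<Sum>i\<in>UNIV. \<Phi>2 i x) - V x * (u x * \<Phi> x)"
    proof (intro AE_I2)
      fix x
      have lm: "(\<lambda>n. m n x) \<longlonglongrightarrow> max 0 (1 - 0 * (x \<bullet> x))"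
        unfolding m_def by (intro tendsto_intros a0)
      have lX: "(\<lambda>n. X n x) \<longlonglongrightarrow> of_real (max 0 (1 - 0 * (x \<bullet> x)) ^ 3)"
        unfolding X_def by (intro tendsto_intros lm)
      have lX1: "(\<lambda>n. X1 n i x) \<longlonglongrightarrow> of_real (- 6 * 0 * x $ i * (max 0 (1 - 0 * (x \<bullet> x)))\<^sup>2)" for i
        unfolding X1_def by (intro tendsto_intros lm a0)
      have lX2: "(\<lambda>n. X2 n i x) \<longlonglongrightarrow> of_real (24 * 0\<^sup>2 * (x $ i)\<^sup>2 * max 0 (1 - 0 * (x \<bullet> x)) - 6 * 0 * (max 0 (1 - 0 * (x \<bullet> x)))\<^sup>2)" for i
        unfolding X2_def by (intro tendsto_intros lm a0)
      have "(\<lambda>n. I n x) \<longlonglongrightarrow> 1 * (u x * (\<Sum>i\<in>UNIV. \<Phi>2 i x) - V x * (u x * \<Phi> x))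
          + (\<Sum>i\<in>UNIV. 2 * 0 * (u x * \<Phi>1 i x) + 0 * (u x * \<Phi> x))"
        unfolding I_eq using lX lX1 lX2 by (intro tendsto_intros) simp_all
      then show "(\<lambda>n. I n x) \<longlonglongrightarrow> u x * (\<Sum>i\<in>UNIV. \<Phi>2 i x) - V x * (u x * \<Phi> x)" by simp
    qed
    show "AE x in lborel. norm (I n x) \<le> L * exp (- c * norm x)" for n
    proof (intro AE_I2)
      fix x :: "real ^ 'n"
      define e where "e = exp (- c * norm x)"
      have "norm (X n x * (u x * (\<Sum>i\<in>UNIV. \<Phi>2 i x) - V x * (u x * \<Phi> x)))
          \<le> 1 * ((\<Sum>i\<in>(UNIV::'n set). K * e) + \<bar>Q\<bar> * (K * e))"
        unfolding norm_mult[of "X n x"]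
      proof (intro mult_mono nX)
        have "norm (u x * (\<Sum>i\<in>UNIV. \<Phi>2 i x)) \<le> (\<Sum>i\<in>(UNIV::'n set). K * e)"
          unfolding sum_distrib_left e_def by (intro sum_norm_le B)
        then show "norm (u x * (\<Sum>i\<in>UNIV. \<Phi>2 i x) - V x * (u x * \<Phi> x)) \<le> (\<Sum>i\<in>(UNIV::'n set). K * e) + \<bar>Q\<bar> * (K * e)"
          using BV[of x] by (intro order_trans[OF norm_triangle_ineq4] add_mono) (auto simp: e_def)
      qed auto
      moreover have "norm (\<Sum>i\<in>UNIV. 2 * X1 n i x * (u x * \<Phi>1 i x) + X2 n i x * (u x * \<Phi> x))
          \<le> (\<Sum>i\<in>(UNIV::'n set). 12 * (K * e) + 30 * (K * e))"
      proof (intro sum_norm_le order_trans[OF norm_triangle_ineq] add_mono)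
        fix i :: 'n
        have "norm (2 * X1 n i x) \<le> 12" using nX(2)[of n i x] by (simp add: norm_mult)
        then show "norm (2 * X1 n i x * (u x * \<Phi>1 i x)) \<le> 12 * (K * e)"
          unfolding norm_mult[of "2 * X1 n i x"] e_def by (intro mult_mono B) auto
        show "norm (X2 n i x * (u x * \<Phi> x)) \<le> 30 * (K * e)"
          unfolding norm_mult[of "X2 n i x"] e_def by (intro mult_mono B nX) auto
      qed
      ultimately have "norm (I n x) \<le> 1 * ((\<Sum>i\<in>(UNIV::'n set). K * e) + \<bar>Q\<bar> * (K * e))
          + (\<Sum>i\<in>(UNIV::'n set). 12 * (K * e) + 30 * (K * e))"
        unfolding I_eq by (intro order_trans[OF norm_triangle_ineq] add_mono)
      also have "\<dots> = L * e" by (simp add: L_def algebra_simps)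
      finally show "norm (I n x) \<le> L * exp (- c * norm x)" by (simp add: e_def)
    qed
  qed
  then show ?thesis unfolding I0 by (simp add: LIMSEQ_const_iff)
qed

section \<open>Product test functions\<close>

text \<open>The normalized antiderivative of the C1 bump (t - b)_+^2 (b1 - t)_+^2 is a C2 step from
  0 to 1.\<close>

lemma plateau_exists:
  fixes b b1 :: real
  assumes "b < b1"
  obtains \<theta> \<theta>1 \<theta>2 :: "real \<Rightarrow> real" and T where
    "\<And>t. (\<theta> has_real_derivative \<theta>1 t) (at t)" "\<And>t. (\<theta>1 has_real_derivative \<theta>2 t) (at t)"
    "continuous_on UNIV \<theta>2"
    "\<And>t. t \<le> b \<Longrightarrow> \<theta> t = 0 \<and> \<theta>1 t = 0 \<and> \<theta>2 t = 0"
    "\<And>t. t \<ge> b1 \<Longrightarrow> \<theta> t = 1 \<and> \<theta>1 t = 0 \<and> \<theta>2 t = 0"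
    "\<And>t. \<bar>\<theta> t\<bar> \<le> T" "\<And>t. \<bar>\<theta>1 t\<bar> \<le> T" "\<And>t. \<bar>\<theta>2 t\<bar> \<le> T"
proof -
  define p where "p t = (max 0 (t - b))\<^sup>2 * (max 0 (b1 - t))\<^sup>2" for t
  define p' where "p' t = (2 * max 0 (t - b)) * (max 0 (b1 - t))\<^sup>2 - (max 0 (t - b))\<^sup>2 * (2 * max 0 (b1 - t))" for t
  have dp: "(p has_real_derivative p' t) (at t)" for t
  proof -
    have "((\<lambda>t. (max 0 (t - b))\<^sup>2) has_real_derivative 2 * max 0 (t - b) * 1) (at t)"
      by (rule DERIV_chain2[OF max_square_deriv]) (auto intro!: derivative_eq_intros)
    moreover have "((\<lambda>t. (max 0 (b1 - t))\<^sup>2) has_real_derivative 2 * max 0 (b1 - t) * (- 1)) (at t)"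
      by (rule DERIV_chain2[OF max_square_deriv]) (auto intro!: derivative_eq_intros)
    ultimately have "((\<lambda>t. (max 0 (t - b))\<^sup>2 * (max 0 (b1 - t))\<^sup>2) has_real_derivative
        (2 * max 0 (t - b) * 1) * (max 0 (b1 - t))\<^sup>2 + (2 * max 0 (b1 - t) * (- 1)) * (max 0 (t - b))\<^sup>2) (at t)"
      by (rule DERIV_mult)
    then show ?thesis unfolding p_def[abs_def] p'_def by (simp add: algebra_simps)
  qed
  have cp: "continuous_on UNIV p" "continuous_on UNIV p'"
    unfolding p_def[abs_def] p'_def[abs_def] by (intro continuous_intros)+
  have zp: "p t = 0" "p' t = 0" if "t \<le> b \<or> b1 \<le> t" for t
    using that by (auto simp: p_def p'_def)
  define I where "I t = integral {b..t} p" for t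
  have dI: "(I has_vector_derivative p t) (at t)" for t
    unfolding I_def[abs_def] using cp zp by (intro has_vector_derivative_integral_from) auto
  have I0: "I t = 0" if "t \<le> b" for t using that by (cases "t = b") (auto simp: I_def)
  have I1: "I t = I b1" if "b1 \<le> t" for t
  proof -
    have "integral {b1..t} p = integral {b1..t} (\<lambda>_. 0)"
      by (rule integral_cong) (use zp in auto)
    moreover have "p integrable_on {b..t}"
      by (intro integrable_continuous_real continuous_on_subset[OF cp(1)]) auto
    ultimately show ?thesis
      using Henstock_Kurzweil_Integration.integral_combine[of b b1 t p] that assms
      by (simp add: I_def)
  qed
  have pos: "I b1 > 0"
  proof -
    have pn: "p t \<ge> 0" for t by (simp add: p_def)
    have pi: "p integrable_on {b..b1}"
      by (intro integrable_continuous_real continuous_on_subset[OF cp(1)]) auto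
    have "I b1 \<noteq> 0"
    proof
      assume "I b1 = 0"
      then have "\<forall>t\<in>{b..b1}. p t = 0"
        using integral_eq_0_iff[of b b1 p] assms pn continuous_on_subset[OF cp(1)]
        by (auto simp: I_def)
      then have "p ((b + b1) / 2) = 0" using assms by (simp add: field_simps)
      then show False using assms by (simp add: p_def max_def field_simps split: if_splits)
    qed
    moreover have "I b1 \<ge> 0" unfolding I_def by (rule Henstock_Kurzweil_Integration.integral_nonneg[OF pi]) (rule pn)
    ultimately show ?thesis by simp
  qed
  define \<theta> where "\<theta> t = I t / I b1" for t
  define \<theta>1 where "\<theta>1 t = p t / I b1" for t
  define \<theta>2 where "\<theta>2 t = p' t / I b1" for t
  have d1: "(\<theta> has_real_derivative \<theta>1 t) (at t)" for t
    unfolding \<theta>_def[abs_def] \<theta>1_def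
    by (intro DERIV_cdivide) (use dI in \<open>simp add: has_real_derivative_iff_has_vector_derivative\<close>)
  have d2: "(\<theta>1 has_real_derivative \<theta>2 t) (at t)" for t
    unfolding \<theta>1_def[abs_def] \<theta>2_def by (intro DERIV_cdivide dp)
  have c0: "continuous_on UNIV \<theta>" using d1 by (meson DERIV_continuous_on has_field_derivative_at_within)
  have c1: "continuous_on UNIV \<theta>1" using d2 by (meson DERIV_continuous_on has_field_derivative_at_within)
  have c2: "continuous_on UNIV \<theta>2" unfolding \<theta>2_def[abs_def] using pos by (intro continuous_intros cp) auto
  have z: "\<theta> t = 0 \<and> \<theta>1 t = 0 \<and> \<theta>2 t = 0" if "t \<le> b" for t
    using that zp I0 by (simp add: \<theta>_def \<theta>1_def \<theta>2_def)
  have o: "\<theta> t = 1 \<and> \<theta>1 t = 0 \<and> \<theta>2 t = 0" if "t \<ge> b1" for t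
    using that zp I1[OF that] pos by (simp add: \<theta>_def \<theta>1_def \<theta>2_def)
  have bd: "\<exists>K. \<forall>t\<in>{b..b1}. \<bar>f t\<bar> \<le> K" if "continuous_on UNIV f" for f :: "real \<Rightarrow> real"
  proof -
    have "bounded (f ` {b..b1})"
      by (intro compact_imp_bounded compact_continuous_image continuous_on_subset[OF that]) auto
    then show ?thesis by (auto simp: bounded_iff)
  qed
  obtain K0 K1 K2 where K: "\<forall>t\<in>{b..b1}. \<bar>\<theta> t\<bar> \<le> K0" "\<forall>t\<in>{b..b1}. \<bar>\<theta>1 t\<bar> \<le> K1" "\<forall>t\<in>{b..b1}. \<bar>\<theta>2 t\<bar> \<le> K2"
    using bd[OF c0] bd[OF c1] bd[OF c2] by blast
  define T where "T = \<bar>K0\<bar> + \<bar>K1\<bar> + \<bar>K2\<bar> + 1"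
  have "\<bar>\<theta> t\<bar> \<le> T \<and> \<bar>\<theta>1 t\<bar> \<le> T \<and> \<bar>\<theta>2 t\<bar> \<le> T" for t
  proof -
    consider "t \<le> b" | "t \<in> {b..b1}" | "t \<ge> b1" by force
    then show ?thesis
    proof cases
      case 1
      show ?thesis using z[OF 1] by (simp add: T_def)
    next
      case 2
      then have "\<bar>\<theta> t\<bar> \<le> K0" "\<bar>\<theta>1 t\<bar> \<le> K1" "\<bar>\<theta>2 t\<bar> \<le> K2" using K by auto
      then show ?thesis unfolding T_def by linarith
    next
      case 3
      show ?thesis using o[OF 3] by (simp add: T_def)
    qed
  qed
  then have "\<And>t. \<bar>\<theta> t\<bar> \<le> T" "\<And>t. \<bar>\<theta>1 t\<bar> \<le> T" "\<And>t. \<bar>\<theta>2 t\<bar> \<le> T" by blast+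
  from that[OF d1 d2 c2 z o this] show thesis .
qed

lemma partials2_ridge:
  fixes d :: "real ^ 'n::finite"
  assumes "\<And>s. (f has_vector_derivative f1 s) (at s)" "\<And>s. (f1 has_vector_derivative f2 s) (at s)"
    "continuous_on UNIV f2"
  shows "partials2 (\<lambda>x. f (x \<bullet> d)) (\<lambda>i x. of_real (d $ i) * f1 (x \<bullet> d)) (\<lambda>i x. of_real ((d $ i)\<^sup>2) * f2 (x \<bullet> d))"
proof -
  have der: "has_partial (\<lambda>x. g (x \<bullet> d)) i (of_real (d $ i) * g' (x \<bullet> d)) x"
    if "\<And>s. (g has_vector_derivative g' s) (at s)" for g g' :: "real \<Rightarrow> complex" and i x
  proof -
    have "((\<lambda>t. g (x \<bullet> d + t * d $ i)) has_vector_derivative d $ i *\<^sub>R g' (x \<bullet> d + 0 * d $ i)) (at 0)"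
    proof (rule vector_diff_chain_at[unfolded comp_def])
      show "((\<lambda>t. x \<bullet> d + t * d $ i) has_vector_derivative d $ i) (at 0)"
        by (auto intro!: derivative_eq_intros simp flip: has_real_derivative_iff_has_vector_derivative)
    qed (rule that)
    then have "((\<lambda>t. g (x \<bullet> d + t * d $ i)) has_vector_derivative of_real (d $ i) * g' (x \<bullet> d)) (at 0)"
      by (simp add: scaleR_conv_of_real)
    then show ?thesis
      by (simp add: has_partial_def inner_add_left inner_axis')
  qed
  have c: "continuous_on UNIV f" "continuous_on UNIV f1"
    using assms(1,2) has_vector_derivative_at_within continuous_on_vector_derivative by blast+
  have cc: "continuous_on UNIV (\<lambda>x. g (x \<bullet> d))" if "continuous_on UNIV g" for g :: "real \<Rightarrow> complex"
    by (rule continuous_on_compose2[OF that]) (auto intro!: continuous_intros)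
  show ?thesis
    unfolding partials2_def
  proof (intro conjI allI)
    fix i x
    show "has_partial (\<lambda>x. f (x \<bullet> d)) i (of_real (d $ i) * f1 (x \<bullet> d)) x" by (rule der[OF assms(1)])
    show "has_partial (\<lambda>x. of_real (d $ i) * f1 (x \<bullet> d)) i (of_real ((d $ i)\<^sup>2) * f2 (x \<bullet> d)) x"
      using has_partial_mult[OF has_partial_const[of "of_real (d $ i)" i x] der[OF assms(2), of i x]]
      by (simp add: power2_eq_square mult.assoc)
  qed (auto intro!: continuous_intros cc c assms(3))
qed

lemma partials2_exp:
  fixes e \<xi> :: "real ^ 'n::finite" and z :: complex
  defines "E \<equiv> \<lambda>x. exp (z * of_real (x \<bullet> e) + \<i> * of_real (x \<bullet> \<xi>))"
    and "L \<equiv> \<lambda>i. z * of_real (e $ i) + \<i> * of_real (\<xi> $ i)"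
  shows "partials2 E (\<lambda>i x. L i * E x) (\<lambda>i x. (L i)\<^sup>2 * E x)"
proof -
  have der: "has_partial E i (L i * E x) x" for i x
  proof -
    have "((\<lambda>t. E (x + t *\<^sub>R axis i 1)) has_vector_derivative L i * E (x + 0 *\<^sub>R axis i 1)) (at 0)"
    proof -
      have "E (x + t *\<^sub>R axis i 1) = E x * exp (of_real t * L i)" for t
        by (simp add: E_def L_def inner_add_left inner_axis' exp_add[symmetric] algebra_simps)
      moreover have "((\<lambda>t. E x * exp (of_real t * L i)) has_vector_derivative E x * (L i * exp (of_real 0 * L i))) (at 0)"
      proof -
        have "((\<lambda>w. E x * exp (w * L i)) has_field_derivative E x * (L i * exp (of_real 0 * L i))) (at (of_real 0))"
          by (auto intro!: derivative_eq_intros)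
        from has_vector_derivative_real_field[OF this] show ?thesis by simp
      qed
      ultimately show ?thesis by (simp add: mult.commute)
    qed
    then show ?thesis by (simp add: has_partial_def)
  qed
  show ?thesis
    unfolding partials2_def
  proof (intro conjI allI)
    fix i x
    show "has_partial E i (L i * E x) x" by (rule der)
    show "has_partial (\<lambda>x. L i * E x) i ((L i)\<^sup>2 * E x) x"
      using has_partial_mult[OF has_partial_const[of "L i" i x] der[of i x]]
      by (simp add: power2_eq_square mult.assoc)
  qed (auto simp: E_def intro!: continuous_intros)
qed

text \<open>The Laplacian of \<phi>(x . d) \<theta>(x . e) E(x), with the letters f, g and E
  standing for values at one point, so that this is pure algebra. Orthogonality kills all mixed
  terms except the one pairing e with e; e itself is not normalized.\<close>

lemma product_test_laplacian:
  fixes d e \<xi> :: "real ^ 'n::finite" and z E f0 f1 f2 g0 g1 g2 :: complex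
  assumes orth: "d \<bullet> d = 1" "d \<bullet> e = 0" "d \<bullet> \<xi> = 0" "e \<bullet> \<xi> = 0"
  defines "L \<equiv> \<lambda>i. z * of_real (e $ i) + \<i> * of_real (\<xi> $ i)"
  shows "(\<Sum>i\<in>UNIV. (f0 * g0) * ((L i)\<^sup>2 * E) + 2 * (f0 * (of_real (e $ i) * g1) + (of_real (d $ i) * f1) * g0) * (L i * E)
      + (f0 * (of_real ((e $ i)\<^sup>2) * g2) + 2 * (of_real (d $ i) * f1) * (of_real (e $ i) * g1) + (of_real ((d $ i)\<^sup>2) * f2) * g0) * E)
    = (f0 * g0 * (z\<^sup>2 * of_real (e \<bullet> e) - of_real (\<xi> \<bullet> \<xi>)) + 2 * z * f0 * g1 * of_real (e \<bullet> e) + f0 * g2 * of_real (e \<bullet> e) + f2 * g0) * E"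
proof -
  define D X Y where "D i = (of_real (d $ i) :: complex)" and "X i = (of_real (e $ i) :: complex)"
    and "Y i = (of_real (\<xi> $ i) :: complex)" for i
  have S: "(\<Sum>i\<in>UNIV. of_real (v $ i) * of_real (w $ i)) = (of_real (v \<bullet> w) :: complex)" for v w :: "real ^ 'n"
    by (simp add: inner_vec_def)
  have S': "(\<Sum>i\<in>UNIV. D i * D i) = 1" "(\<Sum>i\<in>UNIV. D i * X i) = 0" "(\<Sum>i\<in>UNIV. D i * Y i) = 0"
    "(\<Sum>i\<in>UNIV. X i * Y i) = 0" "(\<Sum>i\<in>UNIV. X i * X i) = of_real (e \<bullet> e)" "(\<Sum>i\<in>UNIV. Y i * Y i) = of_real (\<xi> \<bullet> \<xi>)"
    unfolding D_def X_def Y_def S by (simp_all add: orth)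
  have "(\<Sum>i\<in>UNIV. (f0 * g0) * ((L i)\<^sup>2 * E) + 2 * (f0 * (of_real (e $ i) * g1) + (of_real (d $ i) * f1) * g0) * (L i * E)
      + (f0 * (of_real ((e $ i)\<^sup>2) * g2) + 2 * (of_real (d $ i) * f1) * (of_real (e $ i) * g1) + (of_real ((d $ i)\<^sup>2) * f2) * g0) * E)
    = (\<Sum>i\<in>UNIV. (f0 * g0 * z\<^sup>2 * E + 2 * f0 * g1 * z * E + f0 * g2 * E) * (X i * X i)
        + (2 * \<i> * f0 * g0 * z * E + 2 * \<i> * f0 * g1 * E) * (X i * Y i) + (- f0 * g0 * E) * (Y i * Y i)
        + (2 * f1 * g0 * z * E + 2 * f1 * g1 * E) * (D i * X i) + (2 * \<i> * f1 * g0 * E) * (D i * Y i) + (f2 * g0 * E) * (D i * D i))"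
    by (rule sum.cong) (simp_all add: L_def D_def X_def Y_def power2_eq_square algebra_simps)
  also have "\<dots> = (f0 * g0 * z\<^sup>2 * E + 2 * f0 * g1 * z * E + f0 * g2 * E) * of_real (e \<bullet> e)
        + (- f0 * g0 * E) * of_real (\<xi> \<bullet> \<xi>) + f2 * g0 * E"
    unfolding sum.distrib sum_distrib_left[symmetric] S' by simp
  finally show ?thesis by (simp add: algebra_simps)
qed

section \<open>Vanishing in the half space and in the corners\<close>

text \<open>The unit direction d is a parameter so that the reflection in the distinguished
  coordinate is just the instance with -d.\<close>

locale decaying_solution =
  fixes u V :: "real ^ 'n::finite \<Rightarrow> complex" and d :: "real ^ 'n" and R0 lam eps C :: real
  assumes R0: "R0 > 0" and lam: "lam > 0" and eps: "eps > 0" and d: "norm d = 1"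
    and weak: "weak_solution R0 V u"
    and cu: "continuous_on {x. norm x \<ge> R0} u" and cV: "continuous_on {x. norm x \<ge> R0} V"
    and V: "\<And>x. norm x \<ge> R0 \<Longrightarrow> norm (V x) \<le> lam\<^sup>2"
    and u: "\<And>x. norm x \<ge> R0 \<Longrightarrow> norm (u x) \<le> C * exp (- (lam + eps) * norm x)"
begin

lemma C_nonneg: "C \<ge> 0"
proof -
  have "norm (R0 *\<^sub>R d) \<ge> R0" using d R0 by simp
  from order_trans[OF norm_ge_zero u[OF this]] show ?thesis by (simp add: zero_le_mult_iff)
qed

lemma inner_d_self: "d \<bullet> d = 1" using d by (simp add: norm_eq_1)

lemma inner_d_le: "x \<bullet> d \<le> norm x"
  using norm_cauchy_schwarz[of x d] d by simp

text \<open>The equation for \<phi> cancels the potential, leaving the source term and the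
  commutator with the cutoff \<theta>. The potential is compared with \<open>qt\<close> only after
  multiplication by \<phi>, so \<open>qt\<close> may be any extension beyond the region where \<phi>
  lives.\<close>

lemma product_test_integral:
  fixes \<phi> \<phi>1 \<phi>2 \<theta> \<theta>1 \<theta>2 \<psi> qt :: "real \<Rightarrow> complex" and e \<xi> :: "real ^ 'n" and z :: complex
  defines "E \<equiv> \<lambda>x. exp (z * of_real (x \<bullet> e) + \<i> * of_real (x \<bullet> \<xi>))"
  assumes d\<phi>: "\<And>s. (\<phi> has_vector_derivative \<phi>1 s) (at s)" "\<And>s. (\<phi>1 has_vector_derivative \<phi>2 s) (at s)" "continuous_on UNIV \<phi>2"
    and d\<theta>: "\<And>s. (\<theta> has_vector_derivative \<theta>1 s) (at s)" "\<And>s. (\<theta>1 has_vector_derivative \<theta>2 s) (at s)" "continuous_on UNIV \<theta>2"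
    and orth: "d \<bullet> e = 0" "d \<bullet> \<xi> = 0" "e \<bullet> \<xi> = 0"
    and ode: "\<And>s. \<phi>2 s = (qt s - (z\<^sup>2 * of_real (e \<bullet> e) - of_real (\<xi> \<bullet> \<xi>))) * \<phi> s + \<psi> s"
    and pot: "\<And>x. norm x \<ge> R0 \<Longrightarrow> V x * \<phi> (x \<bullet> d) = qt (x \<bullet> d) * \<phi> (x \<bullet> d)"
    and R: "R0 < R1"
    and van: "\<And>x. norm x \<le> R1 \<Longrightarrow> (\<phi> (x \<bullet> d) = 0 \<and> \<phi>1 (x \<bullet> d) = 0 \<and> \<phi>2 (x \<bullet> d) = 0) \<or>
                (\<theta> (x \<bullet> e) = 0 \<and> \<theta>1 (x \<bullet> e) = 0 \<and> \<theta>2 (x \<bullet> e) = 0)"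
    and c: "c > 0"
    and bnd: "\<And>x f g. norm x \<ge> R0 \<Longrightarrow> f \<in> {\<phi>, \<phi>1, \<phi>2} \<Longrightarrow> g \<in> {\<theta>, \<theta>1, \<theta>2} \<Longrightarrow>
        norm (u x * f (x \<bullet> d) * g (x \<bullet> e) * E x) \<le> K * exp (- c * norm x)"
  shows "(LINT x|lborel. u x * (\<psi> (x \<bullet> d) * \<theta> (x \<bullet> e) +
      (2 * z * \<theta>1 (x \<bullet> e) + \<theta>2 (x \<bullet> e)) * of_real (e \<bullet> e) * \<phi> (x \<bullet> d)) * E x) = 0"
proof -
  define L where "L i = z * of_real (e $ i) + \<i> * of_real (\<xi> $ i)" for i
  define A where "A x = \<phi> (x \<bullet> d) * \<theta> (x \<bullet> e)" for x
  define A1 where "A1 i x = \<phi> (x \<bullet> d) * (of_real (e $ i) * \<theta>1 (x \<bullet> e)) + (of_real (d $ i) * \<phi>1 (x \<bullet> d)) * \<theta> (x \<bullet> e)" for i x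
  define A2 where "A2 i x = \<phi> (x \<bullet> d) * (of_real ((e $ i)\<^sup>2) * \<theta>2 (x \<bullet> e))
      + 2 * (of_real (d $ i) * \<phi>1 (x \<bullet> d)) * (of_real (e $ i) * \<theta>1 (x \<bullet> e))
      + (of_real ((d $ i)\<^sup>2) * \<phi>2 (x \<bullet> d)) * \<theta> (x \<bullet> e)" for i x
  define P where "P x = A x * E x" for x
  define P1 where "P1 i x = A x * (L i * E x) + A1 i x * E x" for i x
  define P2 where "P2 i x = A x * ((L i)\<^sup>2 * E x) + 2 * A1 i x * (L i * E x) + A2 i x * E x" for i x
  have PP: "partials2 P P1 P2"
    unfolding P_def[abs_def] P1_def[abs_def] P2_def[abs_def] A_def A1_def A2_def L_def E_def
    by (rule partials2_mult[OF partials2_mult[OF partials2_ridge[OF d\<phi>, of d] partials2_ridge[OF d\<theta>, of e]] partials2_exp[of z e \<xi>]])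
  have PZ: "P x = 0 \<and> P1 i x = 0 \<and> P2 i x = 0" if "norm x \<le> R1" for x i
    using van[OF that] by (auto simp: P_def P1_def P2_def A_def A1_def A2_def)
  \<comment> \<open>One bound for all coefficients d_i, e_i and L_i of the derivatives, and at least
    1 so that B^2 also dominates single factors.\<close>
  define B where "B = 1 + norm e + norm z * norm e + norm \<xi>"
  have B1: "B \<ge> 1" by (simp add: B_def add_nonneg_nonneg)
  have cd: "\<bar>d $ i\<bar> \<le> B" for i
    using component_le_norm_cart[of d i] d B1 by linarith
  have ce: "\<bar>e $ i\<bar> \<le> B" for i
    using component_le_norm_cart[of e i] by (simp add: B_def add_increasing add_increasing2)
  have cL: "norm (L i) \<le> B" for i
  proof -
    have "norm (L i) \<le> norm z * \<bar>e $ i\<bar> + \<bar>\<xi> $ i\<bar>"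
      unfolding L_def by (rule order_trans[OF norm_triangle_ineq]) (simp add: norm_mult)
    also have "\<dots> \<le> norm z * norm e + norm \<xi>"
      by (intro add_mono mult_left_mono component_le_norm_cart) auto
    finally show ?thesis unfolding B_def using norm_ge_zero[of e] by linarith
  qed
  have K0: "K \<ge> 0"
  proof -
    have "norm (R0 *\<^sub>R d) \<ge> R0" using d R0 by simp
    from order_trans[OF norm_ge_zero bnd[OF this, of \<phi> \<theta>]] show ?thesis by (simp add: zero_le_mult_iff)
  qed
  have BB: "1 \<le> B\<^sup>2" "B \<le> B\<^sup>2" using B1 self_le_power[of B 2] by (auto simp: one_le_power)
  have bT: "norm (k * (u x * f (x \<bullet> d) * g (x \<bullet> e) * E x)) \<le> m * B\<^sup>2 * (K * exp (- c * norm x))"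
    if "norm x \<ge> R0" "f \<in> {\<phi>, \<phi>1, \<phi>2}" "g \<in> {\<theta>, \<theta>1, \<theta>2}" "norm k \<le> m * B\<^sup>2" for k x f g m
    unfolding norm_mult[of k] using bnd[OF that(1-3)] that(4)
    by (intro mult_mono) (auto intro: order_trans[OF norm_ge_zero])
  have kk: "norm (k1 * k2) \<le> 1 * B\<^sup>2" if "norm k1 \<le> B" "norm k2 \<le> B" for k1 k2 :: complex
    unfolding norm_mult power2_eq_square using that B1 by (simp add: mult_mono')
  have k2: "norm (2 * (k1 * k2)) \<le> 2 * B\<^sup>2" if "norm k1 \<le> B" "norm k2 \<le> B" for k1 k2 :: complex
    using kk[OF that] by (simp add: norm_mult)
  have nB: "norm (of_real (d $ i) :: complex) \<le> B" "norm (of_real (e $ i) :: complex) \<le> B" for i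
    using cd ce by auto
  \<comment> \<open>The 9 counts the terms of the second derivative of a threefold product, 1 + 1 +
    1 + 2 + 2 + 2; it also covers the shorter expressions.\<close>
  have b0: "norm (u x * P x) \<le> 9 * B\<^sup>2 * K * exp (- c * norm x)"
    and b1: "norm (u x * P1 i x) \<le> 9 * B\<^sup>2 * K * exp (- c * norm x)"
    and b2: "norm (u x * P2 i x) \<le> 9 * B\<^sup>2 * K * exp (- c * norm x)" if x: "norm x \<ge> R0" for x i
  proof -
    let ?e = "K * exp (- c * norm x)"
    let ?T = "\<lambda>f g. u x * f (x \<bullet> d) * g (x \<bullet> e) * E x"
    let ?D = "of_real (d $ i) :: complex" and ?X = "of_real (e $ i) :: complex"
    define Z where "Z = B\<^sup>2 * ?e"
    have e0: "0 \<le> Z" using K0 by (simp add: Z_def)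
    have r9: "9 * B\<^sup>2 * K * exp (- c * norm x) = 9 * Z" and mZ: "m * B\<^sup>2 * ?e = m * Z" for m
      by (simp_all add: Z_def)
    have "norm (1 * ?T \<phi> \<theta>) \<le> 1 * B\<^sup>2 * ?e" by (rule bT[OF x]) (use BB in auto)
    moreover have "u x * P x = 1 * ?T \<phi> \<theta>" by (simp add: P_def A_def mult.assoc)
    ultimately show "norm (u x * P x) \<le> 9 * B\<^sup>2 * K * exp (- c * norm x)"
      using e0 unfolding r9 mZ by (simp only:)
    have "norm (L i * ?T \<phi> \<theta>) \<le> 1 * B\<^sup>2 * ?e" "norm (?X * ?T \<phi> \<theta>1) \<le> 1 * B\<^sup>2 * ?e" "norm (?D * ?T \<phi>1 \<theta>) \<le> 1 * B\<^sup>2 * ?e"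
      by (rule bT[OF x]; use BB cL[of i] nB[of i] in force)+
    then have "norm (L i * ?T \<phi> \<theta> + ?X * ?T \<phi> \<theta>1 + ?D * ?T \<phi>1 \<theta>) \<le> 1 * B\<^sup>2 * ?e + 1 * B\<^sup>2 * ?e + 1 * B\<^sup>2 * ?e"
      by (intro order_trans[OF norm_triangle_ineq] add_mono)
    moreover have "u x * P1 i x = L i * ?T \<phi> \<theta> + ?X * ?T \<phi> \<theta>1 + ?D * ?T \<phi>1 \<theta>"
      by (simp add: P1_def A_def A1_def algebra_simps)
    ultimately show "norm (u x * P1 i x) \<le> 9 * B\<^sup>2 * K * exp (- c * norm x)"
      using e0 unfolding r9 mZ by (simp only:)
    have "norm ((L i * L i) * ?T \<phi> \<theta>) \<le> 1 * B\<^sup>2 * ?e" "norm ((?X * ?X) * ?T \<phi> \<theta>2) \<le> 1 * B\<^sup>2 * ?e"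
      "norm ((?D * ?D) * ?T \<phi>2 \<theta>) \<le> 1 * B\<^sup>2 * ?e"
      by (rule bT[OF x _ _ kk]; use cL[of i] nB[of i] in force)+
    moreover have "norm ((2 * (?X * L i)) * ?T \<phi> \<theta>1) \<le> 2 * B\<^sup>2 * ?e" "norm ((2 * (?D * L i)) * ?T \<phi>1 \<theta>) \<le> 2 * B\<^sup>2 * ?e"
      "norm ((2 * (?D * ?X)) * ?T \<phi>1 \<theta>1) \<le> 2 * B\<^sup>2 * ?e"
      by (rule bT[OF x _ _ k2]; use cL[of i] nB[of i] in force)+
    ultimately have "norm ((L i * L i) * ?T \<phi> \<theta> + (?X * ?X) * ?T \<phi> \<theta>2 + (?D * ?D) * ?T \<phi>2 \<theta>
        + (2 * (?X * L i)) * ?T \<phi> \<theta>1 + (2 * (?D * L i)) * ?T \<phi>1 \<theta> + (2 * (?D * ?X)) * ?T \<phi>1 \<theta>1)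
      \<le> 1 * B\<^sup>2 * ?e + 1 * B\<^sup>2 * ?e + 1 * B\<^sup>2 * ?e + 2 * B\<^sup>2 * ?e + 2 * B\<^sup>2 * ?e + 2 * B\<^sup>2 * ?e"
      by (intro order_trans[OF norm_triangle_ineq] add_mono)
    moreover have "u x * P2 i x = (L i * L i) * ?T \<phi> \<theta> + (?X * ?X) * ?T \<phi> \<theta>2 + (?D * ?D) * ?T \<phi>2 \<theta>
        + (2 * (?X * L i)) * ?T \<phi> \<theta>1 + (2 * (?D * L i)) * ?T \<phi>1 \<theta> + (2 * (?D * ?X)) * ?T \<phi>1 \<theta>1"
      by (simp add: P2_def A_def A1_def A2_def power2_eq_square algebra_simps)
    ultimately show "norm (u x * P2 i x) \<le> 9 * B\<^sup>2 * K * exp (- c * norm x)"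
      using e0 unfolding r9 mZ by (simp only:)
  qed
  have int0: "(LINT x|lborel. u x * (\<Sum>i\<in>UNIV. P2 i x) - V x * (u x * P x)) = 0"
    by (rule weak_solution_decaying_test[OF weak cu cV V R PP PZ c b0 b1 b2])
  have "u x * (\<Sum>i\<in>UNIV. P2 i x) - V x * (u x * P x) = u x * (\<psi> (x \<bullet> d) * \<theta> (x \<bullet> e) +
      (2 * z * \<theta>1 (x \<bullet> e) + \<theta>2 (x \<bullet> e)) * of_real (e \<bullet> e) * \<phi> (x \<bullet> d)) * E x" for x
  proof -
    have V': "V x * (\<phi> (x \<bullet> d) * \<theta> (x \<bullet> e)) = qt (x \<bullet> d) * \<phi> (x \<bullet> d) * \<theta> (x \<bullet> e)"
    proof (cases "norm x \<ge> R0")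
      case True
      then show ?thesis using pot[OF True] by (metis mult.assoc)
    next
      case False
      then show ?thesis using van[of x] R by auto
    qed
    have "(\<Sum>i\<in>UNIV. P2 i x) = (\<phi> (x \<bullet> d) * \<theta> (x \<bullet> e) * (z\<^sup>2 * of_real (e \<bullet> e) - of_real (\<xi> \<bullet> \<xi>))
        + 2 * z * \<phi> (x \<bullet> d) * \<theta>1 (x \<bullet> e) * of_real (e \<bullet> e) + \<phi> (x \<bullet> d) * \<theta>2 (x \<bullet> e) * of_real (e \<bullet> e)
        + \<phi>2 (x \<bullet> d) * \<theta> (x \<bullet> e)) * E x"
      unfolding P2_def A_def A1_def A2_def L_def
      by (rule product_test_laplacian[OF inner_d_self orth])
    also have "\<dots> = (qt (x \<bullet> d) * \<phi> (x \<bullet> d) * \<theta> (x \<bullet> e) + \<psi> (x \<bullet> d) * \<theta> (x \<bullet> e) +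
      (2 * z * \<theta>1 (x \<bullet> e) + \<theta>2 (x \<bullet> e)) * of_real (e \<bullet> e) * \<phi> (x \<bullet> d)) * E x"
      unfolding ode by (simp add: algebra_simps)
    also have "u x * \<dots> - V x * (u x * P x) = u x * (\<psi> (x \<bullet> d) * \<theta> (x \<bullet> e) +
      (2 * z * \<theta>1 (x \<bullet> e) + \<theta>2 (x \<bullet> e)) * of_real (e \<bullet> e) * \<phi> (x \<bullet> d)) * E x"
    proof -
      have "V x * (u x * P x) = u x * (V x * (\<phi> (x \<bullet> d) * \<theta> (x \<bullet> e))) * E x"
        by (simp add: P_def A_def)
      then show ?thesis unfolding V' by (auto simp: algebra_simps)
    qed
    finally show ?thesis .
  qed
  then show ?thesis using int0 by (simp only:)
qed

text \<open>Used with \<theta> = 1 and \<xi> = 0, so there is no commutator. Because e is not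
  normalized, evaluation at z = i reaches every frequency orthogonal to d.\<close>

lemma halfspace_integral_zero:
  fixes qt \<psi> :: "real \<Rightarrow> complex" and e :: "real ^ 'n"
  assumes a: "a > R0"
    and qt: "continuous_on UNIV qt" "\<And>s. norm (qt s) \<le> lam\<^sup>2"
    and Vq: "\<And>x. norm x \<ge> R0 \<Longrightarrow> x \<bullet> d \<ge> a \<Longrightarrow> V x = qt (x \<bullet> d)"
    and \<psi>: "continuous_on UNIV \<psi>" "\<And>s. norm (\<psi> s) \<le> 1" "\<And>s. s \<le> a \<Longrightarrow> \<psi> s = 0"
    and e: "d \<bullet> e = 0"
  shows "(LINT x|lborel. u x * \<psi> (x \<bullet> d) * exp (\<i> * of_real (x \<bullet> e))) = 0"
proof -
  interpret W: volterra qt \<psi> a "lam\<^sup>2" 1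
    by unfold_locales (use qt \<psi> in auto)
  define w where "w x = u x * \<psi> (x \<bullet> d)" for x
  have cw: "continuous_on UNIV w"
    unfolding w_def[abs_def]
  proof (rule continuous_mult_exterior[OF cu _ _ a])
    show "continuous_on UNIV (\<lambda>x. \<psi> (x \<bullet> d))"
      by (rule continuous_on_compose2[OF \<psi>(1)]) (auto intro!: continuous_intros)
    show "\<psi> (x \<bullet> d) = 0" if "norm x \<le> a" for x
      using \<psi>(3) that inner_d_le[of x] by simp
  qed
  have bw: "norm (w x) \<le> C * exp (- (lam + eps) * norm x)" for x
  proof (cases "norm x \<ge> R0")
    case True
    have "norm (w x) \<le> (C * exp (- (lam + eps) * norm x)) * 1"
      unfolding w_def norm_mult using u[OF True] \<psi>(2) C_nonneg by (intro mult_mono) auto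
    then show ?thesis by simp
  next
    case False
    then have "\<psi> (x \<bullet> d) = 0" using inner_d_le[of x] a by (intro \<psi>(3)) auto
    then show ?thesis using C_nonneg by (simp add: w_def)
  qed
  \<comment> \<open>A positive substitute for the norm of e, which may be 0.\<close>
  define N where "N = norm e + 1"
  have N: "N > 0" "norm e \<le> N" by (auto simp: N_def add_nonneg_pos)
  \<comment> \<open>In this strip the exponential uses up at most half of the decay of u; the other
    half keeps the integral convergent.\<close>
  define S where "S = {z::complex. \<bar>Re z\<bar> < (lam + eps) / (2 * N)}"
  have Sopen: "open S" unfolding S_def by (intro open_Collect_less continuous_intros)
  have "convex {z::complex. Re z < r}" "convex {z::complex. Re z > r}" for r
    by (rule convex_halfspace_Re_lt convex_halfspace_Re_gt)+
  then have "convex ({z::complex. Re z < (lam + eps) / (2 * N)} \<inter> {z. Re z > - ((lam + eps) / (2 * N))})"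
    by (rule convex_Int)
  also have "{z::complex. Re z < (lam + eps) / (2 * N)} \<inter> {z. Re z > - ((lam + eps) / (2 * N))} = S"
    by (auto simp: S_def)
  finally have Sconn: "connected S" by (rule convex_connected)
  have nexp: "norm (exp (z * of_real (x \<bullet> e))) \<le> exp (\<bar>Re z\<bar> * N * norm x)" for z and x :: "real ^ 'n"
  proof -
    have "\<bar>x \<bullet> e\<bar> \<le> N * norm x"
      using Cauchy_Schwarz_ineq2[of x e] mult_left_mono[OF N(2), of "norm x"] by (simp add: mult.commute)
    then have "\<bar>Re z\<bar> * \<bar>x \<bullet> e\<bar> \<le> \<bar>Re z\<bar> * (N * norm x)" by (intro mult_left_mono) auto
    moreover have "Re z * (x \<bullet> e) \<le> \<bar>Re z\<bar> * \<bar>x \<bullet> e\<bar>" by (metis abs_ge_self abs_mult)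
    ultimately show ?thesis by (simp add: mult.assoc)
  qed
  define H where "H z = (LINT x|lborel. w x * exp (z * of_real (x \<bullet> e)))" for z
  have holH: "H holomorphic_on S"
    unfolding H_def[abs_def]
  proof (rule holomorphic_on_dominated_integral[OF Sopen])
    have "continuous_on UNIV (\<lambda>x. w x * exp (z * of_real (x \<bullet> e)))" for z
      by (intro continuous_intros cw)
    then show "(\<lambda>x. w x * exp (z * of_real (x \<bullet> e))) \<in> borel_measurable lborel" for z
      by (simp add: borel_measurable_continuous_onI)
    show "(\<lambda>z. w x * exp (z * of_real (x \<bullet> e))) holomorphic_on S" for x
      by (intro holomorphic_intros)
    fix z0 assume "z0 \<in> S"
    let ?g = "\<lambda>x::real ^ 'n. C * exp (- ((lam + eps) / 2) * norm x)"
    have "integrable lborel ?g"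
      using lam eps by (intro integrable_mult_right integrable_exp_minus_norm) auto
    moreover have "norm (w x * exp (z * of_real (x \<bullet> e))) \<le> ?g x" if "z \<in> S" for z x
    proof -
      have "\<bar>Re z\<bar> * N \<le> (lam + eps) / 2"
        using that N by (simp add: S_def field_simps)
      then have "\<bar>Re z\<bar> * N * norm x \<le> (lam + eps) / 2 * norm x" by (rule mult_right_mono) simp
      then have "exp (- (lam + eps) * norm x) * exp (\<bar>Re z\<bar> * N * norm x) \<le> exp (- ((lam + eps) / 2) * norm x)"
        unfolding exp_add[symmetric] by (simp add: field_simps)
      then have "C * (exp (- (lam + eps) * norm x) * exp (\<bar>Re z\<bar> * N * norm x)) \<le> ?g x"
        using C_nonneg by (rule mult_left_mono)
      moreover have "norm (w x * exp (z * of_real (x \<bullet> e)))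
          \<le> (C * exp (- (lam + eps) * norm x)) * exp (\<bar>Re z\<bar> * N * norm x)"
        unfolding norm_mult[of "w x"] using bw[of x] nexp[of z x] C_nonneg by (intro mult_mono) auto
      ultimately show ?thesis by simp
    qed
    ultimately show "\<exists>r>0. \<exists>g. integrable lborel g \<and>
        (\<forall>z\<in>ball z0 r \<inter> S. \<forall>x\<in>space lborel. norm (w x * exp (z * of_real (x \<bullet> e))) \<le> g x)"
      using zero_less_one by blast
  qed
  \<comment> \<open>The budget: |z| |e| <= eps/4 costs eps/4 for the exponential and makes |\<mu>|
    <= (eps/4)^2. With k = lam + eps/4 one has k^2 > lam^2 + (eps/4)^2, and the decay left over is
    eps/2.\<close>
  define \<rho> where "\<rho> = eps / (4 * N)"
  have \<rho>: "\<rho> > 0" using eps N by (simp add: \<rho>_def)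
  have Hzero: "H z = 0" if z: "norm z < \<rho>" for z
  proof -
    define \<mu> where "\<mu> = z\<^sup>2 * of_real (e \<bullet> e) - of_real ((0::real ^ 'n) \<bullet> 0)"
    define k where "k = lam + eps / 4"
    have zN: "norm z * N \<le> eps / 4" using z N by (simp add: \<rho>_def field_simps)
    have n\<mu>: "norm \<mu> \<le> (eps / 4)\<^sup>2"
    proof -
      have "norm \<mu> = (norm z * norm e)\<^sup>2"
        by (simp add: \<mu>_def norm_mult norm_power power_mult_distrib power2_norm_eq_inner)
      also have "\<dots> \<le> (eps / 4)\<^sup>2"
        using zN mult_left_mono[OF N(2), of "norm z"] by (intro power_mono) auto
      finally show ?thesis .
    qed
    have k: "k > 0" "lam\<^sup>2 + norm \<mu> < k\<^sup>2"
    proof -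
      show "k > 0" using lam eps by (simp add: k_def)
      have "lam\<^sup>2 + (eps / 4)\<^sup>2 < k\<^sup>2"
        using lam eps by (simp add: k_def power2_sum)
      then show "lam\<^sup>2 + norm \<mu> < k\<^sup>2" using n\<mu> by linarith
    qed
    define M where "M = 1 / (k\<^sup>2 - (lam\<^sup>2 + norm \<mu>))"
    have M: "M > 0" using k by (simp add: M_def)
    define f0 f1 where "f0 = W.sol \<mu>" and "f1 = W.sol1 \<mu>"
    define f2 where "f2 s = (qt s - \<mu>) * f0 s + \<psi> s" for s
    have df: "(f0 has_vector_derivative f1 s) (at s)" "(f1 has_vector_derivative f2 s) (at s)" for s
      unfolding f0_def f1_def f2_def by (rule W.sol_deriv)+
    have cf0: "continuous_on UNIV f0"
      by (rule continuous_on_vector_derivative) (use df(1) has_vector_derivative_at_within in blast)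
    have cf2: "continuous_on UNIV f2"
      unfolding f2_def[abs_def] by (intro continuous_intros qt \<psi> cf0)
    have zf: "f0 s = 0" "f1 s = 0" "f2 s = 0" if "s \<le> a" for s
      using that W.sol_zero \<psi>(3) by (auto simp: f0_def f1_def f2_def)
    define M1 where "M1 = M + k * M + k\<^sup>2 * M + 1"
    have M1: "M1 \<ge> 0" using M k by (simp add: M1_def)
    have bf: "norm (f s) \<le> M1 * exp (k * norm x)" if "f \<in> {f0, f1, f2}" "s \<le> norm x" for f s and x :: "real ^ 'n"
    proof (cases "a \<le> s")
      case True
      have ex: "exp (k * (s - a)) \<le> exp (k * norm x)"
        using that k a R0 by simp
      have ex1: "1 \<le> exp (k * (s - a))" using True k by simp
      have b0: "norm (f0 s) \<le> M * exp (k * (s - a))"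
        using W.sol_bound(1)[OF k True] by (simp add: f0_def M_def)
      have b1: "norm (f1 s) \<le> (k * M) * exp (k * (s - a))"
        using W.sol_bound(2)[OF k True] by (simp add: f1_def M_def)
      have "norm (qt s - \<mu>) \<le> k\<^sup>2"
        using norm_triangle_ineq4[of "qt s" \<mu>] qt(2)[of s] k(2) by linarith
      then have "norm (f2 s) \<le> k\<^sup>2 * (M * exp (k * (s - a))) + 1"
        unfolding f2_def using b0 \<psi>(2)[of s]
        by (intro order_trans[OF norm_triangle_ineq] add_mono) (auto simp: norm_mult intro!: mult_mono)
      also have "\<dots> \<le> (k\<^sup>2 * M + 1) * exp (k * (s - a))"
        using ex1 by (simp add: algebra_simps)
      finally have b2: "norm (f2 s) \<le> (k\<^sup>2 * M + 1) * exp (k * (s - a))" .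
      have "\<exists>m\<le>M1. norm (f s) \<le> m * exp (k * (s - a))"
      proof -
        have "M \<le> M1" "k * M \<le> M1" "k\<^sup>2 * M + 1 \<le> M1" using M k by (simp_all add: M1_def)
        then show ?thesis using that(1) b0 b1 b2 by blast
      qed
      then obtain m where "m \<le> M1" "norm (f s) \<le> m * exp (k * (s - a))" by blast
      moreover have "m * exp (k * (s - a)) \<le> M1 * exp (k * (s - a))"
        using \<open>m \<le> M1\<close> by (rule mult_right_mono) simp
      moreover have "M1 * exp (k * (s - a)) \<le> M1 * exp (k * norm x)"
        using ex M1 by (rule mult_left_mono)
      ultimately show ?thesis by linarith
    next
      case False
      then show ?thesis using zf[of s] that(1) M1 by auto
    qed
    have "(LINT x|lborel. u x * (\<psi> (x \<bullet> d) * 1 + (2 * z * 0 + 0) * of_real (e \<bullet> e) * f0 (x \<bullet> d))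
        * exp (z * of_real (x \<bullet> e) + \<i> * of_real (x \<bullet> 0))) = 0"
    proof (rule product_test_integral[of f0 f1 f2 "\<lambda>_. 1" "\<lambda>_. 0" "\<lambda>_. 0" e 0 qt z \<psi> a "eps / 2" "C * M1"])
      show "f2 s = (qt s - (z\<^sup>2 * of_real (e \<bullet> e) - of_real ((0::real ^ 'n) \<bullet> 0))) * f0 s + \<psi> s" for s
        by (simp add: f2_def \<mu>_def)
      show "V x * f0 (x \<bullet> d) = qt (x \<bullet> d) * f0 (x \<bullet> d)" if "R0 \<le> norm x" for x
        using Vq[OF that] zf(1)[of "x \<bullet> d"] by (cases "x \<bullet> d \<ge> a") auto
      show "(f0 (x \<bullet> d) = 0 \<and> f1 (x \<bullet> d) = 0 \<and> f2 (x \<bullet> d) = 0) \<or> ((1::complex) = 0 \<and> (0::complex) = 0 \<and> (0::complex) = 0)"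
        if "norm x \<le> a" for x
        using zf[of "x \<bullet> d"] that inner_d_le[of x] by simp
      fix x :: "real ^ 'n" and f g
      assume x: "R0 \<le> norm x" and f: "f \<in> {f0, f1, f2}" and g: "g \<in> {\<lambda>_::real. 1::complex, \<lambda>_. 0, \<lambda>_. 0}"
      have g1: "norm (g (x \<bullet> e)) \<le> 1" using g by auto
      have "\<bar>Re z\<bar> * N \<le> norm z * N" using abs_Re_le_cmod[of z] N by (intro mult_right_mono) auto
      also have "\<dots> \<le> eps / 4" by (rule zN)
      finally have "\<bar>Re z\<bar> * N * norm x \<le> eps / 4 * norm x" by (rule mult_right_mono) simp
      then have E: "norm (exp (z * of_real (x \<bullet> e) + \<i> * of_real (x \<bullet> 0))) \<le> exp (eps / 4 * norm x)"
        using nexp[of z x] order_trans by fastforce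
      have "norm (u x * f (x \<bullet> d) * g (x \<bullet> e) * exp (z * of_real (x \<bullet> e) + \<i> * of_real (x \<bullet> 0)))
        \<le> (C * exp (- (lam + eps) * norm x)) * (M1 * exp (k * norm x)) * 1 * exp (eps / 4 * norm x)"
        unfolding norm_mult using u[OF x] bf[OF f inner_d_le] g1 E C_nonneg M1
        by (intro mult_mono) auto
      also have "\<dots> = C * M1 * (exp (- (lam + eps) * norm x) * exp (k * norm x) * exp (eps / 4 * norm x))"
        by simp
      also have "exp (- (lam + eps) * norm x) * exp (k * norm x) * exp (eps / 4 * norm x) = exp (- (eps / 2) * norm x)"
        unfolding exp_add[symmetric] by (simp add: k_def algebra_simps)
      finally show "norm (u x * f (x \<bullet> d) * g (x \<bullet> e) * exp (z * of_real (x \<bullet> e) + \<i> * of_real (x \<bullet> 0)))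
        \<le> C * M1 * exp (- (eps / 2) * norm x)" .
    qed (use df cf2 e a eps in auto)
    then show "H z = 0" by (simp add: H_def w_def)
  qed
  have "H \<i> = 0"
  proof (rule analytic_continuation[OF holH Sopen Sconn, of "ball 0 \<rho> \<inter> S" 0])
    have "\<rho> > 0" "0 \<in> S" "\<i> \<in> S" using \<rho> lam eps N by (auto simp: S_def)
    then show "0 \<in> S" "\<i> \<in> S" "0 islimpt (ball 0 \<rho> \<inter> S)"
      using Sopen by (auto intro!: interior_limit_point simp: interior_open open_Int)
  qed (use Hzero in auto)
  then show ?thesis by (simp add: H_def w_def)
qed

text \<open>The Laplace transform of the solution along \<open>e\<close> over \<open>x \<bullet> e > b1\<close> is bounded in the left half
  plane; the duality identity continues it to an entire function \<open>J\<close> of exponential type, which the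
  oscillatory solutions of the ordinary differential equation bound on the positive axis.\<close>

lemma corner_integral_zero:
  fixes qt \<psi> :: "real \<Rightarrow> complex" and e \<xi> :: "real ^ 'n" and a b b1 R1 \<sigma> :: real
  assumes a: "0 < a" "a < R0" and b: "0 < b" "b < b1" and R: "R0 < R1"
    and corner: "\<And>x. norm x \<le> R1 \<Longrightarrow> x \<bullet> d \<le> a \<or> x \<bullet> e \<le> b"
    and half: "\<And>x. x \<bullet> d > R0 \<Longrightarrow> u x = 0"
    and qt: "continuous_on UNIV qt" "\<And>s. norm (qt s) \<le> lam\<^sup>2"
    and Vq: "\<And>x. norm x \<ge> R0 \<Longrightarrow> x \<bullet> d \<ge> a \<Longrightarrow> V x = qt (x \<bullet> d)"
    and \<psi>: "continuous_on UNIV \<psi>" "\<And>s. norm (\<psi> s) \<le> 1" "\<And>s. s \<le> a \<Longrightarrow> \<psi> s = 0"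
    and orth: "d \<bullet> e = 0" "e \<bullet> e = 1" "d \<bullet> \<xi> = 0" "e \<bullet> \<xi> = 0"
  shows "(LINT x|lborel. u x * \<psi> (x \<bullet> d) * indicator {x. x \<bullet> e > b1} x
      * exp (\<i> * of_real (\<sigma> * (x \<bullet> e)) + \<i> * of_real (x \<bullet> \<xi>))) = 0"
proof -
  interpret W: volterra qt \<psi> a "lam\<^sup>2" 1
    by unfold_locales (use qt \<psi> in auto)
  obtain th th1 th2 :: "real \<Rightarrow> real" and T where
    th: "\<And>t. (th has_real_derivative th1 t) (at t)" "\<And>t. (th1 has_real_derivative th2 t) (at t)"
      "continuous_on UNIV th2"
    and th0: "\<And>t. t \<le> b \<Longrightarrow> th t = 0 \<and> th1 t = 0 \<and> th2 t = 0"
    and thb1: "\<And>t. t \<ge> b1 \<Longrightarrow> th t = 1 \<and> th1 t = 0 \<and> th2 t = 0"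
    and T: "\<And>t. \<bar>th t\<bar> \<le> T" "\<And>t. \<bar>th1 t\<bar> \<le> T" "\<And>t. \<bar>th2 t\<bar> \<le> T"
    using plateau_exists[OF b(2)] by blast
  have T0: "T \<ge> 1" using T(1)[of b1] thb1[of b1] by simp
  define g0 g1 g2 :: "real \<Rightarrow> complex" where "g0 t = of_real (th t)" and "g1 t = of_real (th1 t)" and "g2 t = of_real (th2 t)" for t
  have dg: "(g0 has_vector_derivative g1 t) (at t)" "(g1 has_vector_derivative g2 t) (at t)" for t
    unfolding g0_def[abs_def] g1_def[abs_def] g2_def using th by (auto intro: has_vector_derivative_of_real)
  have cg2: "continuous_on UNIV g2" unfolding g2_def[abs_def] by (intro continuous_intros th)
  have cg: "continuous_on UNIV g0" "continuous_on UNIV g1"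
    by (rule continuous_on_vector_derivative, use dg has_vector_derivative_at_within in blast)+
  have g_zero: "g0 t = 0" "g1 t = 0" "g2 t = 0" if "t \<le> b" for t
    using th0[OF that] by (auto simp: g0_def g1_def g2_def)
  have g_one: "g0 t = 1" "g1 t = 0" "g2 t = 0" if "t \<ge> b1" for t
    using thb1[OF that] by (auto simp: g0_def g1_def g2_def)
  have gT: "norm (g0 t) \<le> T" "norm (g1 t) \<le> T" "norm (g2 t) \<le> T" for t
    using T by (auto simp: g0_def g1_def g2_def)
  define \<kappa> where "\<kappa> = \<xi> \<bullet> \<xi>"
  have \<kappa>: "\<kappa> \<ge> 0" by (simp add: \<kappa>_def)
  define mu where "mu z = z\<^sup>2 * of_real (e \<bullet> e) - of_real (\<xi> \<bullet> \<xi>)" for z :: complex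
  have mu: "mu z = z\<^sup>2 - of_real \<kappa>" for z by (simp add: mu_def \<kappa>_def orth)
  define L where "L = R0 - a"
  have L: "L > 0" using a by (simp add: L_def)
  \<comment> \<open>With growth rate |z| + k0 the denominator in the solution bound is at least 1,
    so the solution has exponential type in z, at most L on s <= R0.\<close>
  define k0 where "k0 = lam\<^sup>2 + \<kappa> + 1"
  have k0: "k0 \<ge> 1" using \<kappa> by (simp add: k0_def)
  have kz: "norm z + k0 > 0" "1 \<le> (norm z + k0)\<^sup>2 - (lam\<^sup>2 + norm (mu z))" for z
  proof -
    show "norm z + k0 > 0" using k0 by (simp add: add_nonneg_pos)
    have "norm (mu z) \<le> (norm z)\<^sup>2 + \<kappa>"
      unfolding mu by (rule order_trans[OF norm_triangle_ineq4]) (use \<kappa> in \<open>simp add: norm_power\<close>)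
    moreover have "k0 \<le> k0\<^sup>2" using self_le_power[of k0 2] k0 by simp
    moreover have "(norm z)\<^sup>2 + k0\<^sup>2 \<le> (norm z + k0)\<^sup>2" using k0 by (simp add: power2_sum)
    ultimately show "1 \<le> (norm z + k0)\<^sup>2 - (lam\<^sup>2 + norm (mu z))" by (simp add: k0_def)
  qed
  define f0 f1 where "f0 z = W.sol (mu z)" and "f1 z = W.sol1 (mu z)" for z
  define f2 where "f2 z s = (qt s - mu z) * f0 z s + \<psi> s" for z s
  have df: "(f0 z has_vector_derivative f1 z s) (at s)" "(f1 z has_vector_derivative f2 z s) (at s)" for z s
    unfolding f0_def f1_def f2_def by (rule W.sol_deriv)+
  have cf: "continuous_on UNIV (f0 z)" "continuous_on UNIV (f1 z)" for z
    by (rule continuous_on_vector_derivative, use df has_vector_derivative_at_within in blast)+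
  have cf2: "continuous_on UNIV (f2 z)" for z
    unfolding f2_def[abs_def] by (intro continuous_intros qt \<psi> cf)
  have zf: "f0 z s = 0" "f1 z s = 0" "f2 z s = 0" if "s \<le> a" for z s
    using that W.sol_zero \<psi>(3) by (auto simp: f0_def f1_def f2_def)
  have bf: "norm (f0 z s) \<le> exp ((norm z + k0) * L)" if "s \<le> R0" for z s
  proof (cases "a \<le> s")
    case True
    let ?k = "norm z + k0"
    have "lam\<^sup>2 + norm (mu z) < ?k\<^sup>2" using kz(2)[of z] by linarith
    from W.sol_bound(1)[OF kz(1) this True]
    have "norm (f0 z s) \<le> 1 / (?k\<^sup>2 - (lam\<^sup>2 + norm (mu z))) * exp (?k * (s - a))"
      by (simp add: f0_def)
    also have "\<dots> \<le> 1 * exp (?k * L)"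
      using kz[of z] that True by (intro mult_mono) (auto simp: L_def divide_le_eq)
    finally show ?thesis by simp
  qed (simp add: zf)
  define dec where "dec x = C * exp (- (lam + eps) * norm x)" for x :: "real ^ 'n"
  have dec0: "dec x \<ge> 0" for x using C_nonneg by (simp add: dec_def)
  have idec: "integrable lborel dec"
    unfolding dec_def[abs_def] using lam eps by (intro integrable_mult_right integrable_exp_minus_norm) auto
  define \<Lambda> where "\<Lambda> = (LINT x|lborel. dec x)"
  have \<Lambda>: "\<Lambda> \<ge> 0" unfolding \<Lambda>_def by (intro integral_nonneg_AE AE_I2) (rule dec0)
  have in_ball: "x \<bullet> d \<le> a \<or> x \<bullet> e \<le> b" if "norm x < R0" for x
    using corner[of x] that R by simp
  have cin: "continuous_on UNIV (\<lambda>x::real^'n. f (x \<bullet> v))" if "continuous_on UNIV f" for f :: "real \<Rightarrow> complex" and v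
    by (rule continuous_on_compose2[OF that]) (auto intro!: continuous_intros)
  \<comment> \<open>A is the commutator with the plateau, P the source term; both vanish in the ball
    because of the corner condition.\<close>
  define A where "A z x = u x * ((2 * z * g1 (x \<bullet> e) + g2 (x \<bullet> e)) * f0 z (x \<bullet> d))" for z x
  define P where "P x = u x * (\<psi> (x \<bullet> d) * g0 (x \<bullet> e))" for x
  have cA: "continuous_on UNIV (A z)" for z
    unfolding A_def[abs_def]
  proof (rule continuous_mult_exterior[OF cu _ _ R])
    show "continuous_on UNIV (\<lambda>x. (2 * z * g1 (x \<bullet> e) + g2 (x \<bullet> e)) * f0 z (x \<bullet> d))"
      by (intro continuous_intros cin cg cg2 cf)
    show "(2 * z * g1 (x \<bullet> e) + g2 (x \<bullet> e)) * f0 z (x \<bullet> d) = 0" if "norm x \<le> R1" for x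
      using corner[OF that] g_zero zf by auto
  qed
  have cP: "continuous_on UNIV P"
    unfolding P_def[abs_def]
  proof (rule continuous_mult_exterior[OF cu _ _ R])
    show "continuous_on UNIV (\<lambda>x. \<psi> (x \<bullet> d) * g0 (x \<bullet> e))"
      by (intro continuous_intros cin cg \<psi>)
    show "\<psi> (x \<bullet> d) * g0 (x \<bullet> e) = 0" if "norm x \<le> R1" for x
      using corner[OF that] g_zero \<psi>(3) by auto
  qed
  have mA: "A z \<in> borel_measurable borel" and mP: "P \<in> borel_measurable borel" for z
    using cA cP by (auto intro: borel_measurable_continuous_onI)
  have P_le: "norm (P x) \<le> T * dec x" for x
  proof (cases "norm x \<ge> R0")
    case True
    have "norm (P x) \<le> dec x * (1 * T)"
      unfolding P_def norm_mult dec_def using u[OF True] \<psi>(2) gT(1) C_nonneg by (intro mult_mono) auto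
    then show ?thesis by (simp add: mult.commute)
  next
    case False
    then have "P x = 0" using in_ball[of x] g_zero \<psi>(3) by (auto simp: P_def)
    then show ?thesis using T0 dec0[of x] by simp
  qed
  have A_le: "norm (A z x) \<le> T * (2 * norm z + 1) * m * dec x"
    if m: "\<And>s. a \<le> s \<Longrightarrow> s \<le> R0 \<Longrightarrow> norm (f0 z s) \<le> m" for z x m
  proof (cases "norm x \<ge> R0 \<and> a \<le> x \<bullet> d \<and> x \<bullet> d \<le> R0")
    case True
    have "norm (2 * z * g1 (x \<bullet> e) + g2 (x \<bullet> e)) \<le> 2 * norm z * T + T"
      by (rule order_trans[OF norm_triangle_ineq]) (use gT in \<open>auto simp: norm_mult intro!: add_mono mult_left_mono\<close>)
    also have "\<dots> = T * (2 * norm z + 1)" by (simp add: algebra_simps)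
    finally have "norm (A z x) \<le> dec x * (T * (2 * norm z + 1) * m)"
      unfolding A_def norm_mult[of "u x"] norm_mult[of "2 * z * g1 (x \<bullet> e) + g2 (x \<bullet> e)"] dec_def
      using u[of x] m[of "x \<bullet> d"] True T0 C_nonneg by (intro mult_mono) auto
    then show ?thesis by (simp add: mult_ac)
  next
    case False
    have m0: "m \<ge> 0" using m[of a] a norm_ge_zero[of "f0 z a"] by linarith
    have "A z x = 0"
    proof (cases "norm x \<ge> R0")
      case True
      with False have "x \<bullet> d < a \<or> x \<bullet> d > R0" by auto
      then show ?thesis using zf(1)[of "x \<bullet> d" z] half[of x] by (auto simp: A_def)
    next
      case False
      then show ?thesis using in_ball[of x] g_zero zf by (auto simp: A_def)
    qed
    then show ?thesis using T0 m0 dec0[of x] by simp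
  qed
  have A_supp: "A z x = 0" if "x \<bullet> e \<le> b \<or> x \<bullet> e \<ge> b1" for z x
    using that g_zero g_one by (auto simp: A_def)
  have P_supp: "P x = 0" if "x \<bullet> e \<le> b" for x
    using that g_zero by (auto simp: P_def)
  \<comment> \<open>Shifting by b1 makes the modulus at most 1 in both cases of interest: beyond b1
    when Re z <= 0, and in the strip b <= y <= b1 when Re z >= 0.\<close>
  define Ex where "Ex z x = exp (z * of_real (x \<bullet> e - b1) + \<i> * of_real (x \<bullet> \<xi>))" for z :: complex and x
  have nEx: "norm (Ex z x) = exp (Re z * (x \<bullet> e - b1))" for z x
    by (simp add: Ex_def)
  have cEx: "continuous_on UNIV (Ex z)" for z
    unfolding Ex_def[abs_def] by (intro continuous_intros)
  have mEx: "Ex z \<in> borel_measurable borel" for z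
    using cEx by (rule borel_measurable_continuous_onI)
  define I :: "real ^ 'n \<Rightarrow> complex" where "I = indicator {x. x \<bullet> e > b1}"
  have mI: "I \<in> borel_measurable borel"
    unfolding I_def by (intro borel_measurable_indicator borel_open open_Collect_less continuous_intros)
  have I01: "norm (I x) \<le> 1" "norm (1 - I x) \<le> 1" for x by (auto simp: I_def indicator_def)
  \<comment> \<open>The duality identity says that D Ex - j integrates to 0. D collects the part
    beyond b1, where the plateau equals 1; j collects the part in the strip, whose integral exists
    for every z.\<close>
  define j where "j z x = - (A z x + P x * (1 - I x)) * Ex z x" for z x
  define D where "D x = P x * I x" for x
  have mj: "j z \<in> borel_measurable borel" for z
    unfolding j_def[abs_def] using mA mP mI mEx by measurable
  have D_le: "norm (D x) \<le> dec x" for x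
  proof (cases "x \<bullet> e > b1 \<and> norm x \<ge> R0")
    case True
    then have "norm (D x) = norm (u x) * norm (\<psi> (x \<bullet> d))"
      by (simp add: D_def P_def I_def g_one norm_mult)
    also have "\<dots> \<le> dec x * 1" unfolding dec_def
      using u[of x] True \<psi>(2) C_nonneg by (intro mult_mono) auto
    finally show ?thesis by simp
  next
    case False
    have "D x = 0"
    proof (cases "norm x \<ge> R0")
      case True
      then show ?thesis using False by (simp add: D_def I_def)
    next
      case False
      then show ?thesis using in_ball[of x] g_zero \<psi>(3) by (auto simp: D_def P_def)
    qed
    then show ?thesis using dec0[of x] by simp
  qed
  have j_supp: "j z x = 0" if "\<not> (b \<le> x \<bullet> e \<and> x \<bullet> e \<le> b1)" for z x
    using that A_supp[of x z] P_supp[of x] by (auto simp: j_def I_def not_le)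
  have j_le: "norm (j z x) \<le> (T * (2 * norm z + 1) * m + T) * dec x * norm (Ex z x)"
    if m: "\<And>s. a \<le> s \<Longrightarrow> s \<le> R0 \<Longrightarrow> norm (f0 z s) \<le> m" for z x m
  proof -
    have "norm (P x * (1 - I x)) \<le> T * dec x * 1"
      unfolding norm_mult using P_le[of x] I01(2)[of x] by (intro mult_mono) (auto intro: order_trans[OF norm_ge_zero])
    then have "norm (A z x + P x * (1 - I x)) \<le> T * (2 * norm z + 1) * m * dec x + T * dec x"
      using A_le[OF m] by (intro order_trans[OF norm_triangle_ineq] add_mono) auto
    also have "\<dots> = (T * (2 * norm z + 1) * m + T) * dec x" by (simp add: algebra_simps)
    finally show ?thesis
      unfolding j_def norm_mult norm_minus_cancel by (rule mult_right_mono) simp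
  qed
  \<comment> \<open>In the type B0, the 1 absorbs the linear factor 2 |z| + 1 <= 2 exp |z|, L comes
    from the solution and b1 - b from the shifted exponential.\<close>
  define A0 B0 where "A0 = T * (2 * exp (k0 * L) + 1)" and "B0 = 1 + L + (b1 - b)"
  have A0: "A0 \<ge> 0" using T0 by (simp add: A0_def)
  have B0: "B0 \<ge> 0" using L b by (simp add: B0_def)
  have j_growth: "norm (j z x) \<le> A0 * exp (B0 * norm z) * dec x" for z x
  proof (cases "b \<le> x \<bullet> e \<and> x \<bullet> e \<le> b1")
    case True
    let ?r = "norm z"
    have m: "norm (f0 z s) \<le> exp ((?r + k0) * L)" if "a \<le> s" "s \<le> R0" for s using bf[OF that(2)] .
    have "Re z * (x \<bullet> e - b1) \<le> \<bar>Re z\<bar> * \<bar>x \<bullet> e - b1\<bar>" by (metis abs_ge_self abs_mult)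
    also have "\<dots> \<le> ?r * (b1 - b)" using True abs_Re_le_cmod[of z] by (intro mult_mono) auto
    finally have ex: "norm (Ex z x) \<le> exp (?r * (b1 - b))" by (simp add: nEx)
    have r1: "2 * ?r + 1 \<le> 2 * exp ?r" using exp_ge_add_one_self[of ?r] by linarith
    have "T * (2 * ?r + 1) * exp ((?r + k0) * L) + T \<le> T * (2 * exp ?r) * exp ((?r + k0) * L) + T * exp (?r + ?r * L)"
      using r1 T0 L by (intro add_mono mult_right_mono mult_left_mono) auto
    also have "\<dots> = A0 * exp (?r + ?r * L)"
      by (simp add: A0_def algebra_simps exp_add)
    finally have "(T * (2 * ?r + 1) * exp ((?r + k0) * L) + T) * dec x * norm (Ex z x)
        \<le> A0 * exp (?r + ?r * L) * dec x * exp (?r * (b1 - b))"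
      using ex dec0[of x] A0 by (intro mult_mono mult_right_mono mult_nonneg_nonneg) auto
    also have "\<dots> = A0 * exp (B0 * ?r) * dec x"
      by (simp add: B0_def exp_add[symmetric] algebra_simps)
    finally show ?thesis using j_le[OF m, of x] by linarith
  next
    case False
    then show ?thesis using j_supp[OF False, of z] A0 dec0[of x] by simp
  qed
  define J where "J z = (LINT x|lborel. j z x)" for z
  have ij: "integrable lborel (j z)" for z
    by (rule Bochner_Integration.integrable_bound[OF integrable_mult_right[OF idec, of "A0 * exp (B0 * norm z)"]])
      (use mj j_growth A0 dec0 in \<open>auto intro!: AE_I2\<close>)
  have J_le: "norm (J z) \<le> m * \<Lambda>" if "\<And>x. norm (j z x) \<le> m * dec x" for z m
  proof -
    have "norm (J z) \<le> (LINT x|lborel. norm (j z x))" unfolding J_def by (rule integral_norm_bound)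
    also have "\<dots> \<le> (LINT x|lborel. m * dec x)"
      using ij idec that by (intro integral_mono) auto
    finally show ?thesis by (simp add: \<Lambda>_def)
  qed
  have holJ: "J holomorphic_on UNIV"
    unfolding J_def[abs_def]
  proof (rule holomorphic_on_dominated_integral)
    show "j z \<in> borel_measurable lborel" for z using mj by simp
    show "(\<lambda>z. j z x) holomorphic_on UNIV" for x
    proof -
      have "((\<lambda>\<mu>. W.sol \<mu> (x \<bullet> d)) \<circ> mu) holomorphic_on UNIV"
        by (rule holomorphic_on_compose_gen[OF _ W.sol_holomorphic])
          (auto simp: mu_def[abs_def] intro!: holomorphic_intros)
      then have "(\<lambda>z. f0 z (x \<bullet> d)) holomorphic_on UNIV" by (simp add: f0_def comp_def)
      then show ?thesis
        unfolding j_def A_def Ex_def by (intro holomorphic_intros)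
    qed
    fix z0 :: complex
    let ?g = "\<lambda>x. A0 * exp (B0 * (norm z0 + 1)) * dec x"
    have "norm (j w x) \<le> ?g x" if "w \<in> ball z0 1" for w x
    proof -
      have "norm w \<le> norm z0 + 1"
        using that norm_triangle_ineq2[of w z0] by (simp add: dist_norm norm_minus_commute)
      then have "A0 * exp (B0 * norm w) * dec x \<le> ?g x"
        using A0 B0 dec0[of x] by (intro mult_right_mono mult_left_mono) (auto intro: mult_left_mono)
      then show ?thesis using j_growth[of w x] by linarith
    qed
    moreover have "integrable lborel ?g" using idec by (rule integrable_mult_right)
    ultimately show "\<exists>r>0. \<exists>g. integrable lborel g \<and> (\<forall>w\<in>ball z0 r \<inter> UNIV. \<forall>x\<in>space lborel. norm (j w x) \<le> g x)"
      by (intro exI[of _ 1] conjI exI[of _ ?g]) auto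
  qed auto
  have DEx_le: "norm (D x * Ex z x) \<le> dec x" if "Re z \<le> 0" for z x
  proof (cases "x \<bullet> e > b1")
    case True
    have "norm (Ex z x) \<le> 1" using that True by (simp add: nEx mult_nonpos_nonneg)
    then have "norm (D x * Ex z x) \<le> dec x * 1"
      unfolding norm_mult using D_le[of x] dec0[of x] by (intro mult_mono) auto
    then show ?thesis by simp
  qed (simp add: D_def I_def dec0)
  have mDEx: "(\<lambda>x. D x * Ex z x) \<in> borel_measurable borel" for z
    unfolding D_def[abs_def] using mP mI mEx by measurable
  have iDEx: "integrable lborel (\<lambda>x. D x * Ex z x)" if "Re z \<le> 0" for z
    by (rule Bochner_Integration.integrable_bound[OF idec])
      (use mDEx DEx_le[OF that] dec0 in \<open>auto intro!: AE_I2\<close>)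
  \<comment> \<open>Since u vanishes for s > R0, the solution matters only on the compact interval
    from a to R0, so its growth is harmless; Re z <= 0 keeps the exponential bounded for y >= b >
    0.\<close>
  have J_eq: "J z = (LINT x|lborel. D x * Ex z x)" if z: "Re z \<le> 0" for z
  proof -
    have bd: "\<exists>m\<ge>0. \<forall>s\<in>{a..R0}. norm (h s) \<le> m" if "continuous_on UNIV h" for h :: "real \<Rightarrow> complex"
    proof -
      have "bounded (h ` {a..R0})"
        by (intro compact_imp_bounded compact_continuous_image continuous_on_subset[OF that]) auto
      then show ?thesis unfolding bounded_pos by (auto intro: less_imp_le)
    qed
    obtain m0 m1 m2 where m: "m0 \<ge> 0" "\<forall>s\<in>{a..R0}. norm (f0 z s) \<le> m0"
      "m1 \<ge> 0" "\<forall>s\<in>{a..R0}. norm (f1 z s) \<le> m1" "m2 \<ge> 0" "\<forall>s\<in>{a..R0}. norm (f2 z s) \<le> m2"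
      using bd[OF cf(1)[of z]] bd[OF cf(2)[of z]] bd[OF cf2[of z]] by metis
    define M where "M = m0 + m1 + m2"
    have M: "M \<ge> 0" using m by (simp add: M_def)
    have fM: "norm (f s) \<le> M" if "f \<in> {f0 z, f1 z, f2 z}" "a \<le> s" "s \<le> R0" for f s
    proof -
      have "norm (f0 z s) \<le> m0" "norm (f1 z s) \<le> m1" "norm (f2 z s) \<le> m2" using m that by auto
      then show ?thesis using that(1) m(1,3,5) by (auto simp: M_def)
    qed
    let ?E = "\<lambda>x. exp (z * of_real (x \<bullet> e) + \<i> * of_real (x \<bullet> \<xi>))"
    have "(LINT x|lborel. u x * (\<psi> (x \<bullet> d) * g0 (x \<bullet> e) +
        (2 * z * g1 (x \<bullet> e) + g2 (x \<bullet> e)) * of_real (e \<bullet> e) * f0 z (x \<bullet> d)) * ?E x) = 0"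
    proof (rule product_test_integral[of "f0 z" "f1 z" "f2 z" g0 g1 g2 e \<xi> qt z \<psi> R1 "lam + eps" "C * M * T"])
      show "f2 z s = (qt s - (z\<^sup>2 * of_real (e \<bullet> e) - of_real (\<xi> \<bullet> \<xi>))) * f0 z s + \<psi> s" for s
        by (simp add: f2_def mu_def)
      show "V x * f0 z (x \<bullet> d) = qt (x \<bullet> d) * f0 z (x \<bullet> d)" if "R0 \<le> norm x" for x
        using Vq[OF that] zf(1)[of "x \<bullet> d"] by (cases "x \<bullet> d \<ge> a") auto
      show "(f0 z (x \<bullet> d) = 0 \<and> f1 z (x \<bullet> d) = 0 \<and> f2 z (x \<bullet> d) = 0) \<or>
          (g0 (x \<bullet> e) = 0 \<and> g1 (x \<bullet> e) = 0 \<and> g2 (x \<bullet> e) = 0)" if "norm x \<le> R1" for x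
        using corner[OF that] zf g_zero by blast
      fix x :: "real ^ 'n" and f g
      assume x: "R0 \<le> norm x" and f: "f \<in> {f0 z, f1 z, f2 z}" and g: "g \<in> {g0, g1, g2}"
      show "norm (u x * f (x \<bullet> d) * g (x \<bullet> e) * ?E x) \<le> C * M * T * exp (- (lam + eps) * norm x)"
      proof (cases "a \<le> x \<bullet> d \<and> x \<bullet> d \<le> R0 \<and> b \<le> x \<bullet> e")
        case True
        have "norm (?E x) \<le> 1" using z True b by (simp add: mult_nonpos_nonneg)
        moreover have "norm (g (x \<bullet> e)) \<le> T" using g gT by auto
        ultimately have "norm (u x * f (x \<bullet> d) * g (x \<bullet> e) * ?E x) \<le> dec x * M * T * 1"
          unfolding norm_mult dec_def using u[OF x] fM[OF f] True C_nonneg M T0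
          by (intro mult_mono) auto
        then show ?thesis by (simp add: dec_def mult_ac)
      next
        case False
        then have eq0: "u x * f (x \<bullet> d) * g (x \<bullet> e) = 0"
          using half[of x] f g zf[of "x \<bullet> d" z] g_zero[of "x \<bullet> e"] by auto
        show ?thesis unfolding eq0 using C_nonneg M T0 by simp
      qed
    qed (use df cf2 dg cg2 orth R lam eps in auto)
    then have "(LINT x|lborel. exp (- z * of_real b1) * (u x * (\<psi> (x \<bullet> d) * g0 (x \<bullet> e) +
        (2 * z * g1 (x \<bullet> e) + g2 (x \<bullet> e)) * of_real (e \<bullet> e) * f0 z (x \<bullet> d)) * ?E x)) = 0"
      by (subst integral_mult_right_zero) simp
    moreover have "exp (- z * of_real b1) * (u x * (\<psi> (x \<bullet> d) * g0 (x \<bullet> e) +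
        (2 * z * g1 (x \<bullet> e) + g2 (x \<bullet> e)) * of_real (e \<bullet> e) * f0 z (x \<bullet> d)) * ?E x)
        = D x * Ex z x - j z x" for x
    proof -
      have "Ex z x = exp (- z * of_real b1) * ?E x"
        by (simp add: Ex_def exp_add[symmetric] algebra_simps)
      then show ?thesis
        by (simp add: orth D_def j_def A_def P_def algebra_simps)
    qed
    ultimately have "(LINT x|lborel. D x * Ex z x - j z x) = 0" by (simp only:)
    then show ?thesis using iDEx[OF z] ij by (simp add: J_def)
  qed
  have J_left: "norm (J z) \<le> \<Lambda>" if "Re z \<le> 0" for z
  proof -
    have "norm (J z) \<le> (LINT x|lborel. norm (D x * Ex z x))"
      unfolding J_eq[OF that] by (rule integral_norm_bound)
    also have "\<dots> \<le> \<Lambda>"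
      unfolding \<Lambda>_def using iDEx[OF that] idec DEx_le[OF that] by (intro integral_mono) auto
    finally show ?thesis .
  qed
  \<comment> \<open>The energy estimate over a length L gives |f0| <= Y / r at z = r >= 1, and (2 r
    + 1) / r <= 3 then bounds the commutator.\<close>
  define Y where "Y = sqrt (L * exp ((lam\<^sup>2 + \<kappa> + 1) * L))"
  have Y: "Y \<ge> 0" by (simp add: Y_def L less_imp_le)
  \<comment> \<open>The three summands serve r >= 1, 0 <= r < 1 and the closed left half
    plane.\<close>
  define M where "M = (3 * T * Y + T) * \<Lambda> + A0 * exp B0 * \<Lambda> + \<Lambda>"
  have Mparts: "(3 * T * Y + T) * \<Lambda> \<ge> 0" "A0 * exp B0 * \<Lambda> \<ge> 0"
    using T0 Y \<Lambda> A0 by auto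
  have J_right: "norm (J (of_real r)) \<le> M" if r: "r \<ge> 0" for r :: real
  proof (cases "r \<ge> 1")
    case True
    let ?z = "of_real r :: complex"
    have m: "norm (f0 ?z s) \<le> Y / r" if "a \<le> s" "s \<le> R0" for s
    proof -
      have "(r * norm (f0 ?z s))\<^sup>2 \<le> 1\<^sup>2 * (s - a) * exp ((lam\<^sup>2 + \<kappa> + 1) * (s - a))"
        using W.sol_energy[OF True \<kappa> that(1)] by (simp add: f0_def mu)
      also have "\<dots> \<le> 1\<^sup>2 * L * exp ((lam\<^sup>2 + \<kappa> + 1) * L)"
        using that \<kappa> L by (intro mult_mono) (auto simp: L_def intro!: mult_left_mono add_nonneg_nonneg)
      finally have "r * norm (f0 ?z s) \<le> Y" unfolding Y_def by (intro real_le_rsqrt) simp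
      then show ?thesis using True by (simp add: field_simps)
    qed
    have "norm (j ?z x) \<le> (3 * T * Y + T) * dec x" for x
    proof (cases "b \<le> x \<bullet> e \<and> x \<bullet> e \<le> b1")
      case inside: True
      have "norm (Ex ?z x) \<le> 1" using inside r by (simp add: nEx mult_nonneg_nonpos)
      moreover have "T * (2 * norm ?z + 1) * (Y / r) + T \<le> 3 * T * Y + T"
      proof -
        have "(2 * r + 1) / r \<le> 3" using True by (simp add: field_simps)
        then have "(2 * r + 1) / r * (T * Y) \<le> 3 * (T * Y)" using T0 Y by (intro mult_right_mono) auto
        then show ?thesis using r by (simp add: field_simps)
      qed
      ultimately have "(T * (2 * norm ?z + 1) * (Y / r) + T) * dec x * norm (Ex ?z x) \<le> (3 * T * Y + T) * dec x * 1"
        using dec0[of x] T0 Y by (intro mult_mono mult_right_mono) auto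
      then show ?thesis using j_le[OF m, of x] by simp
    next
      case False
      then show ?thesis using j_supp[OF False, of ?z] T0 Y dec0[of x] by simp
    qed
    from J_le[OF this] show ?thesis using Mparts \<Lambda> by (simp add: M_def)
  next
    case False
    have "norm (j (of_real r) x) \<le> A0 * exp B0 * dec x" for x
    proof -
      have "B0 * r \<le> B0 * 1" using False B0 by (intro mult_left_mono) auto
      then have "A0 * exp (B0 * norm (of_real r :: complex)) * dec x \<le> A0 * exp B0 * dec x"
        using r A0 dec0[of x] by (intro mult_right_mono mult_left_mono) auto
      then show ?thesis using j_growth[of "of_real r" x] by linarith
    qed
    from J_le[OF this] show ?thesis using Mparts \<Lambda> by (simp add: M_def)
  qed
  have const: "J z = J 0" for z
  proof (rule phragmen_lindelof_liouville[OF holJ _ J_right])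
    show "norm (J z) \<le> (A0 * \<Lambda>) * exp (B0 * norm z)" for z
      using J_le[OF j_growth, of z] by (simp add: mult_ac)
    show "norm (J z) \<le> M" if "Re z \<le> 0" for z
      using J_left[OF that] Mparts by (simp add: M_def)
  qed
  \<comment> \<open>The constant is found along z = -n: D lives in y > b1, where the shifted
    exponential tends to 0.\<close>
  have "(\<lambda>n. LINT x|lborel. D x * Ex (- of_nat n) x) \<longlonglongrightarrow> (LINT x|(lborel :: (real ^ 'n) measure). (0::complex))"
  proof (rule integral_dominated_convergence[where w=dec])
    show "integrable lborel dec" by (rule idec)
    show "(\<lambda>x. D x * Ex (- of_nat n) x) \<in> borel_measurable lborel" for n using mDEx by simp
    show "AE x in lborel. norm (D x * Ex (- of_nat n) x) \<le> dec x" for n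
      by (intro AE_I2 DEx_le) simp
    show "AE x in lborel. (\<lambda>n. D x * Ex (- of_nat n) x) \<longlonglongrightarrow> 0"
    proof (intro AE_I2)
      fix x
      show "(\<lambda>n. D x * Ex (- of_nat n) x) \<longlonglongrightarrow> 0"
      proof (cases "x \<bullet> e > b1")
        case True
        have "(\<lambda>n. exp (- (x \<bullet> e - b1)) ^ n) \<longlonglongrightarrow> 0"
          using True by (intro LIMSEQ_power_zero) simp
        then have "(\<lambda>n. norm (Ex (- of_nat n) x)) \<longlonglongrightarrow> 0"
          by (simp add: nEx exp_of_nat_mult[symmetric] algebra_simps)
        then have "(\<lambda>n. Ex (- of_nat n) x) \<longlonglongrightarrow> 0" by (simp add: tendsto_norm_zero_iff)
        then show ?thesis by (rule tendsto_mult_right_zero)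
      qed (simp add: D_def I_def)
    qed
  qed simp
  then have "(\<lambda>n. J (- of_nat n)) \<longlonglongrightarrow> 0" by (simp add: J_eq)
  moreover have "(\<lambda>n. J (- of_nat n)) = (\<lambda>n. J 0)" using const by blast
  ultimately have J0: "J 0 = 0" by (simp add: LIMSEQ_const_iff)
  have "J (\<i> * of_real \<sigma>) = 0" using const[of "\<i> * of_real \<sigma>"] unfolding J0 .
  then have "(LINT x|lborel. D x * Ex (\<i> * of_real \<sigma>) x) = 0" by (simp add: J_eq)
  then have "(LINT x|lborel. exp (\<i> * of_real (\<sigma> * b1)) * (D x * Ex (\<i> * of_real \<sigma>) x)) = 0"
    by (subst integral_mult_right_zero) simp
  moreover have "exp (\<i> * of_real (\<sigma> * b1)) * (D x * Ex (\<i> * of_real \<sigma>) x) =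
      u x * \<psi> (x \<bullet> d) * indicator {x. x \<bullet> e > b1} x * exp (\<i> * of_real (\<sigma> * (x \<bullet> e)) + \<i> * of_real (x \<bullet> \<xi>))" for x
  proof (cases "x \<bullet> e > b1")
    case True
    have "exp (\<i> * of_real (\<sigma> * b1)) * Ex (\<i> * of_real \<sigma>) x = exp (\<i> * of_real (\<sigma> * (x \<bullet> e)) + \<i> * of_real (x \<bullet> \<xi>))"
      by (simp add: Ex_def exp_add[symmetric] algebra_simps)
    then show ?thesis
      using True by (simp add: D_def P_def I_def g_one mult_ac)
  qed (simp add: D_def I_def)
  ultimately show ?thesis by (simp only:)
qed

end

text \<open>An admissible source that is nonzero for all s > a; the oscillating factor contributes
  the frequency along d, so that the integrals become full Fourier coefficients of u times the
  ramp.\<close>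

definition ramp_wave :: "real \<Rightarrow> real \<Rightarrow> real \<Rightarrow> complex" where
  "ramp_wave a \<tau> s = of_real (min 1 (max 0 (s - a))) * exp (\<i> * of_real (\<tau> * s))"

lemma ramp_wave:
  "continuous_on UNIV (ramp_wave a \<tau>)" "norm (ramp_wave a \<tau> s) \<le> 1" "s \<le> a \<Longrightarrow> ramp_wave a \<tau> s = 0"
proof -
  show "continuous_on UNIV (ramp_wave a \<tau>)"
    unfolding ramp_wave_def[abs_def] by (intro continuous_intros)
  have "norm (exp (\<i> * of_real (\<tau> * s))) = 1" by simp
  then show "norm (ramp_wave a \<tau> s) \<le> 1"
    unfolding ramp_wave_def norm_mult by simp
qed (simp add: ramp_wave_def)

section \<open>From vanishing Fourier integrals to pointwise vanishing\<close>

context decaying_solution begin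

lemma halfspace_zero:
  assumes Vq: "\<And>x. norm x \<ge> R0 \<Longrightarrow> V x = q (x \<bullet> d)" and x0: "x0 \<bullet> d > R0"
  shows "u x0 = 0"
proof -
  define a where "a = (R0 + x0 \<bullet> d) / 2"
  have a: "R0 < a" "a < x0 \<bullet> d" using x0 by (auto simp: a_def)
  \<comment> \<open>Sampling V on the axis, frozen below a > R0 to stay outside the ball. This also
    works in dimension one, where no direction orthogonal to d is available.\<close>
  define qt where "qt s = V (max s a *\<^sub>R d)" for s
  have nd: "norm (max s a *\<^sub>R d) \<ge> R0" for s using d a R0 by simp
  have cqt: "continuous_on UNIV qt"
    unfolding qt_def[abs_def]
    by (rule continuous_on_compose2[OF cV]) (use nd in \<open>auto intro!: continuous_intros\<close>)
  have Vqt: "V x = qt (x \<bullet> d)" if "norm x \<ge> R0" "x \<bullet> d \<ge> a" for x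
    using Vq[OF that(1)] Vq[OF nd[of "x \<bullet> d"]] that(2) inner_d_self by (simp add: qt_def max_def)
  define h where "h x = u x * of_real (min 1 (max 0 (x \<bullet> d - a)))" for x
  have ch: "continuous_on UNIV h"
    unfolding h_def[abs_def]
  proof (rule continuous_mult_exterior[OF cu _ _ a(1)])
    show "of_real (min 1 (max 0 (x \<bullet> d - a))) = (0::complex)" if "norm x \<le> a" for x :: "real ^ 'n"
      using that inner_d_le[of x] by simp
  qed (intro continuous_intros)
  have hC: "norm (h x) \<le> C * exp (- (lam + eps) * norm x)" for x
  proof (cases "norm x \<ge> R0")
    case True
    have "norm (h x) \<le> (C * exp (- (lam + eps) * norm x)) * 1"
      unfolding h_def norm_mult using u[OF True] C_nonneg by (intro mult_mono) auto
    then show ?thesis by simp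
  next
    case False
    then have "h x = 0" using a inner_d_le[of x] by (simp add: h_def)
    then show ?thesis using C_nonneg by simp
  qed
  have "h x0 = 0"
  proof (rule fourier_zero_imp_zero[of h C x0])
    show "integrable lborel h"
      by (rule integrable_exp_decay[OF _ _ hC]) (use ch lam eps in \<open>auto intro: borel_measurable_continuous_onI\<close>)
    have "exp (- (lam + eps) * norm x) \<le> 1" for x :: "real ^ 'n" using lam eps by (simp add: mult_nonpos_nonneg)
    then show "norm (h x) \<le> C" for x
      using hC[of x] C_nonneg by (meson mult_left_le order_trans)
    show "isCont h x0" using ch by (simp add: continuous_on_eq_continuous_at)
    fix \<omega> :: "real ^ 'n"
    define \<tau> e where "\<tau> = \<omega> \<bullet> d" and "e = \<omega> - \<tau> *\<^sub>R d"
    have de: "d \<bullet> e = 0" by (simp add: e_def \<tau>_def inner_diff_right inner_d_self inner_commute)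
    have "h x * exp (\<i> * of_real (\<omega> \<bullet> x)) = u x * ramp_wave a \<tau> (x \<bullet> d) * exp (\<i> * of_real (x \<bullet> e))" for x
    proof -
      have "\<omega> \<bullet> x = \<tau> * (x \<bullet> d) + x \<bullet> e"
        by (simp add: e_def inner_diff_right inner_commute)
      then show ?thesis by (simp add: h_def ramp_wave_def exp_add distrib_left)
    qed
    then show "(LINT x|lborel. h x * exp (\<i> * of_real (\<omega> \<bullet> x))) = 0"
      using halfspace_integral_zero[OF a(1) cqt _ Vqt ramp_wave(1) ramp_wave(2) ramp_wave(3) de] V[OF nd]
      by (simp add: qt_def)
  qed
  then show ?thesis using a(2) by (auto simp: h_def min_def split: if_splits)
qed

lemma corner_zero:
  assumes Vq: "\<And>x. norm x \<ge> R0 \<Longrightarrow> V x = q (x \<bullet> d)"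
    and x0: "0 < x0 \<bullet> d" "x0 \<bullet> d \<le> R0" "norm x0 > R0"
  shows "u x0 = 0"
proof -
  \<comment> \<open>The direction e is adapted to x0: it points along the part of x0 orthogonal to
    d, which is nonzero because 0 < s0 <= R0 < |x0|.\<close>
  define s0 y t0 where "s0 = x0 \<bullet> d" and "y = x0 - s0 *\<^sub>R d" and "t0 = norm y"
  have dy: "d \<bullet> y = 0" by (simp add: y_def s0_def inner_diff_right inner_d_self inner_commute)
  have pyth: "(norm x0)\<^sup>2 = s0\<^sup>2 + t0\<^sup>2"
  proof -
    have "x0 = s0 *\<^sub>R d + y" by (simp add: y_def)
    then have "x0 \<bullet> x0 = (s0 *\<^sub>R d + y) \<bullet> (s0 *\<^sub>R d + y)" by simp
    also have "\<dots> = s0\<^sup>2 + y \<bullet> y"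
      using dy by (simp add: inner_add_left inner_add_right inner_d_self inner_commute power2_eq_square)
    finally show ?thesis by (simp add: t0_def power2_norm_eq_inner)
  qed
  have t0: "t0 > 0"
  proof -
    have "s0\<^sup>2 \<le> R0\<^sup>2" "R0\<^sup>2 < (norm x0)\<^sup>2"
      using x0 R0 by (auto simp: s0_def intro!: power_mono power_strict_mono)
    then have "t0\<^sup>2 > 0" using pyth by linarith
    then show ?thesis by (simp add: t0_def)
  qed
  define e where "e = (1 / t0) *\<^sub>R y"
  have e: "d \<bullet> e = 0" "e \<bullet> e = 1"
    using t0 dy by (auto simp: e_def t0_def dot_square_norm power2_eq_square)
  have x0e: "x0 \<bullet> e = t0"
  proof -
    have "x0 \<bullet> e = (s0 *\<^sub>R d + y) \<bullet> e" by (simp add: y_def)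
    also have "\<dots> = y \<bullet> e" by (simp add: inner_add_left e)
    also have "\<dots> = t0" using t0 by (simp add: e_def dot_square_norm t0_def[symmetric] power2_eq_square)
    finally show ?thesis .
  qed
  have bessel: "(x \<bullet> d)\<^sup>2 + (x \<bullet> e)\<^sup>2 \<le> (norm x)\<^sup>2" for x
  proof -
    have "0 \<le> (x - (x \<bullet> d) *\<^sub>R d - (x \<bullet> e) *\<^sub>R e) \<bullet> (x - (x \<bullet> d) *\<^sub>R d - (x \<bullet> e) *\<^sub>R e)" by simp
    also have "\<dots> = x \<bullet> x - (x \<bullet> d)\<^sup>2 - (x \<bullet> e)\<^sup>2"
      using e inner_d_self by (simp add: inner_diff_left inner_diff_right inner_commute power2_eq_square algebra_simps)
    finally show ?thesis by (simp add: power2_norm_eq_inner)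
  qed
  have nq: "norm (s *\<^sub>R d + R0 *\<^sub>R e) \<ge> R0" for s
  proof -
    have "R0\<^sup>2 \<le> (norm (s *\<^sub>R d + R0 *\<^sub>R e))\<^sup>2"
      unfolding power2_norm_eq_inner using e inner_d_self
      by (simp add: inner_add_left inner_add_right inner_commute power2_eq_square)
    then show ?thesis using R0 power2_le_imp_le norm_ge_zero by blast
  qed
  \<comment> \<open>Here s ranges below R0, so V is sampled on a line parallel to d that stays
    outside the open ball.\<close>
  define qt where "qt s = V (s *\<^sub>R d + R0 *\<^sub>R e)" for s
  have cqt: "continuous_on UNIV qt"
    unfolding qt_def[abs_def]
    by (rule continuous_on_compose2[OF cV]) (use nq in \<open>auto intro!: continuous_intros\<close>)
  have Vqt: "V x = qt (x \<bullet> d)" if "norm x \<ge> R0" for x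
  proof -
    have "(s *\<^sub>R d + R0 *\<^sub>R e) \<bullet> d = s" for s
      using inner_d_self e(1) by (simp add: inner_add_left inner_commute[of e d])
    then show ?thesis using Vq[OF that] Vq[OF nq[of "x \<bullet> d"]] by (simp add: qt_def)
  qed
  \<comment> \<open>Scaling x0 by this factor gives the vertex of the corner, at distance R1 = (|x0|
    + R0) / 2, strictly between R0 and |x0|. By Bessel's inequality the whole corner lies beyond
    R1.\<close>
  define \<kappa> where "\<kappa> = (1 + R0 / norm x0) / 2"
  have nx0: "norm x0 > 0" using x0 R0 by linarith
  have \<kappa>: "0 < \<kappa>" "\<kappa> < 1" using x0 R0 nx0 by (auto simp: \<kappa>_def field_simps)
  define a b R1 where "a = \<kappa> * s0" and "b = \<kappa> * t0" and "R1 = \<kappa> * norm x0"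
  have R1: "R0 < R1" using x0 nx0 by (simp add: R1_def \<kappa>_def field_simps)
  have s0: "0 < s0" "s0 \<le> R0" using x0 by (auto simp: s0_def)
  have a: "0 < a" "a < s0" "a < R0"
  proof -
    show "0 < a" using \<kappa> s0 by (simp add: a_def)
    have "\<kappa> * s0 < 1 * s0" using \<kappa>(2) s0(1) by (rule mult_strict_right_mono)
    then have "a < s0" by (simp add: a_def)
    then show "a < s0" "a < R0" using s0 by linarith+
  qed
  have b: "0 < b" "b < t0" using \<kappa> t0 by (auto simp: b_def)
  have corner: "x \<bullet> d \<le> a \<or> x \<bullet> e \<le> b" if "norm x \<le> R1" for x
  proof (rule ccontr)
    assume "\<not> ?thesis"
    then have "a\<^sup>2 < (x \<bullet> d)\<^sup>2" "b\<^sup>2 < (x \<bullet> e)\<^sup>2" using a b by (auto intro!: power_strict_mono)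
    then have "a\<^sup>2 + b\<^sup>2 < (norm x)\<^sup>2" using bessel[of x] by linarith
    also have "\<dots> \<le> R1\<^sup>2" using that by (intro power_mono) auto
    also have "\<dots> = a\<^sup>2 + b\<^sup>2" by (simp add: R1_def a_def b_def power_mult_distrib pyth distrib_left)
    finally show False by simp
  qed
  define b1 where "b1 = (b + t0) / 2"
  have b1: "b < b1" "b1 < t0" using b by (auto simp: b1_def)
  have half: "u x = 0" if "x \<bullet> d > R0" for x using halfspace_zero[OF Vq that] .
  define r where "r x = (of_real (min 1 (max 0 (x \<bullet> d - a))) :: complex)" for x
  have r1: "norm (r x) \<le> 1" for x by (simp add: r_def)
  \<comment> \<open>The jump at y = b1 is harmless: x0 has y = t0 > b1, so h is continuous at
    x0.\<close>
  define h where "h x = u x * r x * indicator {x. x \<bullet> e > b1} x" for x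
  have in_ball: "h x = 0" if "norm x < R0" for x
    using corner[of x] that R1 b1 by (auto simp: h_def r_def indicator_def)
  have hC: "norm (h x) \<le> C * exp (- (lam + eps) * norm x)" for x
  proof (cases "norm x \<ge> R0")
    case True
    have "norm (h x) \<le> (C * exp (- (lam + eps) * norm x)) * 1 * 1"
      unfolding h_def norm_mult using u[OF True] C_nonneg r1[of x]
      by (intro mult_mono) (auto simp: indicator_def)
    then show ?thesis by simp
  next
    case False
    then show ?thesis using in_ball[of x] C_nonneg by simp
  qed
  have mh: "h \<in> borel_measurable borel"
  proof -
    have cl: "{x::real ^ 'n. norm x \<ge> R0} \<in> sets borel"
      by (intro borel_closed closed_Collect_le continuous_intros)
    have cr: "continuous_on {x. norm x \<ge> R0} (\<lambda>x. u x * r x)"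
      unfolding r_def by (intro continuous_intros cu)
    have "(\<lambda>x. indicator {x. norm x \<ge> R0} x *\<^sub>R (u x * r x)) \<in> borel_measurable borel"
      by (rule borel_measurable_continuous_on_indicator[OF cl cr])
    moreover have "(indicator {x. x \<bullet> e > b1} :: real ^ 'n \<Rightarrow> complex) \<in> borel_measurable borel"
      by (intro borel_measurable_indicator borel_open open_Collect_less continuous_intros)
    ultimately have "(\<lambda>x. (indicator {x. norm x \<ge> R0} x *\<^sub>R (u x * r x)) * indicator {x. x \<bullet> e > b1} x) \<in> borel_measurable borel"
      by (rule borel_measurable_times)
    also have "(\<lambda>x. (indicator {x. norm x \<ge> R0} x *\<^sub>R (u x * r x)) * indicator {x. x \<bullet> e > b1} x) = h"
    proof
      fix x
      show "(indicator {x. norm x \<ge> R0} x *\<^sub>R (u x * r x)) * indicator {x. x \<bullet> e > b1} x = h x"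
        using in_ball[of x] by (cases "norm x \<ge> R0") (auto simp: h_def)
    qed
    finally show ?thesis .
  qed
  have "h x0 = 0"
  proof (rule fourier_zero_imp_zero[of h C x0])
    show "integrable lborel h"
      by (rule integrable_exp_decay[OF mh _ hC]) (use lam eps in auto)
    have "exp (- (lam + eps) * norm x) \<le> 1" for x :: "real ^ 'n" using lam eps by (simp add: mult_nonpos_nonneg)
    then show "norm (h x) \<le> C" for x
      using hC[of x] C_nonneg by (meson mult_left_le order_trans)
    show "isCont h x0"
    proof -
      let ?W = "{x. x \<bullet> e > b1} \<inter> {x. norm x > R0}"
      have W: "open ?W" by (intro open_Int open_Collect_less continuous_intros)
      have "continuous_on ?W (\<lambda>x. u x * r x)"
        unfolding r_def by (intro continuous_intros continuous_on_subset[OF cu]) auto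
      then have "continuous_on ?W h"
        by (rule continuous_on_eq) (auto simp: h_def)
      then show ?thesis
        using W x0 x0e b1 by (simp add: continuous_on_eq_continuous_at)
    qed
    fix \<omega> :: "real ^ 'n"
    define \<tau> \<sigma> \<xi> where "\<tau> = \<omega> \<bullet> d" and "\<sigma> = \<omega> \<bullet> e" and "\<xi> = \<omega> - \<tau> *\<^sub>R d - \<sigma> *\<^sub>R e"
    have xi: "d \<bullet> \<xi> = 0" "e \<bullet> \<xi> = 0"
      using e inner_d_self by (auto simp: \<xi>_def \<tau>_def \<sigma>_def inner_diff_right inner_commute)
    have "h x * exp (\<i> * of_real (\<omega> \<bullet> x)) = u x * ramp_wave a \<tau> (x \<bullet> d) * indicator {x. x \<bullet> e > b1} x
        * exp (\<i> * of_real (\<sigma> * (x \<bullet> e)) + \<i> * of_real (x \<bullet> \<xi>))" for x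
    proof -
      have "\<omega> \<bullet> x = \<tau> * (x \<bullet> d) + (\<sigma> * (x \<bullet> e) + x \<bullet> \<xi>)"
        by (simp add: \<xi>_def inner_diff_right inner_commute)
      then show ?thesis by (simp add: h_def r_def ramp_wave_def exp_add distrib_left)
    qed
    then show "(LINT x|lborel. h x * exp (\<i> * of_real (\<omega> \<bullet> x))) = 0"
      using corner_integral_zero[OF a(1,3) b(1) b1(1) R1 corner half cqt _ Vqt
          ramp_wave(1) ramp_wave(2) ramp_wave(3) e xi] V[OF nq]
      by (simp add: qt_def)
  qed
  then show ?thesis using a(2) b1(2) x0e by (auto simp: h_def r_def s0_def min_def split: if_splits)
qed

lemma zero_on_positive_side:
  assumes "\<And>x. norm x \<ge> R0 \<Longrightarrow> V x = q (x \<bullet> d)" "x0 \<bullet> d > 0" "norm x0 > R0"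
  shows "u x0 = 0"
  using halfspace_zero[OF assms(1), of x0] corner_zero[OF assms(1,2) _ assms(3)]
  by (cases "x0 \<bullet> d > R0") auto

end

section \<open>Assembly of both half spaces; the separating hyperplane and the sphere by
  continuity\<close>

theorem theorem7p2p1:
  fixes R0 lam eps :: real
    and k :: "'n::finite"
    and q :: "real \<Rightarrow> complex"
    and u :: "real ^ 'n \<Rightarrow> complex"
  assumes "R0 > 0" and "lam > 0" and "eps > 0"
    and "continuous_on {x :: real ^ 'n. norm x \<ge> R0} (\<lambda>x. q (x $ k))"
    and "\<And>x :: real ^ 'n. norm x \<ge> R0 \<Longrightarrow> norm (q (x $ k)) \<le> lam\<^sup>2"
    and "C2_on {x. norm x \<ge> R0} u"
    and "\<And>x. norm x \<ge> R0 \<Longrightarrow> laplacian_within {x. norm x \<ge> R0} u x - q (x $ k) * u x = 0"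
    and "\<exists>C::real. \<forall>x. norm x \<ge> R0 \<longrightarrow> norm (u x) \<le> C * exp (- (lam + eps) * norm x)"
  shows "\<forall>x. norm x \<ge> R0 \<longrightarrow> u x = 0"
proof (intro allI impI)
  fix x :: "real ^ 'n" assume x: "R0 \<le> norm x"
  define V where "V x = q (x $ k)" for x :: "real ^ 'n"
  obtain C where C: "\<And>x. norm x \<ge> R0 \<Longrightarrow> norm (u x) \<le> C * exp (- (lam + eps) * norm x)"
    using assms(8) by blast
  have weak: "weak_solution R0 V u"
    by (rule C2_on_weak_solution) (use assms(6,7) in \<open>auto simp: V_def\<close>)
  have cu: "continuous_on {x. norm x \<ge> R0} u" using C2_on_continuous(1)[OF assms(6)] .
  have cV: "continuous_on {x. norm x \<ge> R0} V" using assms(4) by (simp add: V_def[abs_def])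
  have VQ: "norm (V x) \<le> lam\<^sup>2" if "norm x \<ge> R0" for x using assms(5)[OF that] by (simp add: V_def)
  interpret pos: decaying_solution u V "axis k 1" R0 lam eps C
    by unfold_locales (use assms(1-3) weak cu cV VQ C in \<open>auto simp: norm_axis_1\<close>)
  interpret neg: decaying_solution u V "- axis k 1" R0 lam eps C
    by unfold_locales (use assms(1-3) weak cu cV VQ C in \<open>auto simp: norm_axis_1\<close>)
  have generic: "u y = 0" if "norm y > R0" "y $ k \<noteq> 0" for y
  proof (cases "y $ k > 0")
    case True
    show ?thesis
      by (rule pos.zero_on_positive_side[of q]) (use True that in \<open>auto simp: V_def inner_axis\<close>)
  next
    case False
    show ?thesis
      by (rule neg.zero_on_positive_side[of "\<lambda>s. q (- s)"]) (use False that in \<open>auto simp: V_def inner_axis\<close>)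
  qed
  \<comment> \<open>Moving x along v leaves both exceptional sets: on the hyperplane the axis
    direction is orthogonal to x and increases the norm, elsewhere the radial direction keeps the
    coordinate nonzero.\<close>
  define v where "v = (if x $ k = 0 then axis k 1 else x)"
  define X where "X n = x + (1 / real (Suc n)) *\<^sub>R v" for n
  have X0: "u (X n) = 0" "norm (X n) > R0" for n
  proof -
    have "norm (X n) > R0 \<and> X n $ k \<noteq> 0"
    proof (cases "x $ k = 0")
      case True
      have "(norm (X n))\<^sup>2 = (norm x)\<^sup>2 + (1 / real (Suc n))\<^sup>2"
        unfolding power2_norm_eq_inner using True
        by (simp add: X_def v_def inner_add_left inner_add_right
            inner_axis inner_axis' inner_axis_axis power2_eq_square)
      then have "(norm x)\<^sup>2 < (norm (X n))\<^sup>2" by simp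
      then have "norm x < norm (X n)" by (rule power2_less_imp_less) simp
      then show ?thesis using True x by (simp add: X_def v_def axis_def)
    next
      case False
      have e: "X n = (1 + 1 / real (Suc n)) *\<^sub>R x" using False by (simp add: X_def v_def algebra_simps)
      have p: "norm x > 0" using x assms(1) by linarith
      have "norm (X n) = (1 + 1 / real (Suc n)) * norm x" unfolding e norm_scaleR by simp
      also have "\<dots> > 1 * norm x" using p by (intro mult_strict_right_mono) auto
      finally have "norm (X n) > norm x" by simp
      moreover have "0 < 1 + 1 / real (Suc n)" by (simp add: add_pos_pos)
      ultimately show ?thesis using x False unfolding e vector_scaleR_component by auto
    qed
    then show "u (X n) = 0" "norm (X n) > R0" using generic by auto
  qed
  have "X \<longlonglongrightarrow> x + 0 *\<^sub>R v"
    unfolding X_def by (intro tendsto_intros LIMSEQ_inverse_real_of_nat[unfolded inverse_eq_divide])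
  then have "(\<lambda>n. u (X n)) \<longlonglongrightarrow> u x"
    by (intro continuous_on_tendsto_compose[OF cu]) (use x X0(2) in \<open>auto intro!: always_eventually less_imp_le\<close>)
  then show "u x = 0" by (simp add: X0 LIMSEQ_const_iff)
qed

end
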